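(* Consider the two-user Gaussian multiple-access wiretap channel without feedback described in the context, with power constraints $P_1,P_2>0$ and noise variances $\sigma_1^2,\sigma_2^2>0$. Its secrecy capacity region $\mathcal{C}_{s,gmac}$ satisfies $\mathcal{C}_{s,gmac}\subseteq\mathcal{C}^{out}_{s,gmac}$, where, writing $M=\max\{\alpha_1P_1,\alpha_2P_2\}$ and $D=\sigma_1^2+\sigma_2^2+M+\beta(P_1+P_2-M)$, \[ \mathcal{C}^{out}_{s,gmac}=\bigcup_{0\le\alpha_1,\alpha_2,\beta\le1}\Big\{(R_1\ge0,R_2\ge0):\ R_1\le\tfrac12\log\Big(1+\tfrac{\alpha_1P_1}{\sigma_1^2}\Big)-\tfrac12\log\Big(\tfrac{D}{\sigma_1^2+\sigma_2^2+\alpha_2P_2}\Big), \] \[ R_2\le\tfrac12\log\Big(1+\tfrac{\alpha_2P_2}{\sigma_1^2}\Big)-\tfrac12\log\Big(\tfrac{D}{\sigma_1^2+\sigma_2^2+\alpha_1P_1}\Big),\ R_1+R_2\le\tfrac12\log\Big(1+\tfrac{P_1+P_2}{\sigma_1^2}\Big)-\tfrac12\log\Big(1+\tfrac{P_1+P_2}{\sigma_1^2+\sigma_2^2}\Big)\Big\}. \]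
   Context: All logarithms are base 2. Channel (GMAC-WT without feedback): for $i=1,\dots,N$, $Y_i=X_{1,i}+X_{2,i}+\eta_{1,i}$ (legitimate receiver) and $Z_i=Y_i+\eta_{2,i}$ (wiretapper), where $\eta_{1,i}\sim\mathcal N(0,\sigma_1^2)$ and $\eta_{2,i}\sim\mathcal N(0,\sigma_2^2)$ are i.i.d. over $i$, mutually independent, and independent of the messages. Messages $W_1,W_2$ are independent, $W_j$ uniform on $\{1,\dots,|\mathcal W_j|\}$. For $j=1,2$, the input $X_{j,i}$ is a (possibly stochastic) function of $W_j$ only, subject to $\frac1N\sum_{i=1}^N E[X_{j,i}^2]\le P_j$. The receiver outputs $(\hat W_1,\hat W_2)=\psi(Y^N)$; $P_e$ is the average probability that $\psi(Y^N)\neq(W_1,W_2)$. The equivocation is $\Delta=\frac1N H(W_1,W_2\mid Z^N)$. A pair $(R_1,R_2)$ is achievable with perfect weak secrecy if for every $\epsilon>0$ and all sufficiently large $N$ there exist encoders and a decoder with $\frac{\log|\mathcal W_j|}{N}=R_j$ ($j=1,2$), $\Delta\ge R_1+R_2-\epsilon$ and $P_e\le\epsilon$. $\mathcal{C}_{s,gmac}$ is the set of all such pairs. *)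

theory Defs
  imports "HOL-Probability.Probability"
begin

text \<open>Two-user Gaussian multiple-access wiretap channel (GMAC-WT) without feedback.
  Block length N; length-N real vectors are functions nat => real of which only the
  indices i < N matter; the measurable space of such vectors is the finite product
  PiM over {..<N}. sig1, sig2 are the noise standard deviations (variances sig1^2, sig2^2).\<close>

definition vec_space :: "nat \<Rightarrow> (nat \<Rightarrow> real) measure" where
  "vec_space N = Pi\<^sub>M {..<N} (\<lambda>_. borel)"

definition leb_vec :: "nat \<Rightarrow> (nat \<Rightarrow> real) measure" where
  "leb_vec N = Pi\<^sub>M {..<N} (\<lambda>_. lborel)"

definition iid_gauss :: "nat \<Rightarrow> real \<Rightarrow> (nat \<Rightarrow> real) measure" where
  "iid_gauss N sig = Pi\<^sub>M {..<N} (\<lambda>_. density lborel (normal_density 0 sig))"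

definition msg_input_space :: "nat \<Rightarrow> (nat \<times> (nat \<Rightarrow> real)) measure" where
  "msg_input_space N = count_space UNIV \<Otimes>\<^sub>M vec_space N"

definition chan_Y :: "nat \<Rightarrow> ('a \<Rightarrow> nat \<Rightarrow> real) \<Rightarrow> ('a \<Rightarrow> nat \<Rightarrow> real) \<Rightarrow> ('a \<Rightarrow> nat \<Rightarrow> real)
    \<Rightarrow> 'a \<Rightarrow> nat \<Rightarrow> real" where
  "chan_Y N X1 X2 n1 = (\<lambda>\<omega>. restrict (\<lambda>i. X1 \<omega> i + X2 \<omega> i + n1 \<omega> i) {..<N})"

definition chan_Z :: "nat \<Rightarrow> ('a \<Rightarrow> nat \<Rightarrow> real) \<Rightarrow> ('a \<Rightarrow> nat \<Rightarrow> real) \<Rightarrow> ('a \<Rightarrow> nat \<Rightarrow> real)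
    \<Rightarrow> ('a \<Rightarrow> nat \<Rightarrow> real) \<Rightarrow> 'a \<Rightarrow> nat \<Rightarrow> real" where
  "chan_Z N X1 X2 n1 n2 = (\<lambda>\<omega>. restrict (\<lambda>i. X1 \<omega> i + X2 \<omega> i + n1 \<omega> i + n2 \<omega> i) {..<N})"

text \<open>A length-N code for the GMAC-WT with message set sizes m1, m2, realised on a
  probability space M: messages W1, W2 uniform on {1..m1}, {1..m2}; channel inputs X1, X2
  (X_j a possibly stochastic function of W_j only, i.e. the pairs (W_j, X_j^N) are
  independent of each other and of the noises); noise vectors n1, n2 i.i.d. Gaussian,
  mutually independent and independent of (messages, inputs); power constraints;
  decoder psi measurable.\<close>
definition gmac_wt_code ::
  "'a measure \<Rightarrow> nat \<Rightarrow> real \<Rightarrow> real \<Rightarrow> real \<Rightarrow> real \<Rightarrow> nat \<Rightarrow> nat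
   \<Rightarrow> ('a \<Rightarrow> nat) \<Rightarrow> ('a \<Rightarrow> nat) \<Rightarrow> ('a \<Rightarrow> nat \<Rightarrow> real) \<Rightarrow> ('a \<Rightarrow> nat \<Rightarrow> real)
   \<Rightarrow> ('a \<Rightarrow> nat \<Rightarrow> real) \<Rightarrow> ('a \<Rightarrow> nat \<Rightarrow> real) \<Rightarrow> ((nat \<Rightarrow> real) \<Rightarrow> nat \<times> nat) \<Rightarrow> bool" where
  "gmac_wt_code M N P1 P2 sig1 sig2 m1 m2 W1 W2 X1 X2 n1 n2 psi \<longleftrightarrow>
     prob_space M \<and>
     W1 \<in> M \<rightarrow>\<^sub>M count_space UNIV \<and> W2 \<in> M \<rightarrow>\<^sub>M count_space UNIV \<and>
     (\<forall>i. (\<lambda>\<omega>. X1 \<omega> i) \<in> borel_measurable M \<and> (\<lambda>\<omega>. X2 \<omega> i) \<in> borel_measurable M \<and>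
          (\<lambda>\<omega>. n1 \<omega> i) \<in> borel_measurable M \<and> (\<lambda>\<omega>. n2 \<omega> i) \<in> borel_measurable M) \<and>
     (\<forall>w. measure M {\<omega> \<in> space M. W1 \<omega> = w} = (if w \<in> {1..m1} then 1 / real m1 else 0)) \<and>
     (\<forall>w. measure M {\<omega> \<in> space M. W2 \<omega> = w} = (if w \<in> {1..m2} then 1 / real m2 else 0)) \<and>
     distr M (msg_input_space N \<Otimes>\<^sub>M msg_input_space N \<Otimes>\<^sub>M vec_space N \<Otimes>\<^sub>M vec_space N)
       (\<lambda>\<omega>. ((W1 \<omega>, restrict (X1 \<omega>) {..<N}), (W2 \<omega>, restrict (X2 \<omega>) {..<N}),
              restrict (n1 \<omega>) {..<N}, restrict (n2 \<omega>) {..<N}))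
     = distr M (msg_input_space N) (\<lambda>\<omega>. (W1 \<omega>, restrict (X1 \<omega>) {..<N})) \<Otimes>\<^sub>M
       distr M (msg_input_space N) (\<lambda>\<omega>. (W2 \<omega>, restrict (X2 \<omega>) {..<N})) \<Otimes>\<^sub>M
       distr M (vec_space N) (\<lambda>\<omega>. restrict (n1 \<omega>) {..<N}) \<Otimes>\<^sub>M
       distr M (vec_space N) (\<lambda>\<omega>. restrict (n2 \<omega>) {..<N}) \<and>
     distr M (vec_space N) (\<lambda>\<omega>. restrict (n1 \<omega>) {..<N}) = iid_gauss N sig1 \<and>
     distr M (vec_space N) (\<lambda>\<omega>. restrict (n2 \<omega>) {..<N}) = iid_gauss N sig2 \<and>
     (\<forall>i<N. integrable M (\<lambda>\<omega>. (X1 \<omega> i)\<^sup>2) \<and> integrable M (\<lambda>\<omega>. (X2 \<omega> i)\<^sup>2)) \<and>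
     (1 / real N) * (\<Sum>i<N. integral\<^sup>L M (\<lambda>\<omega>. (X1 \<omega> i)\<^sup>2)) \<le> P1 \<and>
     (1 / real N) * (\<Sum>i<N. integral\<^sup>L M (\<lambda>\<omega>. (X2 \<omega> i)\<^sup>2)) \<le> P2 \<and>
     psi \<in> vec_space N \<rightarrow>\<^sub>M count_space UNIV"

definition gmac_Pe :: "'a measure \<Rightarrow> nat \<Rightarrow> ('a \<Rightarrow> nat) \<Rightarrow> ('a \<Rightarrow> nat) \<Rightarrow> ('a \<Rightarrow> nat \<Rightarrow> real)
   \<Rightarrow> ('a \<Rightarrow> nat \<Rightarrow> real) \<Rightarrow> ('a \<Rightarrow> nat \<Rightarrow> real) \<Rightarrow> ((nat \<Rightarrow> real) \<Rightarrow> nat \<times> nat) \<Rightarrow> real" where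
  "gmac_Pe M N W1 W2 X1 X2 n1 psi =
     measure M {\<omega> \<in> space M. psi (chan_Y N X1 X2 n1 \<omega>) \<noteq> (W1 \<omega>, W2 \<omega>)}"

definition gmac_equivocation :: "'a measure \<Rightarrow> nat \<Rightarrow> ('a \<Rightarrow> nat) \<Rightarrow> ('a \<Rightarrow> nat) \<Rightarrow> ('a \<Rightarrow> nat \<Rightarrow> real)
   \<Rightarrow> ('a \<Rightarrow> nat \<Rightarrow> real) \<Rightarrow> ('a \<Rightarrow> nat \<Rightarrow> real) \<Rightarrow> ('a \<Rightarrow> nat \<Rightarrow> real) \<Rightarrow> real" where
  "gmac_equivocation M N W1 W2 X1 X2 n1 n2 =
     (1 / real N) * prob_space.conditional_entropy M 2 (count_space UNIV) (leb_vec N)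
        (\<lambda>\<omega>. (W1 \<omega>, W2 \<omega>)) (chan_Z N X1 X2 n1 n2)"

text \<open>Achievability with perfect weak secrecy. The underlying probability space ranges
  over measures on the (arbitrary) type 'a, which is made explicit by the 'a itself argument.\<close>
definition achievable_gmac ::
  "'a itself \<Rightarrow> real \<Rightarrow> real \<Rightarrow> real \<Rightarrow> real \<Rightarrow> real \<Rightarrow> real \<Rightarrow> bool" where
  "achievable_gmac _ P1 P2 sig1 sig2 R1 R2 \<longleftrightarrow>
     (\<forall>\<epsilon>>0. \<exists>N0. \<forall>N\<ge>N0. \<exists>(M :: 'a measure) m1 m2 W1 W2 X1 X2 n1 n2 psi.
        gmac_wt_code M N P1 P2 sig1 sig2 m1 m2 W1 W2 X1 X2 n1 n2 psi \<and>
        log 2 (real m1) / real N = R1 \<and> log 2 (real m2) / real N = R2 \<and>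
        gmac_equivocation M N W1 W2 X1 X2 n1 n2 \<ge> R1 + R2 - \<epsilon> \<and>
        gmac_Pe M N W1 W2 X1 X2 n1 psi \<le> \<epsilon>)"

definition C_s_gmac :: "'a itself \<Rightarrow> real \<Rightarrow> real \<Rightarrow> real \<Rightarrow> real \<Rightarrow> (real \<times> real) set" where
  "C_s_gmac t P1 P2 sig1 sig2 = {(R1, R2). achievable_gmac t P1 P2 sig1 sig2 R1 R2}"

text \<open>Outer bound region; s1 = sig1^2, s2 = sig2^2 are the noise variances.\<close>
definition C_out_gmac :: "real \<Rightarrow> real \<Rightarrow> real \<Rightarrow> real \<Rightarrow> (real \<times> real) set" where
  "C_out_gmac P1 P2 s1 s2 =
     (\<Union>a1\<in>{0..1}. \<Union>a2\<in>{0..1}. \<Union>b\<in>{0..1}.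
       let Mx = max (a1 * P1) (a2 * P2);
           D = s1 + s2 + Mx + b * (P1 + P2 - Mx)
       in {(R1, R2). 0 \<le> R1 \<and> 0 \<le> R2 \<and>
            R1 \<le> 1/2 * log 2 (1 + a1 * P1 / s1) - 1/2 * log 2 (D / (s1 + s2 + a2 * P2)) \<and>
            R2 \<le> 1/2 * log 2 (1 + a2 * P2 / s1) - 1/2 * log 2 (D / (s1 + s2 + a1 * P1)) \<and>
            R1 + R2 \<le> 1/2 * log 2 (1 + (P1 + P2) / s1) - 1/2 * log 2 (1 + (P1 + P2) / (s1 + s2))})"

end

theory Submission
  imports Defs
begin

text \<open>The largest of the regions in the union is the one for \<open>\<alpha>\<^sub>1 = \<alpha>\<^sub>2 = 1\<close>, \<open>\<beta> = 0\<close>, so it suffices to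
  bound the rates by its three constraints. No entropy power inequality is needed: with
  \<open>s1 = \<sigma>\<^sub>1\<^sup>2\<close> and \<open>s = \<sigma>\<^sub>1\<^sup>2 + \<sigma>\<^sub>2\<^sup>2\<close>, secrecy and Fano give, up to vanishing terms,
  \<open>N (R1 + R2) \<le> I(X1,X2;Y|Z)\<close>, \<open>N R1 \<le> I(X1;Y|X2,Z) + I(X2;Z|X1)\<close> and \<open>N R2 \<le> I(X2;Y|X1)\<close>; the
  conditional terms are bounded through the linear estimate of \<open>Y\<close> from \<open>Z\<close>, the others through the
  maximal entropy of Gaussians. Each bound is derived directly, without differential entropies, as
  Gibbs' inequality \<open>E ln (dQ/dP) \<le> 0\<close> for the true law \<open>P\<close> of messages, inputs and outputs and an
  explicit test law \<open>Q\<close> built from Gaussian kernels and the decoder.\<close>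

subsection \<open>Gaussian vectors\<close>

text \<open>Why that point gives the largest region: \<open>D\<close> is least for
  \<open>b = 0\<close>, and then the bound on \<open>R1\<close> is half the logarithm of the smaller
  of \<open>(s1 + a1 * P1) / s1\<close> and
  \<open>(s1 + a1 * P1) * (s + a2 * P2) / (s1 * (s + a1 * P1))\<close>. Both grow with
  \<open>a1\<close> and \<open>a2\<close>, because s1 < s. The maximum in \<open>D\<close> thus
  subjects each rate to two bounds, a secrecy bound and the plain single-user converse, and both
  have to be proved. In the test laws of the secrecy bounds, dQ/dP contains the factor p(z) /
  p(w,z). Its expected logarithm is the equivocation itself, so Gibbs' inequality bounds the
  equivocation without any chain rule. The logarithm of a Gaussian kernel is quadratic, so only
  second moments enter, and a single variance for all coordinates fits an average power constraint:
  no per-letter bound and no concavity argument arises. The obstacle is integrability. The inputs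
  are arbitrary, so the output densities are general Gaussian mixtures, and the integrability of
  their logarithms has to come out of Gibbs' inequality itself.\<close>

definition gauss_vec :: "nat \<Rightarrow> real \<Rightarrow> (nat \<Rightarrow> real) \<Rightarrow> real" where
  "gauss_vec N \<sigma> x = (\<Prod>i<N. normal_density 0 \<sigma> (x i))"

lemma gauss_vec_pos: "\<sigma> > 0 \<Longrightarrow> gauss_vec N \<sigma> x > 0"
  unfolding gauss_vec_def by (intro prod_pos) (auto intro: normal_density_pos)

lemma gauss_vec_nonneg [simp]: "gauss_vec N \<sigma> x \<ge> 0"
  unfolding gauss_vec_def by (intro prod_nonneg) auto

lemma gauss_vec_cong: "(\<And>i. i < N \<Longrightarrow> x i = y i) \<Longrightarrow> gauss_vec N \<sigma> x = gauss_vec N \<sigma> y"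
  unfolding gauss_vec_def by (intro prod.cong) auto

text \<open>The hypothesis is coordinatewise and stops at \<open>N\<close> because arguments such as
  \<open>\<lambda>i. y i - a i\<close> need not be extensional, hence need not be points of
  \<open>leb_vec N\<close>.\<close>

lemma borel_measurable_gauss_vec [measurable (raw)]:
  assumes "\<And>i. i < N \<Longrightarrow> (\<lambda>\<omega>. F \<omega> i) \<in> borel_measurable M"
  shows "(\<lambda>\<omega>. gauss_vec N \<sigma> (F \<omega>)) \<in> borel_measurable M"
  unfolding gauss_vec_def
proof (intro borel_measurable_prod)
  fix i assume "i \<in> {..<N}"
  then have [measurable]: "(\<lambda>\<omega>. F \<omega> i) \<in> borel_measurable M" using assms by simp
  show "(\<lambda>\<omega>. normal_density 0 \<sigma> (F \<omega> i)) \<in> borel_measurable M" by measurable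
qed

lemma ln_gauss_vec:
  assumes "\<sigma> > 0"
  shows "ln (gauss_vec N \<sigma> x) = - (real N / 2) * ln (2 * pi * \<sigma>\<^sup>2) - (\<Sum>i<N. (x i)\<^sup>2) / (2 * \<sigma>\<^sup>2)"
proof -
  have "ln (normal_density 0 \<sigma> t) = - (1/2) * ln (2 * pi * \<sigma>\<^sup>2) - t\<^sup>2 / (2 * \<sigma>\<^sup>2)" for t
    using assms unfolding normal_density_def
    by (simp add: ln_mult ln_div ln_sqrt)
  moreover have "ln (gauss_vec N \<sigma> x) = (\<Sum>i<N. ln (normal_density 0 \<sigma> (x i)))"
    unfolding gauss_vec_def using normal_density_pos[OF assms, of 0]
    by (subst ln_prod) (auto simp: less_imp_neq[symmetric])
  ultimately show ?thesis
    by (simp only: sum_subtractf sum_divide_distrib[symmetric] sum_constant card_lessThan)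
qed

text \<open>The peak value of the density. It makes the output densities finite and bounds their
  logarithms from above.\<close>

lemma gauss_vec_le:
  assumes "\<sigma> > 0"
  shows "gauss_vec N \<sigma> x \<le> exp (- (real N / 2) * ln (2 * pi * \<sigma>\<^sup>2))"
proof -
  have "gauss_vec N \<sigma> x = exp (ln (gauss_vec N \<sigma> x))"
    using gauss_vec_pos[OF assms] by simp
  also have "\<dots> \<le> exp (- (real N / 2) * ln (2 * pi * \<sigma>\<^sup>2))"
    unfolding ln_gauss_vec[OF assms] by (simp add: sum_nonneg)
  finally show ?thesis .
qed

text \<open>Codes live on \<open>vec_space\<close>, densities on \<open>leb_vec\<close>;
  measurability passes between them through this equality.\<close>

lemma sets_leb_vec: "sets (leb_vec N) = sets (vec_space N)"
  unfolding leb_vec_def vec_space_def by (intro sets_PiM_cong) auto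

lemma sigma_finite_leb_vec: "sigma_finite_measure (leb_vec N)"
proof -
  interpret product_sigma_finite "\<lambda>_::nat. lborel :: real measure" by standard
  interpret finite_product_sigma_finite "\<lambda>_::nat. lborel :: real measure" "{..<N}" by standard simp
  show ?thesis unfolding leb_vec_def by (rule sigma_finite_measure_axioms)
qed

lemma nn_integral_leb_vec_prod:
  assumes "\<And>i. i < N \<Longrightarrow> f i \<in> borel_measurable borel"
  shows "(\<integral>\<^sup>+ x. (\<Prod>i<N. f i (x i)) \<partial>leb_vec N) = (\<Prod>i<N. \<integral>\<^sup>+ t. f i t \<partial>lborel)"
proof -
  interpret product_sigma_finite "\<lambda>_::nat. lborel :: real measure" by standard
  show ?thesis unfolding leb_vec_def using assms by (intro product_nn_integral_prod) auto
qed

lemma measurable_leb_vec_component [measurable (raw)]: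
  "i < N \<Longrightarrow> (\<lambda>x. x i) \<in> borel_measurable (leb_vec N)"
  unfolding leb_vec_def using measurable_component_singleton[of i "{..<N}" "\<lambda>_. lborel :: real measure"] by simp

lemma measurable_leb_vec_component' [measurable_dest]:
  assumes f: "f \<in> measurable M' (leb_vec N)" and g: "g \<in> measurable K M'" and i: "i < N"
  shows "(\<lambda>x. f (g x) i) \<in> borel_measurable K"
  using measurable_compose[OF measurable_compose[OF g f] measurable_leb_vec_component[OF i]] .

lemma measurable_restrict_leb_vec:
  assumes "\<And>i. i < N \<Longrightarrow> (\<lambda>\<omega>. f \<omega> i) \<in> borel_measurable M"
  shows "(\<lambda>\<omega>. restrict (f \<omega>) {..<N}) \<in> measurable M (leb_vec N)"
  unfolding leb_vec_def using assms by (intro measurable_restrict) auto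

lemma nn_integral_gauss_vec:
  assumes "\<sigma> > 0"
  shows "(\<integral>\<^sup>+ y. ennreal (gauss_vec N \<sigma> (\<lambda>i. y i - a i)) \<partial>leb_vec N) = 1"
proof -
  have "(\<integral>\<^sup>+ y. ennreal (gauss_vec N \<sigma> (\<lambda>i. y i - a i)) \<partial>leb_vec N)
      = (\<integral>\<^sup>+ y. (\<Prod>i<N. ennreal (normal_density 0 \<sigma> (y i - a i))) \<partial>leb_vec N)"
    unfolding gauss_vec_def by (simp add: prod_ennreal)
  also have "\<dots> = (\<Prod>i<N. \<integral>\<^sup>+ t. ennreal (normal_density 0 \<sigma> (t - a i)) \<partial>lborel)"
    by (intro nn_integral_leb_vec_prod) measurable
  also have "\<dots> = (\<Prod>i<N. 1)"
  proof (intro prod.cong refl)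
    fix i
    have "normal_density 0 \<sigma> (t - a i) = normal_density (a i) \<sigma> t" for t
      by (simp add: normal_density_def)
    then have "(\<integral>\<^sup>+ t. ennreal (normal_density 0 \<sigma> (t - a i)) \<partial>lborel) = ennreal (\<integral> t. normal_density (a i) \<sigma> t \<partial>lborel)"
      using assms by (simp only:) (intro nn_integral_eq_integral integrable_normal_density AE_I2 normal_density_nonneg)
    also have "\<dots> = 1" using assms by simp
    finally show "(\<integral>\<^sup>+ t. ennreal (normal_density 0 \<sigma> (t - a i)) \<partial>lborel) = 1" .
  qed
  finally show ?thesis by simp
qed

text \<open>Integrating out \<open>y\<close> in the chain input, \<open>Y\<close>, \<open>Z\<close>:
  coordinate by coordinate, a convolution of centred normal densities.\<close>

lemma gauss_vec_convolution:
  assumes "\<sigma> > 0" "\<tau> > 0"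
  shows "(\<integral>\<^sup>+ y. ennreal (gauss_vec N \<sigma> (\<lambda>i. y i - a i)) * ennreal (gauss_vec N \<tau> (\<lambda>i. z i - y i)) \<partial>leb_vec N)
     = ennreal (gauss_vec N (sqrt (\<sigma>\<^sup>2 + \<tau>\<^sup>2)) (\<lambda>i. z i - a i))"
proof -
  have "(\<integral>\<^sup>+ y. ennreal (gauss_vec N \<sigma> (\<lambda>i. y i - a i)) * ennreal (gauss_vec N \<tau> (\<lambda>i. z i - y i)) \<partial>leb_vec N)
      = (\<integral>\<^sup>+ y. (\<Prod>i<N. ennreal (normal_density 0 \<sigma> (y i - a i) * normal_density 0 \<tau> (z i - y i))) \<partial>leb_vec N)"
    unfolding gauss_vec_def by (simp add: prod_ennreal ennreal_mult' prod.distrib prod_nonneg)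
  also have "\<dots> = (\<Prod>i<N. \<integral>\<^sup>+ t. ennreal (normal_density 0 \<sigma> (t - a i) * normal_density 0 \<tau> (z i - t)) \<partial>lborel)"
    by (intro nn_integral_leb_vec_prod) measurable
  also have "\<dots> = (\<Prod>i<N. ennreal (normal_density 0 (sqrt (\<sigma>\<^sup>2 + \<tau>\<^sup>2)) (z i - a i)))"
  proof (intro prod.cong refl)
    fix i
    \<comment> \<open>Shifting \<open>t\<close> by \<open>a i\<close> turns the integral into the
      standard convolution evaluated at \<open>z i - a i\<close>.\<close>
    have "(\<integral>\<^sup>+ t. ennreal (normal_density 0 \<sigma> (t - a i) * normal_density 0 \<tau> (z i - t)) \<partial>lborel)
        = (\<integral>\<^sup>+ t. ennreal (normal_density 0 \<sigma> ((a i + 1 * t) - a i) * normal_density 0 \<tau> (z i - (a i + 1 * t))) \<partial>lborel)"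
      by (subst nn_integral_real_affine[where c=1 and t="a i"]) auto
    also have "\<dots> = (\<integral>\<^sup>+ t. ennreal (normal_density 0 \<tau> ((z i - a i) - t) * normal_density 0 \<sigma> t) \<partial>lborel)"
      by (intro nn_integral_cong) (simp add: mult.commute algebra_simps)
    also have "\<dots> = ennreal (normal_density 0 (sqrt (\<tau>\<^sup>2 + \<sigma>\<^sup>2)) (z i - a i))"
      using fun_cong[OF conv_normal_density_zero_mean[OF assms(2,1)], of "z i - a i"] by simp
    finally show "(\<integral>\<^sup>+ t. ennreal (normal_density 0 \<sigma> (t - a i) * normal_density 0 \<tau> (z i - t)) \<partial>lborel)
        = ennreal (normal_density 0 (sqrt (\<sigma>\<^sup>2 + \<tau>\<^sup>2)) (z i - a i))" by (simp add: add.commute)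
  qed
  also have "\<dots> = ennreal (gauss_vec N (sqrt (\<sigma>\<^sup>2 + \<tau>\<^sup>2)) (\<lambda>i. z i - a i))"
    unfolding gauss_vec_def by (simp add: prod_ennreal)
  finally show ?thesis .
qed

text \<open>A product measure is determined by its values on boxes, and there the integral of the
  product density factorises.\<close>

lemma iid_gauss_eq_density:
  assumes "\<sigma> > 0"
  shows "iid_gauss N \<sigma> = density (leb_vec N) (\<lambda>x. ennreal (gauss_vec N \<sigma> x))"
proof -
  have [simp]: "prob_space (density lborel (\<lambda>x. ennreal (normal_density 0 \<sigma> x)))"
    using assms by (rule prob_space_normal_density)
  interpret product_sigma_finite "\<lambda>_::nat. density lborel (\<lambda>x. ennreal (normal_density 0 \<sigma> x))"
    by (simp add: product_sigma_finite_def prob_space_imp_sigma_finite)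
  have [measurable]: "(\<lambda>x. gauss_vec N \<sigma> x) \<in> borel_measurable (leb_vec N)"
    by (rule borel_measurable_gauss_vec) measurable
  show ?thesis
    unfolding iid_gauss_def
  proof (rule PiM_eqI[symmetric])
    show "sets (density (leb_vec N) (\<lambda>x. ennreal (gauss_vec N \<sigma> x)))
        = sets (Pi\<^sub>M {..<N} (\<lambda>_. density lborel (\<lambda>x. ennreal (normal_density 0 \<sigma> x))))"
      unfolding leb_vec_def sets_density by (intro sets_PiM_cong) auto
    fix A assume A: "\<And>i. i \<in> {..<N} \<Longrightarrow> A i \<in> sets (density lborel (\<lambda>x. ennreal (normal_density 0 \<sigma> x)))"
    then have A'[measurable]: "i < N \<Longrightarrow> A i \<in> sets borel" for i by simp
    have B: "Pi\<^sub>E {..<N} A \<in> sets (leb_vec N)"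
      unfolding leb_vec_def using A by (intro sets_PiM_I_finite) auto
    have ind: "indicator (Pi\<^sub>E {..<N} A) x = (\<Prod>i<N. indicator (A i) (x i) :: ennreal)"
      if "x \<in> space (leb_vec N)" for x
    proof -
      have "x \<in> extensional {..<N}" using that by (auto simp: leb_vec_def space_PiM PiE_iff)
      then show ?thesis
        by (auto simp: indicator_def PiE_iff prod_zero_iff split: if_splits)
    qed
    have "emeasure (density (leb_vec N) (\<lambda>x. ennreal (gauss_vec N \<sigma> x))) (Pi\<^sub>E {..<N} A)
       = (\<integral>\<^sup>+ x. ennreal (gauss_vec N \<sigma> x) * indicator (Pi\<^sub>E {..<N} A) x \<partial>leb_vec N)"
      using B by (subst emeasure_density) auto
    also have "\<dots> = (\<integral>\<^sup>+ x. (\<Prod>i<N. ennreal (normal_density 0 \<sigma> (x i)) * indicator (A i) (x i)) \<partial>leb_vec N)"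
      by (intro nn_integral_cong) (simp add: ind gauss_vec_def prod_ennreal prod.distrib)
    also have "\<dots> = (\<Prod>i<N. \<integral>\<^sup>+ t. ennreal (normal_density 0 \<sigma> t) * indicator (A i) t \<partial>lborel)"
      by (intro nn_integral_leb_vec_prod) (simp add: A')
    also have "\<dots> = (\<Prod>i<N. emeasure (density lborel (\<lambda>x. ennreal (normal_density 0 \<sigma> x))) (A i))"
      by (intro prod.cong refl, subst emeasure_density) (auto simp: A')
    finally show "emeasure (density (leb_vec N) (\<lambda>x. ennreal (gauss_vec N \<sigma> x))) (Pi\<^sub>E {..<N} A)
       = (\<Prod>i<N. emeasure (density lborel (\<lambda>x. ennreal (normal_density 0 \<sigma> x))) (A i))" .
  qed simp
qed

text \<open>Translation invariance of Lebesgue measure, checked on boxes. The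
  \<open>restrict\<close> brings the translated vector back among the extensional functions.\<close>

lemma nn_integral_leb_vec_shift:
  assumes F: "F \<in> borel_measurable (leb_vec N)"
  shows "(\<integral>\<^sup>+ y. F (restrict (\<lambda>i. a i + y i) {..<N}) \<partial>leb_vec N) = (\<integral>\<^sup>+ y. F y \<partial>leb_vec N)"
proof -
  interpret product_sigma_finite "\<lambda>_::nat. lborel :: real measure" by standard
  let ?T = "\<lambda>y. restrict (\<lambda>i. a i + y i) {..<N}"
  have T[measurable]: "?T \<in> measurable (leb_vec N) (leb_vec N)"
    by (rule measurable_restrict_leb_vec) measurable
  have "distr (leb_vec N) (leb_vec N) ?T = Pi\<^sub>M {..<N} (\<lambda>_. lborel)"
  proof (rule PiM_eqI)
    fix A assume A: "\<And>i. i \<in> {..<N} \<Longrightarrow> A i \<in> sets (lborel::real measure)"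
    then have A'[measurable]: "i < N \<Longrightarrow> A i \<in> sets borel" for i by simp
    have B: "Pi\<^sub>E {..<N} A \<in> sets (leb_vec N)"
      unfolding leb_vec_def using A by (intro sets_PiM_I_finite) auto
    have "emeasure (distr (leb_vec N) (leb_vec N) ?T) (Pi\<^sub>E {..<N} A)
        = (\<integral>\<^sup>+ y. indicator (Pi\<^sub>E {..<N} A) (?T y) \<partial>leb_vec N)"
      using B by (subst nn_integral_distr[OF T, symmetric]) auto
    also have "\<dots> = (\<integral>\<^sup>+ y. (\<Prod>i<N. indicator (A i) (a i + y i)) \<partial>leb_vec N)"
      by (intro nn_integral_cong) (auto simp: indicator_def PiE_iff prod_zero_iff split: if_splits)
    also have "\<dots> = (\<Prod>i<N. \<integral>\<^sup>+ t. indicator (A i) (a i + t) \<partial>lborel)"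
      by (intro nn_integral_leb_vec_prod) (simp add: A')
    also have "\<dots> = (\<Prod>i<N. emeasure lborel (A i))"
    proof (intro prod.cong refl)
      fix i assume "i \<in> {..<N}"
      then have "A i \<in> sets borel" by simp
      then have "(\<integral>\<^sup>+ t. indicator (A i) t \<partial>lborel) = (\<integral>\<^sup>+ t. indicator (A i) (a i + 1 * t) \<partial>lborel)"
        by (subst nn_integral_real_affine[where c=1 and t="a i"]) auto
      then show "(\<integral>\<^sup>+ t. indicator (A i) (a i + t) \<partial>lborel) = emeasure lborel (A i)"
        using \<open>A i \<in> sets borel\<close> by simp
    qed
    finally show "emeasure (distr (leb_vec N) (leb_vec N) ?T) (Pi\<^sub>E {..<N} A) = (\<Prod>i<N. emeasure lborel (A i))" .
  qed (simp_all add: leb_vec_def)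
  then have *: "distr (leb_vec N) (leb_vec N) ?T = leb_vec N" by (simp add: leb_vec_def)
  have "(\<integral>\<^sup>+ y. F y \<partial>leb_vec N) = (\<integral>\<^sup>+ y. F y \<partial>distr (leb_vec N) (leb_vec N) ?T)" by (simp add: *)
  also have "\<dots> = (\<integral>\<^sup>+ y. F (?T y) \<partial>leb_vec N)" using F by (intro nn_integral_distr) auto
  finally show ?thesis ..
qed

text \<open>This is how additive noise becomes a channel density: the output \<open>a + n\<close>
  has density \<open>gauss_vec\<close> centred at \<open>a\<close>.\<close>

lemma nn_integral_iid_gauss_shift:
  assumes "\<sigma> > 0" and F[measurable]: "F \<in> borel_measurable (leb_vec N)"
  shows "(\<integral>\<^sup>+ n. F (restrict (\<lambda>i. a i + n i) {..<N}) \<partial>iid_gauss N \<sigma>)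
    = (\<integral>\<^sup>+ y. ennreal (gauss_vec N \<sigma> (\<lambda>i. y i - a i)) * F y \<partial>leb_vec N)"
proof -
  let ?T = "\<lambda>y. restrict (\<lambda>i. a i + y i) {..<N}"
  have T[measurable]: "?T \<in> measurable (leb_vec N) (leb_vec N)"
    by (rule measurable_restrict_leb_vec) measurable
  have [measurable]: "(\<lambda>x. gauss_vec N \<sigma> x) \<in> borel_measurable (leb_vec N)"
    by (rule borel_measurable_gauss_vec) measurable
  have [measurable]: "(\<lambda>x. gauss_vec N \<sigma> (\<lambda>i. x i - a i)) \<in> borel_measurable (leb_vec N)"
    by (rule borel_measurable_gauss_vec) measurable
  have "(\<integral>\<^sup>+ n. F (?T n) \<partial>iid_gauss N \<sigma>) = (\<integral>\<^sup>+ n. ennreal (gauss_vec N \<sigma> n) * F (?T n) \<partial>leb_vec N)"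
    unfolding iid_gauss_eq_density[OF assms(1)] by (intro nn_integral_density) measurable
  also have "\<dots> = (\<integral>\<^sup>+ n. ennreal (gauss_vec N \<sigma> (\<lambda>i. ?T n i - a i)) * F (?T n) \<partial>leb_vec N)"
    by (intro nn_integral_cong arg_cong2[where f="(*)"] arg_cong[where f=ennreal] gauss_vec_cong refl) simp
  also have "\<dots> = (\<integral>\<^sup>+ y. ennreal (gauss_vec N \<sigma> (\<lambda>i. y i - a i)) * F y \<partial>leb_vec N)"
    by (rule nn_integral_leb_vec_shift) measurable
  finally show ?thesis .
qed

text \<open>\<open>ln g\<close> is split because only \<open>B\<close> is known to be integrable beforehand; since \<open>A\<close> is bounded below, its integrability is part of the conclusion.\<close>
lemma (in prob_space) gibbs_inequality:
  fixes A B :: "'a \<Rightarrow> real"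
  assumes g[measurable]: "g \<in> borel_measurable M" and A[measurable]: "A \<in> borel_measurable M"
    and B: "integrable M B"
    and mass: "(\<integral>\<^sup>+\<omega>. ennreal (g \<omega>) \<partial>M) \<le> 1"
    and pos: "AE \<omega> in M. 0 < g \<omega>"
    and lower: "AE \<omega> in M. c \<le> A \<omega>"
    and split: "AE \<omega> in M. ln (g \<omega>) = A \<omega> + B \<omega>"
  shows "integrable M A" "expectation A + expectation B \<le> 0"
proof -
  have gi: "integrable M g"
    using mass pos by (intro integrableI_nonneg) (auto simp: less_top[symmetric] top_unique elim!: eventually_mono)
  have "ennreal (expectation g) \<le> 1"
    using mass by (subst nn_integral_eq_integral[OF gi, symmetric]) (use pos in \<open>auto elim!: eventually_mono\<close>)
  then have g1: "expectation g \<le> 1" by simp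
  have le: "AE \<omega> in M. A \<omega> \<le> g \<omega> - 1 - B \<omega>"
    using pos split
  proof eventually_elim
    case (elim \<omega>)
    then show ?case using ln_le_minus_one[of "g \<omega>"] by simp
  qed
  show Ai: "integrable M A"
  proof (rule Bochner_Integration.integrable_bound)
    show "integrable M (\<lambda>\<omega>. \<bar>g \<omega> - 1 - B \<omega>\<bar> + \<bar>c\<bar>)" using gi B by auto
    show "AE \<omega> in M. norm (A \<omega>) \<le> norm (\<bar>g \<omega> - 1 - B \<omega>\<bar> + \<bar>c\<bar>)"
      using le lower by eventually_elim auto
  qed measurable
  have "expectation A \<le> expectation (\<lambda>\<omega>. g \<omega> - 1 - B \<omega>)"
    using Ai gi B le by (intro integral_mono_AE) auto
  also have "\<dots> = expectation g - 1 - expectation B"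
    using gi B by (simp add: prob_space)
  finally show "expectation A + expectation B \<le> 0" using g1 by simp
qed

section \<open>Integrals over events that fix a message\<close>

lemma borel_measurable_indicator_singleton [measurable (raw)]:
  "W \<in> measurable M (count_space UNIV) \<Longrightarrow> (\<lambda>\<omega>. indicator {w} (W \<omega>) :: ennreal) \<in> borel_measurable M"
  by (rule measurable_compose[where N="count_space UNIV"]) auto

text \<open>A vanishing integral would force the indicator to vanish almost everywhere, as the
  weight is positive everywhere. This keeps the output densities positive, so that they may be
  divided by and have logarithms.\<close>

lemma nn_integral_indicator_weight_pos:
  assumes [measurable]: "W \<in> measurable M (count_space UNIV)" "h \<in> borel_measurable M"
    and W: "(\<integral>\<^sup>+\<omega>. indicator {w} (W \<omega>) \<partial>M) > 0" and h: "\<And>\<omega>. \<omega> \<in> space M \<Longrightarrow> h \<omega> > (0::ennreal)"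
  shows "(\<integral>\<^sup>+\<omega>. indicator {w} (W \<omega>) * h \<omega> \<partial>M) > 0"
proof -
  have "(\<integral>\<^sup>+\<omega>. indicator {w} (W \<omega>) * h \<omega> \<partial>M) \<noteq> 0"
  proof
    assume "(\<integral>\<^sup>+\<omega>. indicator {w} (W \<omega>) * h \<omega> \<partial>M) = 0"
    then have "AE \<omega> in M. indicator {w} (W \<omega>) * h \<omega> = 0"
      by (subst (asm) nn_integral_0_iff_AE) auto
    then have "AE \<omega> in M. indicator {w} (W \<omega>) = (0::ennreal)"
      using AE_space by eventually_elim (use h in fastforce)
    then have "(\<integral>\<^sup>+\<omega>. indicator {w} (W \<omega>) \<partial>M) = 0"
      by (subst nn_integral_0_iff_AE) auto
    then show False using W by simp
  qed
  then show ?thesis by (simp add: zero_less_iff_neq_zero)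
qed

text \<open>Turns a random message into a finite sum over its values, so that densities given the
  messages can be treated one value at a time.\<close>

lemma (in prob_space) nn_integral_split_finite_range:
  assumes W[measurable]: "W \<in> measurable M (count_space UNIV)"
    and fin: "finite S" and S: "AE \<omega> in M. W \<omega> \<in> S"
    and F: "\<And>w. w \<in> S \<Longrightarrow> F w \<in> borel_measurable M"
  shows "(\<integral>\<^sup>+\<omega>. F (W \<omega>) \<omega> \<partial>M) = (\<Sum>w\<in>S. \<integral>\<^sup>+\<omega>. indicator {w} (W \<omega>) * F w \<omega> \<partial>M)"
proof -
  have "(\<Sum>w\<in>S. \<integral>\<^sup>+\<omega>. indicator {w} (W \<omega>) * F w \<omega> \<partial>M)
      = (\<integral>\<^sup>+\<omega>. (\<Sum>w\<in>S. indicator {w} (W \<omega>) * F w \<omega>) \<partial>M)"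
    using F by (intro nn_integral_sum[symmetric]) auto
  also have "\<dots> = (\<integral>\<^sup>+\<omega>. F (W \<omega>) \<omega> \<partial>M)"
  proof (rule nn_integral_cong_AE, use S in eventually_elim)
    case (elim \<omega>)
    have "(\<Sum>w\<in>S. indicator {w} (W \<omega>) * F w \<omega>) = (\<Sum>w\<in>S. if w = W \<omega> then F w \<omega> else 0)"
      by (intro sum.cong) (auto simp: indicator_def)
    then show ?case using elim fin by simp
  qed
  finally show ?thesis ..
qed

lemma nn_integral_swap:
  assumes "sigma_finite_measure A" "sigma_finite_measure B"
    and "(\<lambda>(x, y). f x y) \<in> borel_measurable (A \<Otimes>\<^sub>M B)"
  shows "(\<integral>\<^sup>+ x. \<integral>\<^sup>+ y. f x y \<partial>B \<partial>A) = (\<integral>\<^sup>+ y. \<integral>\<^sup>+ x. f x y \<partial>A \<partial>B)"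
proof -
  interpret pair_sigma_finite A B using assms(1,2) by (rule pair_sigma_finite.intro)
  show ?thesis using Fubini'[OF assms(3)] by simp
qed

subsection \<open>The law of a code\<close>

text \<open>\<open>law\<close> expresses independence of the users by two independent samples \<open>a\<close>, \<open>b\<close> of the same
  probability space, from which \<open>(W1, X1)\<close> and \<open>(W2, X2)\<close> are taken; the noise is given by the densities of
  \<open>Y\<close> given the inputs and of \<open>Z\<close> given \<open>Y\<close>.\<close>
locale gmac_law = prob_space M for M :: "'a measure" +
  fixes N m1 m2 :: nat and \<sigma>1 \<sigma>2 :: real and W1 W2 :: "'a \<Rightarrow> nat"
    and X1 X2 Y Z :: "'a \<Rightarrow> nat \<Rightarrow> real"
  assumes \<sigma>1_pos: "\<sigma>1 > 0" and \<sigma>2_pos: "\<sigma>2 > 0"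
    and m1_pos: "m1 > 0" and m2_pos: "m2 > 0"
    and W1_measurable [measurable]: "W1 \<in> measurable M (count_space UNIV)"
    and W2_measurable [measurable]: "W2 \<in> measurable M (count_space UNIV)"
    and X1_measurable [measurable]: "X1 \<in> measurable M (leb_vec N)"
    and X2_measurable [measurable]: "X2 \<in> measurable M (leb_vec N)"
    and Y_measurable [measurable]: "Y \<in> measurable M (leb_vec N)"
    and Z_measurable [measurable]: "Z \<in> measurable M (leb_vec N)"
    and W1_range: "AE \<omega> in M. W1 \<omega> \<in> {1..m1}"
    and W2_range: "AE \<omega> in M. W2 \<omega> \<in> {1..m2}"
    and W1_uniform: "\<And>w. w \<in> {1..m1} \<Longrightarrow> (\<integral>\<^sup>+\<omega>. indicator {w} (W1 \<omega>) \<partial>M) = ennreal (1 / real m1)"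
    and W2_uniform: "\<And>w. w \<in> {1..m2} \<Longrightarrow> (\<integral>\<^sup>+\<omega>. indicator {w} (W2 \<omega>) \<partial>M) = ennreal (1 / real m2)"
    and law: "\<And>G. G \<in> borel_measurable (count_space UNIV \<Otimes>\<^sub>M leb_vec N \<Otimes>\<^sub>M count_space UNIV \<Otimes>\<^sub>M
          leb_vec N \<Otimes>\<^sub>M leb_vec N \<Otimes>\<^sub>M leb_vec N) \<Longrightarrow>
      (\<integral>\<^sup>+\<omega>. G (W1 \<omega>, X1 \<omega>, W2 \<omega>, X2 \<omega>, Y \<omega>, Z \<omega>) \<partial>M) =
      (\<integral>\<^sup>+a. \<integral>\<^sup>+b. \<integral>\<^sup>+y. \<integral>\<^sup>+z. ennreal (gauss_vec N \<sigma>1 (\<lambda>i. y i - (X1 a i + X2 b i))) *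
          ennreal (gauss_vec N \<sigma>2 (\<lambda>i. z i - y i)) * G (W1 a, X1 a, W2 b, X2 b, y, z)
          \<partial>leb_vec N \<partial>leb_vec N \<partial>M \<partial>M)"
begin

abbreviation "L \<equiv> leb_vec N"
abbreviation "\<sigma> \<equiv> sqrt (\<sigma>1\<^sup>2 + \<sigma>2\<^sup>2)"
abbreviation "\<Phi>1 y a b \<equiv> gauss_vec N \<sigma>1 (\<lambda>i. y i - (X1 a i + X2 b i))"
abbreviation "\<Phi>2 z y \<equiv> gauss_vec N \<sigma>2 (\<lambda>i. z i - y i)"
abbreviation "\<Phi> z a b \<equiv> gauss_vec N \<sigma> (\<lambda>i. z i - (X1 a i + X2 b i))"

lemma \<sigma>_pos: "\<sigma> > 0" using \<sigma>1_pos by (simp add: add_pos_nonneg)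

lemmas leb_sigma_finite = sigma_finite_leb_vec
lemmas M_sigma_finite = sigma_finite_measure_axioms

lemma law_split:
  assumes G[measurable]: "G \<in> borel_measurable (count_space UNIV \<Otimes>\<^sub>M L \<Otimes>\<^sub>M count_space UNIV \<Otimes>\<^sub>M L \<Otimes>\<^sub>M L \<Otimes>\<^sub>M L)"
  shows "(\<integral>\<^sup>+\<omega>. G (W1 \<omega>, X1 \<omega>, W2 \<omega>, X2 \<omega>, Y \<omega>, Z \<omega>) \<partial>M) =
      (\<Sum>u\<in>{1..m1}. \<Sum>v\<in>{1..m2}. \<integral>\<^sup>+a. indicator {u} (W1 a) * (\<integral>\<^sup>+b. indicator {v} (W2 b) *
          (\<integral>\<^sup>+y. \<integral>\<^sup>+z. ennreal (\<Phi>1 y a b) * ennreal (\<Phi>2 z y) * G (u, X1 a, v, X2 b, y, z)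
          \<partial>L \<partial>L) \<partial>M) \<partial>M)"
proof -
  interpret L: sigma_finite_measure L by (rule leb_sigma_finite)
  let ?F = "\<lambda>u v a b. \<integral>\<^sup>+y. \<integral>\<^sup>+z. ennreal (\<Phi>1 y a b) * ennreal (\<Phi>2 z y) * G (u, X1 a, v, X2 b, y, z) \<partial>L \<partial>L"
  have [measurable]: "(\<lambda>b. ?F u v a b) \<in> borel_measurable M" if "a \<in> space M" for u v a
    using that by measurable
  have [measurable]: "(\<lambda>(a, b). ?F u v a b) \<in> borel_measurable (M \<Otimes>\<^sub>M M)" for u v
    by measurable
  have "(\<integral>\<^sup>+\<omega>. G (W1 \<omega>, X1 \<omega>, W2 \<omega>, X2 \<omega>, Y \<omega>, Z \<omega>) \<partial>M) =
      (\<integral>\<^sup>+a. \<integral>\<^sup>+b. ?F (W1 a) (W2 b) a b \<partial>M \<partial>M)" by (rule law[OF G])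
  also have "\<dots> = (\<integral>\<^sup>+a. (\<Sum>v\<in>{1..m2}. \<integral>\<^sup>+b. indicator {v} (W2 b) * ?F (W1 a) v a b \<partial>M) \<partial>M)"
    by (intro nn_integral_cong nn_integral_split_finite_range[OF W2_measurable _ W2_range]) auto
  also have "\<dots> = (\<Sum>u\<in>{1..m1}. \<integral>\<^sup>+a. indicator {u} (W1 a) * (\<Sum>v\<in>{1..m2}. \<integral>\<^sup>+b. indicator {v} (W2 b) * ?F u v a b \<partial>M) \<partial>M)"
    by (intro nn_integral_split_finite_range[OF W1_measurable _ W1_range]) auto
  also have "\<dots> = (\<Sum>u\<in>{1..m1}. \<Sum>v\<in>{1..m2}. \<integral>\<^sup>+a. indicator {u} (W1 a) * (\<integral>\<^sup>+b. indicator {v} (W2 b) * ?F u v a b \<partial>M) \<partial>M)"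
    by (intro sum.cong refl, simp only: sum_distrib_left, intro nn_integral_sum) measurable
  finally show ?thesis .
qed

text \<open>\<open>kE v\<close> is the density of \<open>X2\<close> plus the total noise on the event \<open>W2 = v\<close>, and \<open>fE u v\<close> that of \<open>Z\<close>
  on \<open>W1 = u, W2 = v\<close>; neither is normalised by the probability of the event.\<close>
definition kE :: "nat \<Rightarrow> (nat \<Rightarrow> real) \<Rightarrow> ennreal" where
  "kE v u = (\<integral>\<^sup>+b. indicator {v} (W2 b) * ennreal (gauss_vec N \<sigma> (\<lambda>i. u i - X2 b i)) \<partial>M)"

definition fE :: "nat \<Rightarrow> nat \<Rightarrow> (nat \<Rightarrow> real) \<Rightarrow> ennreal" where
  "fE u v z = (\<integral>\<^sup>+a. indicator {u} (W1 a) * kE v (\<lambda>i. z i - X1 a i) \<partial>M)"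

lemma kE_measurable [measurable (raw)]:
  assumes "\<And>i. i < N \<Longrightarrow> (\<lambda>\<omega>. F \<omega> i) \<in> borel_measurable M'"
  shows "(\<lambda>\<omega>. kE v (F \<omega>)) \<in> borel_measurable M'"
proof -
  have [measurable]: "(\<lambda>x. gauss_vec N \<sigma> (\<lambda>i. F (fst x) i - X2 (snd x) i)) \<in> borel_measurable (M' \<Otimes>\<^sub>M M)"
  proof (rule borel_measurable_gauss_vec)
    fix i assume [measurable]: "i < N"
    then have [measurable]: "(\<lambda>\<omega>. F \<omega> i) \<in> borel_measurable M'" using assms by simp
    show "(\<lambda>x. F (fst x) i - X2 (snd x) i) \<in> borel_measurable (M' \<Otimes>\<^sub>M M)" using \<open>i < N\<close> by measurable
  qed
  show ?thesis unfolding kE_def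
    by (rule borel_measurable_nn_integral) (simp add: split_beta')
qed

lemma fE_measurable [measurable (raw)]:
  assumes "\<And>i. i < N \<Longrightarrow> (\<lambda>\<omega>. F \<omega> i) \<in> borel_measurable M'"
  shows "(\<lambda>\<omega>. fE u v (F \<omega>)) \<in> borel_measurable M'"
proof -
  have [measurable]: "(\<lambda>x. kE v (\<lambda>i. F (fst x) i - X1 (snd x) i)) \<in> borel_measurable (M' \<Otimes>\<^sub>M M)"
  proof (rule kE_measurable)
    fix i assume [measurable]: "i < N"
    then have [measurable]: "(\<lambda>\<omega>. F \<omega> i) \<in> borel_measurable M'" using assms by simp
    show "(\<lambda>x. F (fst x) i - X1 (snd x) i) \<in> borel_measurable (M' \<Otimes>\<^sub>M M)" using \<open>i < N\<close> by measurable
  qed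
  show ?thesis unfolding fE_def
    by (rule borel_measurable_nn_integral) (simp add: split_beta')
qed


text \<open>The marginal of \<open>law_split\<close> without \<open>Y\<close>: by convolution the
  two noises merge into one of variance
  \<open>\<sigma>1\<^sup>2 + \<sigma>2\<^sup>2\<close>.\<close>

lemma law_Z:
  assumes G[measurable]: "G \<in> borel_measurable (count_space UNIV \<Otimes>\<^sub>M L \<Otimes>\<^sub>M count_space UNIV \<Otimes>\<^sub>M L \<Otimes>\<^sub>M L)"
  shows "(\<integral>\<^sup>+\<omega>. G (W1 \<omega>, X1 \<omega>, W2 \<omega>, X2 \<omega>, Z \<omega>) \<partial>M) =
      (\<Sum>u\<in>{1..m1}. \<Sum>v\<in>{1..m2}. \<integral>\<^sup>+a. indicator {u} (W1 a) * (\<integral>\<^sup>+b. indicator {v} (W2 b) *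
          (\<integral>\<^sup>+z. ennreal (\<Phi> z a b) * G (u, X1 a, v, X2 b, z) \<partial>L) \<partial>M) \<partial>M)"
proof -
  interpret L: sigma_finite_measure L by (rule leb_sigma_finite)
  let ?G = "\<lambda>(u, x1, v, x2, y, z). G (u, x1, v, x2, z)"
  have "(\<integral>\<^sup>+y. \<integral>\<^sup>+z. ennreal (\<Phi>1 y a b) * ennreal (\<Phi>2 z y) * G (u, X1 a, v, X2 b, z) \<partial>L \<partial>L)
      = (\<integral>\<^sup>+z. ennreal (\<Phi> z a b) * G (u, X1 a, v, X2 b, z) \<partial>L)"
    if [measurable]: "a \<in> space M" "b \<in> space M" for a b u v
  proof -
    have "(\<integral>\<^sup>+y. \<integral>\<^sup>+z. ennreal (\<Phi>1 y a b) * ennreal (\<Phi>2 z y) * G (u, X1 a, v, X2 b, z) \<partial>L \<partial>L)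
       = (\<integral>\<^sup>+z. \<integral>\<^sup>+y. ennreal (\<Phi>1 y a b) * ennreal (\<Phi>2 z y) * G (u, X1 a, v, X2 b, z) \<partial>L \<partial>L)"
      using that by (intro nn_integral_swap leb_sigma_finite) measurable
    also have "\<dots> = (\<integral>\<^sup>+z. (\<integral>\<^sup>+y. ennreal (\<Phi>1 y a b) * ennreal (\<Phi>2 z y) \<partial>L) * G (u, X1 a, v, X2 b, z) \<partial>L)"
      using that by (intro nn_integral_cong nn_integral_multc) measurable
    also have "\<dots> = (\<integral>\<^sup>+z. ennreal (\<Phi> z a b) * G (u, X1 a, v, X2 b, z) \<partial>L)"
      by (simp only: gauss_vec_convolution[OF \<sigma>1_pos \<sigma>2_pos])
    finally show ?thesis .
  qed
  moreover have "(\<integral>\<^sup>+\<omega>. G (W1 \<omega>, X1 \<omega>, W2 \<omega>, X2 \<omega>, Z \<omega>) \<partial>M) =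
      (\<Sum>u\<in>{1..m1}. \<Sum>v\<in>{1..m2}. \<integral>\<^sup>+a. indicator {u} (W1 a) * (\<integral>\<^sup>+b. indicator {v} (W2 b) *
          (\<integral>\<^sup>+y. \<integral>\<^sup>+z. ennreal (\<Phi>1 y a b) * ennreal (\<Phi>2 z y) * G (u, X1 a, v, X2 b, z) \<partial>L \<partial>L) \<partial>M) \<partial>M)"
    using law_split[of ?G] by simp
  ultimately show ?thesis
    by (simp cong: nn_integral_cong_simp)
qed

text \<open>Averaging the Gaussian around the inputs over \<open>X2\<close> and then over
  \<open>X1\<close> produces \<open>kE\<close> and then \<open>fE\<close>; this identifies
  \<open>fE\<close> as the joint density of messages and \<open>Z\<close>.\<close>

lemma law_WZ:
  assumes G[measurable]: "\<And>u v. (\<lambda>z. G u v z) \<in> borel_measurable L"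
  shows "(\<integral>\<^sup>+\<omega>. G (W1 \<omega>) (W2 \<omega>) (Z \<omega>) \<partial>M) = (\<Sum>u\<in>{1..m1}. \<Sum>v\<in>{1..m2}. \<integral>\<^sup>+z. fE u v z * G u v z \<partial>L)"
proof -
  interpret L: sigma_finite_measure L by (rule leb_sigma_finite)
  have [measurable]: "(\<lambda>(u, x1, v, x2, z). G u v z) \<in> borel_measurable (count_space UNIV \<Otimes>\<^sub>M L \<Otimes>\<^sub>M count_space UNIV \<Otimes>\<^sub>M L \<Otimes>\<^sub>M L)"
    by measurable
  have "(\<integral>\<^sup>+a. indicator {u} (W1 a) * (\<integral>\<^sup>+b. indicator {v} (W2 b) *
          (\<integral>\<^sup>+z. ennreal (\<Phi> z a b) * G u v z \<partial>L) \<partial>M) \<partial>M) = (\<integral>\<^sup>+z. fE u v z * G u v z \<partial>L)" for u v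
  proof -
    have *: "(\<integral>\<^sup>+b. indicator {v} (W2 b) * (\<integral>\<^sup>+z. ennreal (\<Phi> z a b) * G u v z \<partial>L) \<partial>M)
       = (\<integral>\<^sup>+z. kE v (\<lambda>i. z i - X1 a i) * G u v z \<partial>L)" if [measurable]: "a \<in> space M" for a
    proof -
      have "(\<integral>\<^sup>+b. indicator {v} (W2 b) * (\<integral>\<^sup>+z. ennreal (\<Phi> z a b) * G u v z \<partial>L) \<partial>M)
        = (\<integral>\<^sup>+b. (\<integral>\<^sup>+z. indicator {v} (W2 b) * (ennreal (\<Phi> z a b) * G u v z) \<partial>L) \<partial>M)"
        using that by (intro nn_integral_cong nn_integral_cmult[symmetric]) measurable
      also have "\<dots> = (\<integral>\<^sup>+z. (\<integral>\<^sup>+b. indicator {v} (W2 b) * (ennreal (\<Phi> z a b) * G u v z) \<partial>M) \<partial>L)"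
        using that by (intro nn_integral_swap leb_sigma_finite M_sigma_finite) measurable
      also have "\<dots> = (\<integral>\<^sup>+z. (\<integral>\<^sup>+b. indicator {v} (W2 b) * ennreal (\<Phi> z a b) \<partial>M) * G u v z \<partial>L)"
        unfolding mult.assoc[symmetric]
        using that by (intro nn_integral_cong nn_integral_multc) measurable
      finally show ?thesis unfolding kE_def by (simp add: diff_diff_eq)
    qed
    have "(\<integral>\<^sup>+a. indicator {u} (W1 a) * (\<integral>\<^sup>+b. indicator {v} (W2 b) *
          (\<integral>\<^sup>+z. ennreal (\<Phi> z a b) * G u v z \<partial>L) \<partial>M) \<partial>M)
        = (\<integral>\<^sup>+a. (\<integral>\<^sup>+z. indicator {u} (W1 a) * (kE v (\<lambda>i. z i - X1 a i) * G u v z) \<partial>L) \<partial>M)"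
      by (intro nn_integral_cong, simp only: *, intro nn_integral_cmult[symmetric]) measurable
    also have "\<dots> = (\<integral>\<^sup>+z. (\<integral>\<^sup>+a. indicator {u} (W1 a) * (kE v (\<lambda>i. z i - X1 a i) * G u v z) \<partial>M) \<partial>L)"
      by (intro nn_integral_swap leb_sigma_finite M_sigma_finite) measurable
    also have "\<dots> = (\<integral>\<^sup>+z. (\<integral>\<^sup>+a. indicator {u} (W1 a) * kE v (\<lambda>i. z i - X1 a i) \<partial>M) * G u v z \<partial>L)"
      unfolding mult.assoc[symmetric]
      by (intro nn_integral_cong nn_integral_multc) measurable
    finally show ?thesis by (simp only: fE_def)
  qed
  then show ?thesis
    using law_Z[of "\<lambda>(u, x1, v, x2, z). G u v z"] by simp
qed

section \<open>Positivity, boundedness and total mass of the output densities\<close>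

lemma kE_pos: "v \<in> {1..m2} \<Longrightarrow> kE v u > 0"
  unfolding kE_def using W2_uniform m2_pos
  by (intro nn_integral_indicator_weight_pos) (auto intro: gauss_vec_pos[OF \<sigma>_pos] simp del: real_sqrt_gt_0_iff)

lemma fE_pos: "u \<in> {1..m1} \<Longrightarrow> v \<in> {1..m2} \<Longrightarrow> fE u v z > 0"
  unfolding fE_def using W1_uniform m1_pos
  by (intro nn_integral_indicator_weight_pos) (auto intro: kE_pos)

definition Kmax :: real where "Kmax = exp (- (real N / 2) * ln (2 * pi * \<sigma>\<^sup>2))"

lemma kE_le: "kE v u \<le> ennreal Kmax"
proof -
  have "kE v u \<le> (\<integral>\<^sup>+b. ennreal Kmax \<partial>M)"
    unfolding kE_def using gauss_vec_le[OF \<sigma>_pos, of N]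
    by (intro nn_integral_mono) (auto simp: indicator_def Kmax_def intro!: ennreal_leI)
  then show ?thesis by (simp add: emeasure_space_1)
qed

lemma fE_le: "fE u v z \<le> ennreal Kmax"
proof -
  have "fE u v z \<le> (\<integral>\<^sup>+b. ennreal Kmax \<partial>M)"
    unfolding fE_def using kE_le
    by (intro nn_integral_mono) (auto simp: indicator_def)
  then show ?thesis by (simp add: emeasure_space_1)
qed

text \<open>Real versions, as logarithms are to be taken. \<open>kE_le\<close> and
  \<open>fE_le\<close> give finiteness, so nothing is lost in the conversion.\<close>

definition k :: "nat \<Rightarrow> (nat \<Rightarrow> real) \<Rightarrow> real" where "k v u = enn2real (kE v u)"
definition f :: "nat \<Rightarrow> nat \<Rightarrow> (nat \<Rightarrow> real) \<Rightarrow> real" where "f u v z = enn2real (fE u v z)"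
definition fZ :: "(nat \<Rightarrow> real) \<Rightarrow> real" where "fZ z = (\<Sum>u\<in>{1..m1}. \<Sum>v\<in>{1..m2}. f u v z)"

lemma ennreal_k: "ennreal (k v u) = kE v u"
  unfolding k_def by (intro ennreal_enn2real) (metis ennreal_less_top kE_le le_less_trans)

lemma ennreal_f: "ennreal (f u v z) = fE u v z"
  unfolding f_def by (intro ennreal_enn2real) (metis ennreal_less_top fE_le le_less_trans)

lemma k_pos: "v \<in> {1..m2} \<Longrightarrow> k v u > 0"
  using kE_pos[of v u] ennreal_k[of v u] by (metis ennreal_0 ennreal_less_zero_iff ennreal_neg leI order_less_irrefl)

lemma f_pos: "u \<in> {1..m1} \<Longrightarrow> v \<in> {1..m2} \<Longrightarrow> f u v z > 0"
  using fE_pos[of u v z] ennreal_f[of u v z] by (metis ennreal_0 ennreal_less_zero_iff ennreal_neg leI order_less_irrefl)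

lemma f_nonneg: "f u v z \<ge> 0" and k_nonneg: "k v w \<ge> 0" unfolding f_def k_def by auto

lemma k_le: "k v u \<le> Kmax"
  using kE_le[of v u] unfolding ennreal_k[symmetric] by (simp add: ennreal_le_iff Kmax_def)

lemma fZ_nonneg: "fZ z \<ge> 0" unfolding fZ_def by (intro sum_nonneg f_nonneg)

lemma f_le_fZ: "u \<in> {1..m1} \<Longrightarrow> v \<in> {1..m2} \<Longrightarrow> f u v z \<le> fZ z"
proof -
  assume uv: "u \<in> {1..m1}" "v \<in> {1..m2}"
  have "f u v z \<le> (\<Sum>v\<in>{1..m2}. f u v z)" using uv by (intro member_le_sum f_nonneg) auto
  also have "\<dots> \<le> fZ z" unfolding fZ_def using uv
    by (intro member_le_sum[where f="\<lambda>u. \<Sum>v\<in>{1..m2}. f u v z"] sum_nonneg f_nonneg) auto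
  finally show ?thesis .
qed

lemma k_measurable [measurable (raw)]:
  assumes V: "V \<in> measurable M' (count_space UNIV)" and F: "\<And>i. i < N \<Longrightarrow> (\<lambda>\<omega>. F \<omega> i) \<in> borel_measurable M'"
  shows "(\<lambda>\<omega>. k (V \<omega>) (F \<omega>)) \<in> borel_measurable M'"
  unfolding k_def
  by (rule borel_measurable_enn2real, rule measurable_compose_countable[OF _ V], rule kE_measurable[OF F])

lemma f_measurable [measurable (raw)]:
  assumes U: "U \<in> measurable M' (count_space UNIV)" and V: "V \<in> measurable M' (count_space UNIV)"
    and F: "\<And>i. i < N \<Longrightarrow> (\<lambda>\<omega>. F \<omega> i) \<in> borel_measurable M'"
  shows "(\<lambda>\<omega>. f (U \<omega>) (V \<omega>) (F \<omega>)) \<in> borel_measurable M'"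
  unfolding f_def
  by (rule borel_measurable_enn2real, rule measurable_compose_countable[OF _ U],
      rule measurable_compose_countable[OF _ V], rule fE_measurable[OF F])

lemma fZ_measurable [measurable (raw)]:
  "(\<And>i. i < N \<Longrightarrow> (\<lambda>\<omega>. F \<omega> i) \<in> borel_measurable M') \<Longrightarrow> (\<lambda>\<omega>. fZ (F \<omega>)) \<in> borel_measurable M'"
  unfolding fZ_def by (intro borel_measurable_sum f_measurable) auto

lemma nn_integral_fZ: "(\<integral>\<^sup>+z. ennreal (fZ z) \<partial>L) = 1"
proof -
  have "1 = (\<Sum>u\<in>{1..m1}. \<Sum>v\<in>{1..m2}. \<integral>\<^sup>+z. fE u v z \<partial>L)"
    using law_WZ[of "\<lambda>_ _ _. 1"] by (simp add: emeasure_space_1)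
  also have "\<dots> = (\<integral>\<^sup>+z. (\<Sum>u\<in>{1..m1}. \<Sum>v\<in>{1..m2}. fE u v z) \<partial>L)"
    by (subst nn_integral_sum) (auto intro!: sum.cong nn_integral_sum[symmetric])
  also have "\<dots> = (\<integral>\<^sup>+z. ennreal (fZ z) \<partial>L)"
    unfolding fZ_def by (simp add: sum_ennreal[symmetric] sum_nonneg f_nonneg ennreal_f)
  finally show ?thesis ..
qed

end

subsection \<open>Test laws for Gibbs' inequality\<close>

text \<open>Tonelli in the shape that \<open>law_split\<close> produces: each integral carries a
  weight in its own variable, typically the indicator of a message.\<close>

lemma nn_integral_swap_weighted:
  assumes "sigma_finite_measure A" "sigma_finite_measure B"
    and [measurable]: "(\<lambda>(x, y). f x y) \<in> borel_measurable (A \<Otimes>\<^sub>M B)"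
      "g \<in> borel_measurable A" "h \<in> borel_measurable B"
  shows "(\<integral>\<^sup>+ x. g x * (\<integral>\<^sup>+ y. h y * f x y \<partial>B) \<partial>A) = (\<integral>\<^sup>+ y. h y * (\<integral>\<^sup>+ x. g x * f x y \<partial>A) \<partial>B)"
proof -
  interpret A: sigma_finite_measure A by fact
  interpret B: sigma_finite_measure B by fact
  have [measurable]: "(\<lambda>p. f (fst p) (snd p)) \<in> borel_measurable (A \<Otimes>\<^sub>M B)" 
    using assms(3) by (simp add: split_beta')
  have [measurable]: "(\<lambda>y. f x y) \<in> borel_measurable B" if "x \<in> space A" for x
    using measurable_Pair2[OF assms(3) that] by simp
  have [measurable]: "(\<lambda>x. f x y) \<in> borel_measurable A" if "y \<in> space B" for y
    using measurable_Pair1[OF assms(3) that] by simp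
  have "(\<integral>\<^sup>+ x. g x * (\<integral>\<^sup>+ y. h y * f x y \<partial>B) \<partial>A) = (\<integral>\<^sup>+ x. (\<integral>\<^sup>+ y. g x * (h y * f x y) \<partial>B) \<partial>A)"
    by (intro nn_integral_cong nn_integral_cmult[symmetric]) measurable
  also have "\<dots> = (\<integral>\<^sup>+ y. (\<integral>\<^sup>+ x. g x * (h y * f x y) \<partial>A) \<partial>B)"
    by (intro nn_integral_swap assms) (simp add: split_beta')
  also have "\<dots> = (\<integral>\<^sup>+ y. (\<integral>\<^sup>+ x. h y * (g x * f x y) \<partial>A) \<partial>B)"
    by (simp add: mult.left_commute)
  also have "\<dots> = (\<integral>\<^sup>+ y. h y * (\<integral>\<^sup>+ x. g x * f x y \<partial>A) \<partial>B)"
    by (intro nn_integral_cong nn_integral_cmult) measurable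
  finally show ?thesis .
qed

text \<open>For fixed \<open>z\<close> this is a Gaussian in \<open>y\<close> centred at
  \<open>m + c * (z - m)\<close>, a linear estimate of \<open>Y\<close> from \<open>Z\<close>. It is
  a probability kernel for every \<open>c\<close>, which leaves \<open>c\<close> free to be
  optimised.\<close>

lemma nn_integral_gauss_vec_affine:
  assumes "\<tau> > 0"
  shows "(\<integral>\<^sup>+ y. ennreal (gauss_vec N \<tau> (\<lambda>i. (y i - m i) - c * (z i - m i))) \<partial>leb_vec N) = 1"
  using nn_integral_gauss_vec[OF assms, of N "\<lambda>i. m i + c * (z i - m i)"]
  by (simp add: diff_diff_eq)

lemma measurable_countable_param:
  fixes U :: "_ \<Rightarrow> nat"
  assumes "\<And>u. r u \<in> measurable L K" "U \<in> measurable M' (count_space UNIV)" "F \<in> measurable M' L"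
  shows "(\<lambda>x. r (U x) (F x)) \<in> measurable M' K"
  by (rule measurable_compose_countable[OF measurable_compose[OF assms(3,1)] assms(2)])

lemma sum_ennreal_uniform:
  assumes "m > 0"
  shows "(\<Sum>v\<in>{1..m}. ennreal (1 / real m)) = 1"
proof -
  have "(\<Sum>v\<in>{1..m}. ennreal (1 / real m)) = ennreal (\<Sum>v\<in>{1..m}. 1 / real m)"
    by (rule sum_ennreal) simp
  also have "\<dots> = 1" using assms by simp
  finally show ?thesis .
qed

context gmac_law
begin

lemma msg_tuple_measurable:
  fixes r :: "nat \<Rightarrow> (nat \<Rightarrow> real) \<Rightarrow> real"
  assumes r: "\<And>u. r u \<in> borel_measurable L"
  shows "(\<lambda>x. r (fst x) (fst (snd (snd (snd (snd x)))))) \<in>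
      borel_measurable (count_space UNIV \<Otimes>\<^sub>M L \<Otimes>\<^sub>M count_space UNIV \<Otimes>\<^sub>M L \<Otimes>\<^sub>M L \<Otimes>\<^sub>M L)"
    and "(\<lambda>x. r (fst (snd (snd x))) (fst (snd (snd (snd (snd x)))))) \<in>
      borel_measurable (count_space UNIV \<Otimes>\<^sub>M L \<Otimes>\<^sub>M count_space UNIV \<Otimes>\<^sub>M L \<Otimes>\<^sub>M L \<Otimes>\<^sub>M L)"
  by (rule measurable_countable_param[OF r], measurable)+

lemma msg_pair_tuple_measurable:
  fixes r :: "nat \<Rightarrow> nat \<Rightarrow> (nat \<Rightarrow> real) \<Rightarrow> real"
  assumes r: "\<And>u v. r u v \<in> borel_measurable L"
  shows "(\<lambda>x. r (fst x) (fst (snd (snd x))) (fst (snd (snd (snd (snd x)))))) \<in>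
      borel_measurable (count_space UNIV \<Otimes>\<^sub>M L \<Otimes>\<^sub>M count_space UNIV \<Otimes>\<^sub>M L \<Otimes>\<^sub>M L \<Otimes>\<^sub>M L)"
  by (rule measurable_compose_countable[where g=fst], rule measurable_countable_param[OF r]) measurable

text \<open>In the following four lemmas the integrand is \<open>dQ/dP\<close>, where \<open>P\<close> is the law of the code and \<open>q\<close>
  denotes the Gaussian kernel with parameter \<open>\<tau>\<close>. Here \<open>Q = p(x1,x2|w,z) p(z) q(y|z) r(w|y)\<close>.\<close>
lemma sum_mass:
  assumes \<tau>: "\<tau> > 0" and r[measurable]: "\<And>u v. r u v \<in> borel_measurable L"
    and r0: "\<And>u v y. r u v y \<ge> 0" and r1: "\<And>y. (\<Sum>u\<in>{1..m1}. \<Sum>v\<in>{1..m2}. r u v y) \<le> 1"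
  shows "(\<integral>\<^sup>+\<omega>. ennreal (gauss_vec N \<sigma> (\<lambda>i. Z \<omega> i - (X1 \<omega> i + X2 \<omega> i)) *
      (gauss_vec N \<tau> (\<lambda>i. (Y \<omega> i - m i) - c * (Z \<omega> i - m i)) * r (W1 \<omega>) (W2 \<omega>) (Y \<omega>) *
      (fZ (Z \<omega>) / f (W1 \<omega>) (W2 \<omega>) (Z \<omega>))) /
      (gauss_vec N \<sigma>1 (\<lambda>i. Y \<omega> i - (X1 \<omega> i + X2 \<omega> i)) * gauss_vec N \<sigma>2 (\<lambda>i. Z \<omega> i - Y \<omega> i))) \<partial>M) \<le> 1"
    (is "?L \<le> 1")
proof -
  interpret L: sigma_finite_measure L by (rule leb_sigma_finite)
  define q where "q y z = gauss_vec N \<tau> (\<lambda>i. (y i - m i) - c * (z i - m i))" for y z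
  define H where "H u v y z = ennreal (q y z * r u v y * (fZ z / f u v z))" for u v y z
  have q0: "q y z \<ge> 0" for y z unfolding q_def by simp
  have [measurable]: "(\<lambda>p. H u v (snd p) (fst p)) \<in> borel_measurable (L \<Otimes>\<^sub>M L)" for u v
    unfolding H_def q_def by measurable
  have [measurable]: "(\<lambda>y. H u v y z) \<in> borel_measurable L" if [measurable]: "z \<in> space L" for u v z
    unfolding H_def q_def by measurable
  have H[measurable]: "(\<lambda>p. H u v (fst p) (snd p)) \<in> borel_measurable (L \<Otimes>\<^sub>M L)" for u v
    unfolding H_def q_def by measurable
  define HH where "HH u v z = (\<integral>\<^sup>+y. H u v y z \<partial>L)" for u v z
  have [measurable]: "(\<lambda>z. HH u v z) \<in> borel_measurable L" for u v
    unfolding HH_def by measurable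
  have Hm: "(\<lambda>(u, x1, v, x2, z). HH u v z) \<in> borel_measurable (count_space UNIV \<Otimes>\<^sub>M L \<Otimes>\<^sub>M count_space UNIV \<Otimes>\<^sub>M L \<Otimes>\<^sub>M L)"
    by measurable
  define G where "G = (\<lambda>(u, x1, v, x2, y, z). ennreal (gauss_vec N \<sigma> (\<lambda>i. z i - (x1 i + x2 i)) *
      (gauss_vec N \<tau> (\<lambda>i. (y i - m i) - c * (z i - m i)) * r u v y * (fZ z / f u v z)) /
      (gauss_vec N \<sigma>1 (\<lambda>i. y i - (x1 i + x2 i)) * gauss_vec N \<sigma>2 (\<lambda>i. z i - y i))))"
  have G: "G \<in> borel_measurable (count_space UNIV \<Otimes>\<^sub>M L \<Otimes>\<^sub>M count_space UNIV \<Otimes>\<^sub>M L \<Otimes>\<^sub>M L \<Otimes>\<^sub>M L)"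
    unfolding G_def using msg_pair_tuple_measurable[OF r, measurable] by measurable
  \<comment> \<open>The denominator of dQ/dP cancels the channel densities of P; the kernel
    \<open>\<Phi>\<close> that remains is the law of \<open>Z\<close> given the inputs.\<close>
  have GH: "ennreal (\<Phi>1 y a b) * ennreal (\<Phi>2 z y) * G (u, X1 a, v, X2 b, y, z) = ennreal (\<Phi> z a b) * H u v y z"
    for u v a b y z
    using gauss_vec_pos[OF \<sigma>1_pos, of N "\<lambda>i. y i - (X1 a i + X2 b i)"] gauss_vec_pos[OF \<sigma>2_pos, of N "\<lambda>i. z i - y i"]
      r0 fZ_nonneg f_nonneg q0
    unfolding G_def H_def q_def by (simp add: ennreal_mult'[symmetric])
  have swap: "(\<integral>\<^sup>+y. \<integral>\<^sup>+z. ennreal (\<Phi> z a b) * H u v y z \<partial>L \<partial>L) = (\<integral>\<^sup>+z. ennreal (\<Phi> z a b) * (\<integral>\<^sup>+y. H u v y z \<partial>L) \<partial>L)"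
    if [measurable]: "a \<in> space M" "b \<in> space M" for u v a b
    using nn_integral_swap_weighted[of L L "\<lambda>y z. H u v y z" "\<lambda>_. 1" "\<lambda>z. ennreal (\<Phi> z a b)"]
    by (simp add: leb_sigma_finite split_beta')
  have "?L = (\<integral>\<^sup>+\<omega>. G (W1 \<omega>, X1 \<omega>, W2 \<omega>, X2 \<omega>, Y \<omega>, Z \<omega>) \<partial>M)" unfolding G_def by simp
  also have "\<dots> = (\<Sum>u\<in>{1..m1}. \<Sum>v\<in>{1..m2}. \<integral>\<^sup>+a. indicator {u} (W1 a) * (\<integral>\<^sup>+b. indicator {v} (W2 b) *
          (\<integral>\<^sup>+y. \<integral>\<^sup>+z. ennreal (\<Phi> z a b) * H u v y z \<partial>L \<partial>L) \<partial>M) \<partial>M)"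
    unfolding law_split[OF G] GH ..
  also have "\<dots> = (\<Sum>u\<in>{1..m1}. \<Sum>v\<in>{1..m2}. \<integral>\<^sup>+a. indicator {u} (W1 a) * (\<integral>\<^sup>+b. indicator {v} (W2 b) *
          (\<integral>\<^sup>+z. ennreal (\<Phi> z a b) * (\<integral>\<^sup>+y. H u v y z \<partial>L) \<partial>L) \<partial>M) \<partial>M)"
    by (simp add: swap cong: nn_integral_cong_simp)
  \<comment> \<open>\<open>law_Z\<close> read from right to left: the integrand no longer involves
    the inputs, so the expression is an expectation over messages and \<open>Z\<close> only, and
    \<open>law_WZ\<close> applies.\<close>
  also have "\<dots> = (\<integral>\<^sup>+\<omega>. (\<integral>\<^sup>+y. H (W1 \<omega>) (W2 \<omega>) y (Z \<omega>) \<partial>L) \<partial>M)"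
    using law_Z[OF Hm] unfolding HH_def by simp
  also have "\<dots> = (\<Sum>u\<in>{1..m1}. \<Sum>v\<in>{1..m2}. \<integral>\<^sup>+z. fE u v z * (\<integral>\<^sup>+y. H u v y z \<partial>L) \<partial>L)"
    by (intro law_WZ) measurable
  also have "\<dots> = (\<Sum>u\<in>{1..m1}. \<Sum>v\<in>{1..m2}. \<integral>\<^sup>+z. ennreal (fZ z) * (\<integral>\<^sup>+y. ennreal (q y z) * ennreal (r u v y) \<partial>L) \<partial>L)"
  proof (intro sum.cong refl nn_integral_cong)
    fix u v z assume uv: "u \<in> {1..m1}" "v \<in> {1..m2}" and [measurable]: "z \<in> space L"
    have "fE u v z * (\<integral>\<^sup>+y. H u v y z \<partial>L) = (\<integral>\<^sup>+y. fE u v z * H u v y z \<partial>L)"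
      by (intro nn_integral_cmult[symmetric]) measurable
    also have "\<dots> = (\<integral>\<^sup>+y. ennreal (fZ z) * (ennreal (q y z) * ennreal (r u v y)) \<partial>L)"
      unfolding H_def ennreal_f[symmetric]
      using f_pos[OF uv, of z] q0 r0 fZ_nonneg[of z] by (simp add: ennreal_mult'[symmetric] mult_ac)
    also have "\<dots> = ennreal (fZ z) * (\<integral>\<^sup>+y. ennreal (q y z) * ennreal (r u v y) \<partial>L)"
      unfolding q_def by (intro nn_integral_cmult) measurable
    finally show "fE u v z * (\<integral>\<^sup>+y. H u v y z \<partial>L) = ennreal (fZ z) * (\<integral>\<^sup>+y. ennreal (q y z) * ennreal (r u v y) \<partial>L)" .
  qed
  also have "\<dots> = (\<integral>\<^sup>+z. (\<Sum>u\<in>{1..m1}. \<Sum>v\<in>{1..m2}. ennreal (fZ z) * (\<integral>\<^sup>+y. ennreal (q y z) * ennreal (r u v y) \<partial>L)) \<partial>L)"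
    unfolding q_def
    by (subst nn_integral_sum, measurable, intro sum.cong refl nn_integral_sum[symmetric]) measurable
  also have "\<dots> = (\<integral>\<^sup>+z. ennreal (fZ z) * (\<integral>\<^sup>+y. ennreal (q y z) * ennreal (\<Sum>u\<in>{1..m1}. \<Sum>v\<in>{1..m2}. r u v y) \<partial>L) \<partial>L)"
  proof (intro nn_integral_cong)
    fix z assume [measurable]: "z \<in> space L"
    have [measurable]: "(\<lambda>y. q y z) \<in> borel_measurable L" unfolding q_def by measurable
    have "(\<Sum>u\<in>{1..m1}. \<Sum>v\<in>{1..m2}. \<integral>\<^sup>+y. ennreal (q y z) * ennreal (r u v y) \<partial>L)
      = (\<integral>\<^sup>+y. (\<Sum>u\<in>{1..m1}. \<Sum>v\<in>{1..m2}. ennreal (q y z) * ennreal (r u v y)) \<partial>L)"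
      by (subst nn_integral_sum, measurable, intro sum.cong refl nn_integral_sum[symmetric]) measurable
    also have "\<dots> = (\<integral>\<^sup>+y. ennreal (q y z) * ennreal (\<Sum>u\<in>{1..m1}. \<Sum>v\<in>{1..m2}. r u v y) \<partial>L)"
      by (simp add: sum_distrib_left[symmetric] sum_ennreal r0 sum_nonneg)
    finally show "(\<Sum>u\<in>{1..m1}. \<Sum>v\<in>{1..m2}. ennreal (fZ z) * (\<integral>\<^sup>+y. ennreal (q y z) * ennreal (r u v y) \<partial>L))
      = ennreal (fZ z) * (\<integral>\<^sup>+y. ennreal (q y z) * ennreal (\<Sum>u\<in>{1..m1}. \<Sum>v\<in>{1..m2}. r u v y) \<partial>L)"
      by (simp add: sum_distrib_left[symmetric])
  qed
  \<comment> \<open>After the cancellation of \<open>f\<close>, the total mass is that of p(z)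
    q(y|z) r(w|y): \<open>r\<close> sums to at most one, and the other two factors integrate to
    one.\<close>
  also have "\<dots> \<le> (\<integral>\<^sup>+z. ennreal (fZ z) * (\<integral>\<^sup>+y. ennreal (q y z) * 1 \<partial>L) \<partial>L)"
    using r1 by (intro nn_integral_mono mult_left_mono) (auto simp: ennreal_le_1)
  also have "\<dots> = 1"
    unfolding q_def using nn_integral_gauss_vec_affine[OF \<tau>, of N m c] nn_integral_fZ by simp
  finally show ?thesis .
qed

text \<open>\<open>Q = p(x1|w1,w2,z) p(w2,x2) q(y|z,x2) p(z) r(w1|y)\<close>: integrate out \<open>x1\<close> first, then sum over \<open>w1\<close>.\<close>
lemma user1_mass:
  assumes \<tau>: "\<tau> > 0" and r[measurable]: "\<And>u. r u \<in> borel_measurable L"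
    and r0: "\<And>u y. r u y \<ge> 0" and r1: "\<And>y. (\<Sum>u\<in>{1..m1}. r u y) \<le> 1"
  shows "(\<integral>\<^sup>+\<omega>. ennreal (k (W2 \<omega>) (\<lambda>i. Z \<omega> i - X1 \<omega> i) *
      (gauss_vec N \<tau> (\<lambda>i. (Y \<omega> i - X2 \<omega> i) - c * (Z \<omega> i - X2 \<omega> i)) * r (W1 \<omega>) (Y \<omega>) *
      (fZ (Z \<omega>) / f (W1 \<omega>) (W2 \<omega>) (Z \<omega>))) /
      (gauss_vec N \<sigma>1 (\<lambda>i. Y \<omega> i - (X1 \<omega> i + X2 \<omega> i)) * gauss_vec N \<sigma>2 (\<lambda>i. Z \<omega> i - Y \<omega> i))) \<partial>M) \<le> 1"
    (is "?L \<le> 1")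
proof -
  interpret L: sigma_finite_measure L by (rule leb_sigma_finite)
  define q where "q b y z = gauss_vec N \<tau> (\<lambda>i. (y i - X2 b i) - c * (z i - X2 b i))" for b y z
  have q0: "q b y z \<ge> 0" for b y z unfolding q_def by simp
  define H where "H u v b y z = ennreal (q b y z * r u y * (fZ z / f u v z))" for u v b y z
  define G where "G = (\<lambda>(u, x1, v, x2, y, z). ennreal (k v (\<lambda>i. z i - x1 i) *
      (gauss_vec N \<tau> (\<lambda>i. (y i - x2 i) - c * (z i - x2 i)) * r u y * (fZ z / f u v z)) /
      (gauss_vec N \<sigma>1 (\<lambda>i. y i - (x1 i + x2 i)) * gauss_vec N \<sigma>2 (\<lambda>i. z i - y i))))"
  have G: "G \<in> borel_measurable (count_space UNIV \<Otimes>\<^sub>M L \<Otimes>\<^sub>M count_space UNIV \<Otimes>\<^sub>M L \<Otimes>\<^sub>M L \<Otimes>\<^sub>M L)"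
    unfolding G_def using msg_tuple_measurable[OF r, measurable] by measurable
  have GH: "ennreal (\<Phi>1 y a b) * ennreal (\<Phi>2 z y) * G (u, X1 a, v, X2 b, y, z)
      = kE v (\<lambda>i. z i - X1 a i) * H u v b y z" for u v a b y z
    using gauss_vec_pos[OF \<sigma>1_pos, of N "\<lambda>i. y i - (X1 a i + X2 b i)"] gauss_vec_pos[OF \<sigma>2_pos, of N "\<lambda>i. z i - y i"]
      r0 fZ_nonneg f_nonneg q0 k_nonneg
    unfolding G_def H_def q_def ennreal_k[symmetric] by (simp add: ennreal_mult'[symmetric])
  have "?L = (\<integral>\<^sup>+\<omega>. G (W1 \<omega>, X1 \<omega>, W2 \<omega>, X2 \<omega>, Y \<omega>, Z \<omega>) \<partial>M)" unfolding G_def by simp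
  also have "\<dots> = (\<Sum>u\<in>{1..m1}. \<Sum>v\<in>{1..m2}. \<integral>\<^sup>+a. indicator {u} (W1 a) * (\<integral>\<^sup>+b. indicator {v} (W2 b) *
          (\<integral>\<^sup>+y. \<integral>\<^sup>+z. kE v (\<lambda>i. z i - X1 a i) * H u v b y z \<partial>L \<partial>L) \<partial>M) \<partial>M)"
    unfolding law_split[OF G] GH ..
  also have "\<dots> = (\<Sum>u\<in>{1..m1}. \<Sum>v\<in>{1..m2}. \<integral>\<^sup>+b. indicator {v} (W2 b) *
          (\<integral>\<^sup>+y. ennreal (r u y) * (\<integral>\<^sup>+z. ennreal (q b y z * fZ z) \<partial>L) \<partial>L) \<partial>M)"
  proof (intro sum.cong refl)
    fix u v assume uv: "u \<in> {1..m1}" "v \<in> {1..m2}"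
    have "(\<integral>\<^sup>+a. indicator {u} (W1 a) * (\<integral>\<^sup>+b. indicator {v} (W2 b) *
          (\<integral>\<^sup>+y. \<integral>\<^sup>+z. kE v (\<lambda>i. z i - X1 a i) * H u v b y z \<partial>L \<partial>L) \<partial>M) \<partial>M)
        = (\<integral>\<^sup>+b. indicator {v} (W2 b) * (\<integral>\<^sup>+a. indicator {u} (W1 a) *
          (\<integral>\<^sup>+y. \<integral>\<^sup>+z. kE v (\<lambda>i. z i - X1 a i) * H u v b y z \<partial>L \<partial>L) \<partial>M) \<partial>M)"
      unfolding H_def q_def by (intro nn_integral_swap_weighted M_sigma_finite) measurable
    also have "\<dots> = (\<integral>\<^sup>+b. indicator {v} (W2 b) *
          (\<integral>\<^sup>+y. ennreal (r u y) * (\<integral>\<^sup>+z. ennreal (q b y z * fZ z) \<partial>L) \<partial>L) \<partial>M)"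
    proof (intro nn_integral_cong arg_cong2[where f="(*)"] refl)
      fix b assume [measurable]: "b \<in> space M"
      have "(\<integral>\<^sup>+a. indicator {u} (W1 a) * (\<integral>\<^sup>+y. \<integral>\<^sup>+z. kE v (\<lambda>i. z i - X1 a i) * H u v b y z \<partial>L \<partial>L) \<partial>M)
          = (\<integral>\<^sup>+a. indicator {u} (W1 a) * (\<integral>\<^sup>+y. 1 * (\<integral>\<^sup>+z. kE v (\<lambda>i. z i - X1 a i) * H u v b y z \<partial>L) \<partial>L) \<partial>M)"
        by simp
      also have "\<dots> = (\<integral>\<^sup>+y. 1 * (\<integral>\<^sup>+a. indicator {u} (W1 a) * (\<integral>\<^sup>+z. kE v (\<lambda>i. z i - X1 a i) * H u v b y z \<partial>L) \<partial>M) \<partial>L)"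
        unfolding H_def q_def 
        by (intro nn_integral_swap_weighted M_sigma_finite leb_sigma_finite) measurable
      also have "\<dots> = (\<integral>\<^sup>+y. ennreal (r u y) * (\<integral>\<^sup>+z. ennreal (q b y z * fZ z) \<partial>L) \<partial>L)"
      proof (intro nn_integral_cong)
        fix y assume [measurable]: "y \<in> space L"
        have [measurable]: "(\<lambda>z. H u v b y z) \<in> borel_measurable L" unfolding H_def q_def by measurable
        have [measurable]: "(\<lambda>z. q b y z) \<in> borel_measurable L" unfolding q_def by measurable
        have "(\<integral>\<^sup>+a. indicator {u} (W1 a) * (\<integral>\<^sup>+z. kE v (\<lambda>i. z i - X1 a i) * H u v b y z \<partial>L) \<partial>M)
          = (\<integral>\<^sup>+a. indicator {u} (W1 a) * (\<integral>\<^sup>+z. H u v b y z * kE v (\<lambda>i. z i - X1 a i) \<partial>L) \<partial>M)"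
          by (simp add: mult.commute)
        also have "\<dots> = (\<integral>\<^sup>+z. H u v b y z * (\<integral>\<^sup>+a. indicator {u} (W1 a) * kE v (\<lambda>i. z i - X1 a i) \<partial>M) \<partial>L)"
          by (intro nn_integral_swap_weighted M_sigma_finite leb_sigma_finite) measurable
        \<comment> \<open>Averaging \<open>kE\<close> over \<open>X1\<close> gives \<open>fE\<close>
          by definition, and this cancels the denominator \<open>f u v z\<close> inside
          \<open>H\<close>.\<close>
        also have "\<dots> = (\<integral>\<^sup>+z. H u v b y z * ennreal (f u v z) \<partial>L)" unfolding ennreal_f fE_def ..
        also have "\<dots> = (\<integral>\<^sup>+z. ennreal (r u y) * ennreal (q b y z * fZ z) \<partial>L)"
        proof (intro nn_integral_cong)
          fix z show "H u v b y z * ennreal (f u v z) = ennreal (r u y) * ennreal (q b y z * fZ z)"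
            unfolding H_def using f_pos[OF uv, of z] q0 r0 fZ_nonneg[of z]
            by (simp add: ennreal_mult'[symmetric])
        qed
        also have "\<dots> = ennreal (r u y) * (\<integral>\<^sup>+z. ennreal (q b y z * fZ z) \<partial>L)"
          by (intro nn_integral_cmult) measurable
        finally show "1 * (\<integral>\<^sup>+a. indicator {u} (W1 a) * (\<integral>\<^sup>+z. kE v (\<lambda>i. z i - X1 a i) * H u v b y z \<partial>L) \<partial>M)
            = ennreal (r u y) * (\<integral>\<^sup>+z. ennreal (q b y z * fZ z) \<partial>L)" by simp
      qed
      finally show "(\<integral>\<^sup>+a. indicator {u} (W1 a) * (\<integral>\<^sup>+y. \<integral>\<^sup>+z. kE v (\<lambda>i. z i - X1 a i) * H u v b y z \<partial>L \<partial>L) \<partial>M)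
          = (\<integral>\<^sup>+y. ennreal (r u y) * (\<integral>\<^sup>+z. ennreal (q b y z * fZ z) \<partial>L) \<partial>L)" .
    qed
    finally show "(\<integral>\<^sup>+a. indicator {u} (W1 a) * (\<integral>\<^sup>+b. indicator {v} (W2 b) *
          (\<integral>\<^sup>+y. \<integral>\<^sup>+z. kE v (\<lambda>i. z i - X1 a i) * H u v b y z \<partial>L \<partial>L) \<partial>M) \<partial>M)
        = (\<integral>\<^sup>+b. indicator {v} (W2 b) * (\<integral>\<^sup>+y. ennreal (r u y) * (\<integral>\<^sup>+z. ennreal (q b y z * fZ z) \<partial>L) \<partial>L) \<partial>M)" .
  qed
  \<comment> \<open>With \<open>X1\<close> gone, \<open>u\<close> occurs only in
    \<open>r u y\<close>, so summing over it first uses up the bound on \<open>r\<close>.\<close>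
  also have "\<dots> = (\<Sum>v\<in>{1..m2}. \<Sum>u\<in>{1..m1}. \<integral>\<^sup>+b. indicator {v} (W2 b) *
          (\<integral>\<^sup>+y. ennreal (r u y) * (\<integral>\<^sup>+z. ennreal (q b y z * fZ z) \<partial>L) \<partial>L) \<partial>M)"
    by (rule sum.swap)
  also have "\<dots> = (\<Sum>v\<in>{1..m2}. \<integral>\<^sup>+b. (\<Sum>u\<in>{1..m1}. indicator {v} (W2 b) *
          (\<integral>\<^sup>+y. ennreal (r u y) * (\<integral>\<^sup>+z. ennreal (q b y z * fZ z) \<partial>L) \<partial>L)) \<partial>M)"
    unfolding q_def by (intro sum.cong refl nn_integral_sum[symmetric]) measurable
  also have "\<dots> \<le> (\<Sum>v\<in>{1..m2}. \<integral>\<^sup>+b. indicator {v} (W2 b) \<partial>M)"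
  proof (intro sum_mono nn_integral_mono)
    fix v b assume [measurable]: "b \<in> space M"
    have [measurable]: "(\<lambda>p. q b (fst p) (snd p)) \<in> borel_measurable (L \<Otimes>\<^sub>M L)"
      unfolding q_def by measurable
    have [measurable]: "(\<lambda>y. q b y z) \<in> borel_measurable L" if [measurable]: "z \<in> space L" for z
      unfolding q_def by measurable
    have [measurable]: "(\<lambda>p. q b (snd p) (fst p)) \<in> borel_measurable (L \<Otimes>\<^sub>M L)"
      unfolding q_def by measurable
    have "(\<Sum>u\<in>{1..m1}. \<integral>\<^sup>+y. ennreal (r u y) * (\<integral>\<^sup>+z. ennreal (q b y z * fZ z) \<partial>L) \<partial>L)
        = (\<integral>\<^sup>+y. (\<Sum>u\<in>{1..m1}. ennreal (r u y)) * (\<integral>\<^sup>+z. ennreal (q b y z * fZ z) \<partial>L) \<partial>L)"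
      unfolding q_def sum_distrib_right by (intro nn_integral_sum[symmetric]) measurable
    also have "\<dots> \<le> (\<integral>\<^sup>+y. 1 * (\<integral>\<^sup>+z. ennreal (q b y z * fZ z) \<partial>L) \<partial>L)"
      using r1 by (intro nn_integral_mono mult_right_mono) (auto simp: sum_ennreal r0 ennreal_le_1)
    also have "\<dots> = (\<integral>\<^sup>+z. (\<integral>\<^sup>+y. ennreal (fZ z) * ennreal (q b y z) \<partial>L) \<partial>L)"
    proof -
      have "(\<integral>\<^sup>+y. 1 * (\<integral>\<^sup>+z. ennreal (q b y z * fZ z) \<partial>L) \<partial>L) = (\<integral>\<^sup>+y. (\<integral>\<^sup>+z. ennreal (fZ z) * ennreal (q b y z) \<partial>L) \<partial>L)"
        by (simp add: ennreal_mult' fZ_nonneg mult.commute[of "q _ _ _"])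
      also have "\<dots> = (\<integral>\<^sup>+z. (\<integral>\<^sup>+y. ennreal (fZ z) * ennreal (q b y z) \<partial>L) \<partial>L)"
        by (intro nn_integral_swap leb_sigma_finite) measurable
      finally show ?thesis .
    qed
    also have "\<dots> = (\<integral>\<^sup>+z. ennreal (fZ z) * (\<integral>\<^sup>+y. ennreal (q b y z) \<partial>L) \<partial>L)"
      by (intro nn_integral_cong nn_integral_cmult) measurable
    also have "\<dots> = 1"
      unfolding q_def using nn_integral_gauss_vec_affine[OF \<tau>, of N "X2 b" c] nn_integral_fZ by simp
    finally show "(\<Sum>u\<in>{1..m1}. indicator {v} (W2 b) * (\<integral>\<^sup>+y. ennreal (r u y) * (\<integral>\<^sup>+z. ennreal (q b y z * fZ z) \<partial>L) \<partial>L))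
      \<le> indicator {v} (W2 b)"
      unfolding sum_distrib_left[symmetric] by (auto simp: indicator_def)
  qed
  also have "\<dots> = (\<Sum>v\<in>{1..m2}. ennreal (1 / real m2))" by (intro sum.cong refl W2_uniform)
  also have "\<dots> = 1" using sum_ennreal_uniform[OF m2_pos] .
  finally show ?thesis .
qed

text \<open>Replaces the density of \<open>Z\<close> given \<open>(X1, W2)\<close> by a Gaussian.\<close>
lemma cross_mass:
  assumes \<tau>: "\<tau> > 0"
  shows "(\<integral>\<^sup>+\<omega>. ennreal (gauss_vec N \<tau> (\<lambda>i. Z \<omega> i - X1 \<omega> i) / (real m2 * k (W2 \<omega>) (\<lambda>i. Z \<omega> i - X1 \<omega> i))) \<partial>M) \<le> 1"
    (is "?L \<le> 1")
proof -
  interpret L: sigma_finite_measure L by (rule leb_sigma_finite)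
  define q where "q v z a = gauss_vec N \<tau> (\<lambda>i. z i - X1 a i) / (real m2 * k v (\<lambda>i. z i - X1 a i))" for v z a
  have [measurable]: "(\<lambda>p. q v (snd p) (fst p)) \<in> borel_measurable (M \<Otimes>\<^sub>M L)" for v
    unfolding q_def by measurable
  have [measurable]: "(\<lambda>z. q v z a) \<in> borel_measurable L" if [measurable]: "a \<in> space M" for v a
    unfolding q_def by measurable
  have Gm: "(\<lambda>(u::nat, x1, v, x2::nat\<Rightarrow>real, z). ennreal (gauss_vec N \<tau> (\<lambda>i. z i - x1 i) / (real m2 * k v (\<lambda>i. z i - x1 i))))
    \<in> borel_measurable (count_space UNIV \<Otimes>\<^sub>M L \<Otimes>\<^sub>M count_space UNIV \<Otimes>\<^sub>M L \<Otimes>\<^sub>M L)"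
    by measurable
  have "?L = (\<Sum>u\<in>{1..m1}. \<Sum>v\<in>{1..m2}. \<integral>\<^sup>+a. indicator {u} (W1 a) * (\<integral>\<^sup>+b. indicator {v} (W2 b) *
          (\<integral>\<^sup>+z. ennreal (\<Phi> z a b) * ennreal (q v z a) \<partial>L) \<partial>M) \<partial>M)"
    unfolding q_def using law_Z[OF Gm] by simp
  also have "\<dots> = (\<Sum>u\<in>{1..m1}. \<Sum>v\<in>{1..m2}. \<integral>\<^sup>+a. indicator {u} (W1 a) * ennreal (1 / real m2) \<partial>M)"
  proof (intro sum.cong refl nn_integral_cong arg_cong2[where f="(*)"])
    fix u v a assume v: "v \<in> {1..m2}" and [measurable]: "a \<in> space M"
    have "(\<integral>\<^sup>+b. indicator {v} (W2 b) * (\<integral>\<^sup>+z. ennreal (\<Phi> z a b) * ennreal (q v z a) \<partial>L) \<partial>M)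
      = (\<integral>\<^sup>+b. indicator {v} (W2 b) * (\<integral>\<^sup>+z. ennreal (q v z a) * ennreal (\<Phi> z a b) \<partial>L) \<partial>M)"
      by (simp add: mult.commute)
    also have "\<dots> = (\<integral>\<^sup>+z. ennreal (q v z a) * (\<integral>\<^sup>+b. indicator {v} (W2 b) * ennreal (\<Phi> z a b) \<partial>M) \<partial>L)"
      by (intro nn_integral_swap_weighted M_sigma_finite leb_sigma_finite) measurable
    \<comment> \<open>Averaging over \<open>X2\<close> recreates exactly the density in the
      denominator of \<open>q\<close>.\<close>
    also have "\<dots> = (\<integral>\<^sup>+z. ennreal (q v z a) * ennreal (k v (\<lambda>i. z i - X1 a i)) \<partial>L)"
      unfolding ennreal_k kE_def by (simp add: diff_diff_eq)
    also have "\<dots> = (\<integral>\<^sup>+z. ennreal (1 / real m2) * ennreal (gauss_vec N \<tau> (\<lambda>i. z i - X1 a i)) \<partial>L)"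
    proof (intro nn_integral_cong)
      fix z show "ennreal (q v z a) * ennreal (k v (\<lambda>i. z i - X1 a i)) = ennreal (1 / real m2) * ennreal (gauss_vec N \<tau> (\<lambda>i. z i - X1 a i))"
        unfolding q_def using k_pos[OF v, of "\<lambda>i. z i - X1 a i"] m2_pos by (simp add: ennreal_mult'[symmetric])
    qed
    also have "\<dots> = ennreal (1 / real m2)"
      by (subst nn_integral_cmult) (use nn_integral_gauss_vec[OF \<tau>, of N "X1 a"] in simp_all)
    finally show "(\<integral>\<^sup>+b. indicator {v} (W2 b) * (\<integral>\<^sup>+z. ennreal (\<Phi> z a b) * ennreal (q v z a) \<partial>L) \<partial>M) = ennreal (1 / real m2)" .
  qed
  also have "\<dots> = (\<Sum>u\<in>{1..m1}. \<Sum>v\<in>{1..m2}. ennreal (1 / real m1) * ennreal (1 / real m2))"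
    by (intro sum.cong refl) (simp add: nn_integral_multc W1_uniform)
  also have "\<dots> = 1" 
    unfolding sum_distrib_left[symmetric] sum_ennreal_uniform[OF m2_pos] using sum_ennreal_uniform[OF m1_pos] by (simp add: mult.commute)
  finally show ?thesis by simp
qed

text \<open>\<open>Q = p(w1,x1) p(x2|w2) q(y|x1) r(w2|y)\<close>.\<close>
lemma user2_mass:
  assumes \<tau>: "\<tau> > 0" and r[measurable]: "\<And>v. r v \<in> borel_measurable L"
    and r0: "\<And>v y. r v y \<ge> 0" and r1: "\<And>y. (\<Sum>v\<in>{1..m2}. r v y) \<le> 1"
  shows "(\<integral>\<^sup>+\<omega>. ennreal (real m2 * r (W2 \<omega>) (Y \<omega>) * gauss_vec N \<tau> (\<lambda>i. Y \<omega> i - X1 \<omega> i) /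
      gauss_vec N \<sigma>1 (\<lambda>i. Y \<omega> i - (X1 \<omega> i + X2 \<omega> i))) \<partial>M) \<le> 1" (is "?L \<le> 1")
proof -
  interpret L: sigma_finite_measure L by (rule leb_sigma_finite)
  define q where "q y a = gauss_vec N \<tau> (\<lambda>i. y i - X1 a i)" for y a
  have q0: "q y a \<ge> 0" for y a unfolding q_def by simp
  have [measurable]: "(\<lambda>p. q (snd p) (fst p)) \<in> borel_measurable (M \<Otimes>\<^sub>M L)"
    unfolding q_def by measurable
  have [measurable]: "(\<lambda>y. q y a) \<in> borel_measurable L" if [measurable]: "a \<in> space M" for a
    unfolding q_def by measurable
  define G where "G = (\<lambda>(u::nat, x1, v, x2, y, z::nat\<Rightarrow>real). ennreal (real m2 * r v y * gauss_vec N \<tau> (\<lambda>i. y i - x1 i) /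
      gauss_vec N \<sigma>1 (\<lambda>i. y i - (x1 i + x2 i))))"
  have G: "G \<in> borel_measurable (count_space UNIV \<Otimes>\<^sub>M L \<Otimes>\<^sub>M count_space UNIV \<Otimes>\<^sub>M L \<Otimes>\<^sub>M L \<Otimes>\<^sub>M L)"
    unfolding G_def using msg_tuple_measurable[OF r, measurable] by measurable
  have GH: "ennreal (\<Phi>1 y a b) * ennreal (\<Phi>2 z y) * G (u, X1 a, v, X2 b, y, z)
      = ennreal (real m2 * r v y * q y a) * ennreal (\<Phi>2 z y)" for u v a b y z
    using gauss_vec_pos[OF \<sigma>1_pos, of N "\<lambda>i. y i - (X1 a i + X2 b i)"] r0 q0
    unfolding G_def q_def by (simp add: ennreal_mult'[symmetric] mult_ac)
  have "?L = (\<integral>\<^sup>+\<omega>. G (W1 \<omega>, X1 \<omega>, W2 \<omega>, X2 \<omega>, Y \<omega>, Z \<omega>) \<partial>M)" unfolding G_def by simp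
  also have "\<dots> = (\<Sum>u\<in>{1..m1}. \<Sum>v\<in>{1..m2}. \<integral>\<^sup>+a. indicator {u} (W1 a) * (\<integral>\<^sup>+b. indicator {v} (W2 b) *
          (\<integral>\<^sup>+y. \<integral>\<^sup>+z. ennreal (real m2 * r v y * q y a) * ennreal (\<Phi>2 z y) \<partial>L \<partial>L) \<partial>M) \<partial>M)"
    unfolding law_split[OF G] GH ..
  also have "\<dots> = (\<Sum>u\<in>{1..m1}. \<Sum>v\<in>{1..m2}. \<integral>\<^sup>+a. indicator {u} (W1 a) * (\<integral>\<^sup>+y. ennreal (r v y) * ennreal (q y a) \<partial>L) \<partial>M)"
  proof (intro sum.cong refl nn_integral_cong arg_cong2[where f="(*)"])
    fix u v a assume v: "v \<in> {1..m2}" and [measurable]: "a \<in> space M"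
    \<comment> \<open>The test law keeps the true channel from \<open>Y\<close> to \<open>Z\<close>,
      so \<open>z\<close> integrates to one and the wiretapper disappears.\<close>
    have "(\<integral>\<^sup>+z. ennreal (real m2 * r v y * q y a) * ennreal (\<Phi>2 z y) \<partial>L) = ennreal (real m2) * (ennreal (r v y) * ennreal (q y a))"
      if [measurable]: "y \<in> space L" for y
      by (subst nn_integral_cmult) (use nn_integral_gauss_vec[OF \<sigma>2_pos, of N y] r0 q0 in \<open>simp_all add: ennreal_mult' mult_ac\<close>)
    then have "(\<integral>\<^sup>+y. \<integral>\<^sup>+z. ennreal (real m2 * r v y * q y a) * ennreal (\<Phi>2 z y) \<partial>L \<partial>L)
       = (\<integral>\<^sup>+y. ennreal (real m2) * (ennreal (r v y) * ennreal (q y a)) \<partial>L)"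
      by (intro nn_integral_cong) simp
    also have "\<dots> = ennreal (real m2) * (\<integral>\<^sup>+y. ennreal (r v y) * ennreal (q y a) \<partial>L)"
      by (intro nn_integral_cmult) measurable
    finally have "(\<integral>\<^sup>+b. indicator {v} (W2 b) *
          (\<integral>\<^sup>+y. \<integral>\<^sup>+z. ennreal (real m2 * r v y * q y a) * ennreal (\<Phi>2 z y) \<partial>L \<partial>L) \<partial>M)
        = ennreal (1 / real m2) * (ennreal (real m2) * (\<integral>\<^sup>+y. ennreal (r v y) * ennreal (q y a) \<partial>L))"
      by (simp add: nn_integral_multc W2_uniform[OF v])
    also have "\<dots> = (\<integral>\<^sup>+y. ennreal (r v y) * ennreal (q y a) \<partial>L)"
      unfolding mult.assoc[symmetric] using m2_pos by (simp add: ennreal_mult[symmetric])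
    finally show "(\<integral>\<^sup>+b. indicator {v} (W2 b) *
          (\<integral>\<^sup>+y. \<integral>\<^sup>+z. ennreal (real m2 * r v y * q y a) * ennreal (\<Phi>2 z y) \<partial>L \<partial>L) \<partial>M)
        = (\<integral>\<^sup>+y. ennreal (r v y) * ennreal (q y a) \<partial>L)" .
  qed
  also have "\<dots> = (\<Sum>u\<in>{1..m1}. \<integral>\<^sup>+a. indicator {u} (W1 a) * (\<Sum>v\<in>{1..m2}. \<integral>\<^sup>+y. ennreal (r v y) * ennreal (q y a) \<partial>L) \<partial>M)"
    by (simp only: sum_distrib_left) (intro sum.cong refl nn_integral_sum[symmetric], measurable)
  also have "\<dots> \<le> (\<Sum>u\<in>{1..m1}. \<integral>\<^sup>+a. indicator {u} (W1 a) * 1 \<partial>M)"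
  proof (intro sum_mono nn_integral_mono mult_left_mono)
    fix a assume [measurable]: "a \<in> space M"
    have "(\<Sum>v\<in>{1..m2}. \<integral>\<^sup>+y. ennreal (r v y) * ennreal (q y a) \<partial>L) = (\<integral>\<^sup>+y. (\<Sum>v\<in>{1..m2}. ennreal (r v y)) * ennreal (q y a) \<partial>L)"
      unfolding sum_distrib_right by (intro nn_integral_sum[symmetric]) measurable
    also have "\<dots> \<le> (\<integral>\<^sup>+y. 1 * ennreal (q y a) \<partial>L)"
      using r1 by (intro nn_integral_mono mult_right_mono) (auto simp: sum_ennreal r0 ennreal_le_1)
    also have "\<dots> = 1" unfolding q_def using nn_integral_gauss_vec[OF \<tau>, of N "X1 a"] by simp
    finally show "(\<Sum>v\<in>{1..m2}. \<integral>\<^sup>+y. ennreal (r v y) * ennreal (q y a) \<partial>L) \<le> 1" .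
  qed simp
  also have "\<dots> = (\<Sum>u\<in>{1..m1}. ennreal (1 / real m1))" by (intro sum.cong refl) (simp add: W1_uniform)
  also have "\<dots> = 1" using sum_ennreal_uniform[OF m1_pos] .
  finally show ?thesis .
qed

end

subsection \<open>Rate bounds at fixed block length\<close>

lemma integrable_mult_of_squares:
  fixes f g :: "'a \<Rightarrow> real"
  assumes [measurable]: "f \<in> borel_measurable M" "g \<in> borel_measurable M"
    and "integrable M (\<lambda>x. (f x)\<^sup>2)" "integrable M (\<lambda>x. (g x)\<^sup>2)"
  shows "integrable M (\<lambda>x. f x * g x)"
proof (rule Bochner_Integration.integrable_bound)
  show "integrable M (\<lambda>x. (f x)\<^sup>2 + (g x)\<^sup>2)" using assms by simp
  have "\<bar>a * b\<bar> \<le> \<bar>a\<^sup>2 + b\<^sup>2\<bar>" for a b :: real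
  proof -
    have "2 * (\<bar>a\<bar> * \<bar>b\<bar>) \<le> \<bar>a\<bar>\<^sup>2 + \<bar>b\<bar>\<^sup>2"
      using sum_squares_bound[of "\<bar>a\<bar>" "\<bar>b\<bar>"] by (simp add: mult.assoc)
    moreover have "0 \<le> \<bar>a\<bar> * \<bar>b\<bar>" by simp
    ultimately have "\<bar>a\<bar> * \<bar>b\<bar> \<le> \<bar>a\<bar>\<^sup>2 + \<bar>b\<bar>\<^sup>2" by linarith
    then show ?thesis by (simp add: abs_mult)
  qed
  then show "AE x in M. norm (f x * g x) \<le> norm ((f x)\<^sup>2 + (g x)\<^sup>2)" by simp
qed measurable

text \<open>Pythagoras for a signal and two noises; the arguments of all Gaussian kernels below are
  such combinations.\<close>

lemma second_moment_orthogonal: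
  fixes S A B :: "'a \<Rightarrow> real"
  assumes [measurable]: "S \<in> borel_measurable M" "A \<in> borel_measurable M" "B \<in> borel_measurable M"
    and sq: "integrable M (\<lambda>x. (S x)\<^sup>2)" "integrable M (\<lambda>x. (A x)\<^sup>2)" "integrable M (\<lambda>x. (B x)\<^sup>2)"
    and orth: "(\<integral>x. S x * A x \<partial>M) = 0" "(\<integral>x. S x * B x \<partial>M) = 0" "(\<integral>x. A x * B x \<partial>M) = 0"
  shows "integrable M (\<lambda>x. (\<alpha> * S x + \<beta> * A x + \<gamma> * B x)\<^sup>2)"
    and "(\<integral>x. (\<alpha> * S x + \<beta> * A x + \<gamma> * B x)\<^sup>2 \<partial>M) =
      \<alpha>\<^sup>2 * (\<integral>x. (S x)\<^sup>2 \<partial>M) + \<beta>\<^sup>2 * (\<integral>x. (A x)\<^sup>2 \<partial>M) + \<gamma>\<^sup>2 * (\<integral>x. (B x)\<^sup>2 \<partial>M)"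
proof -
  have eq: "(\<lambda>x. (\<alpha> * S x + \<beta> * A x + \<gamma> * B x)\<^sup>2) = (\<lambda>x. \<alpha>\<^sup>2 * (S x)\<^sup>2 + \<beta>\<^sup>2 * (A x)\<^sup>2 + \<gamma>\<^sup>2 * (B x)\<^sup>2
      + (2 * \<alpha> * \<beta>) * (S x * A x) + (2 * \<alpha> * \<gamma>) * (S x * B x) + (2 * \<beta> * \<gamma>) * (A x * B x))"
    by (intro ext) (simp add: power2_eq_square algebra_simps)
  note [simp] = integrable_mult_of_squares[OF assms(1,2) sq(1,2)] integrable_mult_of_squares[OF assms(1,3) sq(1,3)]
    integrable_mult_of_squares[OF assms(2,3) sq(2,3)] sq orth
  show "integrable M (\<lambda>x. (\<alpha> * S x + \<beta> * A x + \<gamma> * B x)\<^sup>2)" unfolding eq by simp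
  show "(\<integral>x. (\<alpha> * S x + \<beta> * A x + \<gamma> * B x)\<^sup>2 \<partial>M) =
      \<alpha>\<^sup>2 * (\<integral>x. (S x)\<^sup>2 \<partial>M) + \<beta>\<^sup>2 * (\<integral>x. (A x)\<^sup>2 \<partial>M) + \<gamma>\<^sup>2 * (\<integral>x. (B x)\<^sup>2 \<partial>M)"
    unfolding eq by simp
qed

text \<open>The expected log-density depends on the law of \<open>V\<close> only through its total
  second moment, which is what a power constraint controls.\<close>

lemma (in prob_space) expectation_ln_gauss_vec:
  assumes "\<tau> > 0" and V: "\<And>i. i < N \<Longrightarrow> integrable M (\<lambda>\<omega>. (V \<omega> i)\<^sup>2)"
  shows "integrable M (\<lambda>\<omega>. ln (gauss_vec N \<tau> (V \<omega>)))"
    and "expectation (\<lambda>\<omega>. ln (gauss_vec N \<tau> (V \<omega>))) =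
      - (real N / 2) * ln (2 * pi * \<tau>\<^sup>2) - (\<Sum>i<N. expectation (\<lambda>\<omega>. (V \<omega> i)\<^sup>2)) / (2 * \<tau>\<^sup>2)"
proof -
  have S: "integrable M (\<lambda>\<omega>. \<Sum>i<N. (V \<omega> i)\<^sup>2)" using V by (intro Bochner_Integration.integrable_sum) simp
  have E: "expectation (\<lambda>\<omega>. \<Sum>i<N. (V \<omega> i)\<^sup>2) = (\<Sum>i<N. expectation (\<lambda>\<omega>. (V \<omega> i)\<^sup>2))"
    using V by (intro Bochner_Integration.integral_sum) simp
  show "integrable M (\<lambda>\<omega>. ln (gauss_vec N \<tau> (V \<omega>)))"
    unfolding ln_gauss_vec[OF assms(1)] using S by simp
  show "expectation (\<lambda>\<omega>. ln (gauss_vec N \<tau> (V \<omega>))) =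
      - (real N / 2) * ln (2 * pi * \<tau>\<^sup>2) - (\<Sum>i<N. expectation (\<lambda>\<omega>. (V \<omega> i)\<^sup>2)) / (2 * \<tau>\<^sup>2)"
    unfolding ln_gauss_vec[OF assms(1)] using S by (simp add: E prob_space)
qed

lemma (in prob_space) integrable_ln_of_range:
  fixes r :: "'a \<Rightarrow> real"
  assumes [measurable]: "r \<in> borel_measurable M" and "a > 0" "\<And>\<omega>. a \<le> r \<omega>" "\<And>\<omega>. r \<omega> \<le> 1"
  shows "integrable M (\<lambda>\<omega>. ln (r \<omega>))"
proof (rule integrable_const_bound[where B="- ln a"])
  have "\<bar>ln (r \<omega>)\<bar> \<le> - ln a" for \<omega>
  proof -
    have "r \<omega> > 0" using assms(2) assms(3)[of \<omega>] by linarith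
    then have "ln (r \<omega>) \<le> 0" "ln a \<le> ln (r \<omega>)" using assms by (simp_all add: ln_le_cancel_iff)
    then show ?thesis by simp
  qed
  then show "AE \<omega> in M. norm (ln (r \<omega>)) \<le> - ln a" by simp
qed measurable

text \<open>The second-order description of the code. The inputs are uncorrelated but may have
  nonzero means. The assumptions keep their form when the users are exchanged, so one user's bounds
  yield the other's by reinterpreting the locale.\<close>

locale gmac_code = gmac_law +
  fixes P1 P2 :: real and \<psi> :: "(nat \<Rightarrow> real) \<Rightarrow> nat \<times> nat"
  assumes P1_pos: "P1 > 0" and P2_pos: "P2 > 0"
    and \<psi>_measurable [measurable]: "\<psi> \<in> measurable (leb_vec N) (count_space UNIV)"
    and X1_sq: "\<And>i. i < N \<Longrightarrow> integrable M (\<lambda>\<omega>. (X1 \<omega> i)\<^sup>2)"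
    and X2_sq: "\<And>i. i < N \<Longrightarrow> integrable M (\<lambda>\<omega>. (X2 \<omega> i)\<^sup>2)"
    and n1_sq: "\<And>i. i < N \<Longrightarrow> integrable M (\<lambda>\<omega>. (Y \<omega> i - (X1 \<omega> i + X2 \<omega> i))\<^sup>2)"
    and n2_sq: "\<And>i. i < N \<Longrightarrow> integrable M (\<lambda>\<omega>. (Z \<omega> i - Y \<omega> i)\<^sup>2)"
    and n1_var: "\<And>i. i < N \<Longrightarrow> expectation (\<lambda>\<omega>. (Y \<omega> i - (X1 \<omega> i + X2 \<omega> i))\<^sup>2) = \<sigma>1\<^sup>2"
    and n2_var: "\<And>i. i < N \<Longrightarrow> expectation (\<lambda>\<omega>. (Z \<omega> i - Y \<omega> i)\<^sup>2) = \<sigma>2\<^sup>2"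
    and n1_mean: "\<And>i. i < N \<Longrightarrow> expectation (\<lambda>\<omega>. Y \<omega> i - (X1 \<omega> i + X2 \<omega> i)) = 0"
    and n2_mean: "\<And>i. i < N \<Longrightarrow> expectation (\<lambda>\<omega>. Z \<omega> i - Y \<omega> i) = 0"
    and X1_n1: "\<And>i. i < N \<Longrightarrow> expectation (\<lambda>\<omega>. X1 \<omega> i * (Y \<omega> i - (X1 \<omega> i + X2 \<omega> i))) = 0"
    and X2_n1: "\<And>i. i < N \<Longrightarrow> expectation (\<lambda>\<omega>. X2 \<omega> i * (Y \<omega> i - (X1 \<omega> i + X2 \<omega> i))) = 0"
    and X1_n2: "\<And>i. i < N \<Longrightarrow> expectation (\<lambda>\<omega>. X1 \<omega> i * (Z \<omega> i - Y \<omega> i)) = 0"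
    and X2_n2: "\<And>i. i < N \<Longrightarrow> expectation (\<lambda>\<omega>. X2 \<omega> i * (Z \<omega> i - Y \<omega> i)) = 0"
    and n1_n2: "\<And>i. i < N \<Longrightarrow> expectation (\<lambda>\<omega>. (Y \<omega> i - (X1 \<omega> i + X2 \<omega> i)) * (Z \<omega> i - Y \<omega> i)) = 0"
    and X1_X2: "\<And>i. i < N \<Longrightarrow> expectation (\<lambda>\<omega>. X1 \<omega> i * X2 \<omega> i) = expectation (\<lambda>\<omega>. X1 \<omega> i) * expectation (\<lambda>\<omega>. X2 \<omega> i)"
    and X1_power: "(\<Sum>i<N. expectation (\<lambda>\<omega>. (X1 \<omega> i)\<^sup>2)) \<le> real N * P1"
    and X2_power: "(\<Sum>i<N. expectation (\<lambda>\<omega>. (X2 \<omega> i)\<^sup>2)) \<le> real N * P2"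
begin

abbreviation "n1 \<omega> i \<equiv> Y \<omega> i - (X1 \<omega> i + X2 \<omega> i)"
abbreviation "n2 \<omega> i \<equiv> Z \<omega> i - Y \<omega> i"

text \<open>The equivocation of the whole block in nats: \<open>f / fZ\<close> is the posterior
  probability of the messages given \<open>Z\<close>.\<close>

definition H where "H = expectation (\<lambda>\<omega>. - ln (f (W1 \<omega>) (W2 \<omega>) (Z \<omega>) / fZ (Z \<omega>)))"
definition perr where "perr = prob {\<omega> \<in> space M. \<psi> (Y \<omega>) \<noteq> (W1 \<omega>, W2 \<omega>)}"

lemma moments:
  assumes i: "i < N" and [measurable]: "S \<in> borel_measurable M" and S: "integrable M (\<lambda>\<omega>. (S \<omega>)\<^sup>2)"
    and o: "expectation (\<lambda>\<omega>. S \<omega> * n1 \<omega> i) = 0" "expectation (\<lambda>\<omega>. S \<omega> * n2 \<omega> i) = 0"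
  shows "integrable M (\<lambda>\<omega>. (\<alpha> * S \<omega> + \<beta> * n1 \<omega> i + \<gamma> * n2 \<omega> i)\<^sup>2)"
    and "expectation (\<lambda>\<omega>. (\<alpha> * S \<omega> + \<beta> * n1 \<omega> i + \<gamma> * n2 \<omega> i)\<^sup>2)
      = \<alpha>\<^sup>2 * expectation (\<lambda>\<omega>. (S \<omega>)\<^sup>2) + \<beta>\<^sup>2 * \<sigma>1\<^sup>2 + \<gamma>\<^sup>2 * \<sigma>2\<^sup>2"
proof -
  have [measurable]: "(\<lambda>\<omega>. n1 \<omega> i) \<in> borel_measurable M" "(\<lambda>\<omega>. n2 \<omega> i) \<in> borel_measurable M"
    using i by measurable
  note * = second_moment_orthogonal[of S M "\<lambda>\<omega>. n1 \<omega> i" "\<lambda>\<omega>. n2 \<omega> i", OF _ _ _ S n1_sq[OF i] n2_sq[OF i] o n1_n2[OF i]]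
  show "integrable M (\<lambda>\<omega>. (\<alpha> * S \<omega> + \<beta> * n1 \<omega> i + \<gamma> * n2 \<omega> i)\<^sup>2)"
    by (rule *) measurable
  show "expectation (\<lambda>\<omega>. (\<alpha> * S \<omega> + \<beta> * n1 \<omega> i + \<gamma> * n2 \<omega> i)\<^sup>2)
      = \<alpha>\<^sup>2 * expectation (\<lambda>\<omega>. (S \<omega>)\<^sup>2) + \<beta>\<^sup>2 * \<sigma>1\<^sup>2 + \<gamma>\<^sup>2 * \<sigma>2\<^sup>2"
    using *(2)[of \<alpha> \<beta> \<gamma>] n1_var[OF i] n2_var[OF i] by simp
qed

lemma noise_terms:
  shows "integrable M (\<lambda>\<omega>. ln (gauss_vec N \<sigma>1 (n1 \<omega>)))"
    and "expectation (\<lambda>\<omega>. ln (gauss_vec N \<sigma>1 (n1 \<omega>))) = - (real N / 2) * (ln (2 * pi * \<sigma>1\<^sup>2) + 1)"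
    and "integrable M (\<lambda>\<omega>. ln (gauss_vec N \<sigma>2 (n2 \<omega>)))"
    and "expectation (\<lambda>\<omega>. ln (gauss_vec N \<sigma>2 (n2 \<omega>))) = - (real N / 2) * (ln (2 * pi * \<sigma>2\<^sup>2) + 1)"
    and "integrable M (\<lambda>\<omega>. ln (gauss_vec N \<sigma> (\<lambda>i. Z \<omega> i - (X1 \<omega> i + X2 \<omega> i))))"
    and "expectation (\<lambda>\<omega>. ln (gauss_vec N \<sigma> (\<lambda>i. Z \<omega> i - (X1 \<omega> i + X2 \<omega> i)))) = - (real N / 2) * (ln (2 * pi * (\<sigma>1\<^sup>2 + \<sigma>2\<^sup>2)) + 1)"
proof -
  show "integrable M (\<lambda>\<omega>. ln (gauss_vec N \<sigma>1 (n1 \<omega>)))"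
    by (rule expectation_ln_gauss_vec[OF \<sigma>1_pos n1_sq])
  show "integrable M (\<lambda>\<omega>. ln (gauss_vec N \<sigma>2 (n2 \<omega>)))"
    by (rule expectation_ln_gauss_vec[OF \<sigma>2_pos n2_sq])
  show "expectation (\<lambda>\<omega>. ln (gauss_vec N \<sigma>1 (n1 \<omega>))) = - (real N / 2) * (ln (2 * pi * \<sigma>1\<^sup>2) + 1)"
    using expectation_ln_gauss_vec(2)[of \<sigma>1 N n1, OF \<sigma>1_pos n1_sq] \<sigma>1_pos n1_var by (simp add: field_simps)
  show "expectation (\<lambda>\<omega>. ln (gauss_vec N \<sigma>2 (n2 \<omega>))) = - (real N / 2) * (ln (2 * pi * \<sigma>2\<^sup>2) + 1)"
    using expectation_ln_gauss_vec(2)[of \<sigma>2 N n2, OF \<sigma>2_pos n2_sq] \<sigma>2_pos n2_var by (simp add: field_simps)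
  have i: "integrable M (\<lambda>\<omega>. (Z \<omega> i - (X1 \<omega> i + X2 \<omega> i))\<^sup>2)"
    and e: "expectation (\<lambda>\<omega>. (Z \<omega> i - (X1 \<omega> i + X2 \<omega> i))\<^sup>2) = \<sigma>1\<^sup>2 + \<sigma>2\<^sup>2" if "i < N" for i
  proof -
    \<comment> \<open>The total noise is treated as an instance of \<open>moments\<close> with zero
      signal.\<close>
    have eq: "Z \<omega> i - (X1 \<omega> i + X2 \<omega> i) = 0 * 0 + 1 * n1 \<omega> i + 1 * n2 \<omega> i" for \<omega> by simp
    show "integrable M (\<lambda>\<omega>. (Z \<omega> i - (X1 \<omega> i + X2 \<omega> i))\<^sup>2)"
      unfolding eq by (rule moments[OF that]) simp_all
    show "expectation (\<lambda>\<omega>. (Z \<omega> i - (X1 \<omega> i + X2 \<omega> i))\<^sup>2) = \<sigma>1\<^sup>2 + \<sigma>2\<^sup>2"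
      unfolding eq by (subst moments(2)[OF that]) simp_all
  qed
  show "integrable M (\<lambda>\<omega>. ln (gauss_vec N \<sigma> (\<lambda>i. Z \<omega> i - (X1 \<omega> i + X2 \<omega> i))))"
    by (rule expectation_ln_gauss_vec[OF \<sigma>_pos i])
  have "(\<Sum>i<N. expectation (\<lambda>\<omega>. (Z \<omega> i - (X1 \<omega> i + X2 \<omega> i))\<^sup>2)) / (2 * \<sigma>\<^sup>2) = real N / 2"
  proof -
    have s: "\<sigma>1\<^sup>2 + \<sigma>2\<^sup>2 \<noteq> 0"
      using \<sigma>1_pos by (metis add_pos_nonneg less_irrefl zero_le_power2 zero_less_power)
    have s': "\<sigma>\<^sup>2 = \<sigma>1\<^sup>2 + \<sigma>2\<^sup>2" by simp
    have sum: "(\<Sum>i<N. expectation (\<lambda>\<omega>. (Z \<omega> i - (X1 \<omega> i + X2 \<omega> i))\<^sup>2)) = real N * (\<sigma>1\<^sup>2 + \<sigma>2\<^sup>2)"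
      using e by simp
    have frac: "real N * x / (2 * x) = real N / 2" if "x \<noteq> 0" for x :: real
      using that by simp
    show ?thesis unfolding s' sum by (rule frac[OF s])
  qed
  then show "expectation (\<lambda>\<omega>. ln (gauss_vec N \<sigma> (\<lambda>i. Z \<omega> i - (X1 \<omega> i + X2 \<omega> i)))) = - (real N / 2) * (ln (2 * pi * (\<sigma>1\<^sup>2 + \<sigma>2\<^sup>2)) + 1)"
    using expectation_ln_gauss_vec(2)[of \<sigma> N "\<lambda>\<omega> i. Z \<omega> i - (X1 \<omega> i + X2 \<omega> i)", OF \<sigma>_pos i]
    by (simp add: algebra_simps)
qed

text \<open>The right-hand side is minus the differential entropy of \<open>N\<close> independent
  normals of variance \<open>\<tau>\<^sup>2\<close>. As all coordinates share one \<tau>, only the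
  sum of the second moments matters, however the power is spread over time.\<close>

lemma ln_gauss_vec_lower:
  assumes "\<tau> > 0" and V: "\<And>i. i < N \<Longrightarrow> integrable M (\<lambda>\<omega>. (V \<omega> i)\<^sup>2)"
    and le: "(\<Sum>i<N. expectation (\<lambda>\<omega>. (V \<omega> i)\<^sup>2)) \<le> real N * \<tau>\<^sup>2"
  shows "expectation (\<lambda>\<omega>. ln (gauss_vec N \<tau> (V \<omega>))) \<ge> - (real N / 2) * (ln (2 * pi * \<tau>\<^sup>2) + 1)"
proof -
  have "(\<Sum>i<N. expectation (\<lambda>\<omega>. (V \<omega> i)\<^sup>2)) / (2 * \<tau>\<^sup>2) \<le> real N * \<tau>\<^sup>2 / (2 * \<tau>\<^sup>2)"
    using le by (intro divide_right_mono) auto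
  also have "\<dots> = real N / 2" using assms(1) by simp
  finally show ?thesis
    using expectation_ln_gauss_vec(2)[of \<tau> N V, OF assms(1) V] by (simp add: algebra_simps)
qed

text \<open>To be applied with \<open>r\<close> the probability of the true message under the equal mixture of the decoder's
  output and the uniform law on \<open>K\<close> messages.\<close>
lemma fano_bound:
  fixes r :: "'a \<Rightarrow> real"
  assumes [measurable]: "r \<in> borel_measurable M" and K: "K \<ge> 1"
    and "\<And>\<omega>. r \<omega> \<ge> 1 / (2 * K)" "\<And>\<omega>. r \<omega> \<le> 1"
    and "\<And>\<omega>. \<psi> (Y \<omega>) = (W1 \<omega>, W2 \<omega>) \<Longrightarrow> r \<omega> \<ge> 1 / 2"
  shows "integrable M (\<lambda>\<omega>. ln (r \<omega>))"
    and "expectation (\<lambda>\<omega>. ln (r \<omega>)) \<ge> - ln 2 - perr * ln K"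
proof -
  let ?E = "{\<omega> \<in> space M. \<psi> (Y \<omega>) \<noteq> (W1 \<omega>, W2 \<omega>)}"
  have [measurable]: "?E \<in> events"
  proof -
    have "(\<lambda>\<omega>. (\<psi> (Y \<omega>), W1 \<omega>, W2 \<omega>)) \<in> measurable M (count_space UNIV \<Otimes>\<^sub>M count_space UNIV \<Otimes>\<^sub>M count_space UNIV)"
      by measurable
    then have "(\<lambda>\<omega>. (\<psi> (Y \<omega>), W1 \<omega>, W2 \<omega>)) \<in> measurable M (count_space UNIV)"
      by (simp add: pair_measure_countable)
    from measurable_sets[OF this, of "{p. fst p \<noteq> snd p}"] show ?thesis
      by (simp add: vimage_def Int_def conj_commute)
  qed
  show i: "integrable M (\<lambda>\<omega>. ln (r \<omega>))"
    using assms by (intro integrable_ln_of_range[where a="1/(2*K)"]) auto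
  have ind: "integrable M (indicat_real ?E)"
    by (intro integrable_real_indicator) (auto simp: less_top[symmetric])
  have le: "ln (r \<omega>) \<ge> - ln 2 - indicator ?E \<omega> * ln K" if "\<omega> \<in> space M" for \<omega>
  proof (cases "\<psi> (Y \<omega>) = (W1 \<omega>, W2 \<omega>)")
    case True
    have "ln (1/2) \<le> ln (r \<omega>)" using assms(5)[OF True] by (subst ln_le_cancel_iff) auto
    then show ?thesis using True by (simp add: ln_div)
  next
    case False
    have "r \<omega> > 0" using assms(3)[of \<omega>] K by (smt (verit) divide_pos_pos)
    then have "ln (1/(2*K)) \<le> ln (r \<omega>)" using assms(3)[of \<omega>] K by (subst ln_le_cancel_iff) auto
    then show ?thesis using False K that by (simp add: ln_div ln_mult)
  qed
  have "expectation (\<lambda>\<omega>. - ln 2 - indicator ?E \<omega> * ln K) \<le> expectation (\<lambda>\<omega>. ln (r \<omega>))"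
    using i le ind by (intro integral_mono) auto
  moreover have "expectation (\<lambda>\<omega>. - ln 2 - indicator ?E \<omega> * ln K) = - ln 2 - perr * ln K"
    unfolding perr_def using ind by (simp add: prob_space)
  ultimately show "expectation (\<lambda>\<omega>. ln (r \<omega>)) \<ge> - ln 2 - perr * ln K" by simp
qed

end

text \<open>The linear MMSE estimate \<open>c * (S + A + B)\<close> of \<open>S + A\<close>, for orthogonal \<open>S\<close>, \<open>A\<close>, \<open>B\<close> of
  second moments \<open>P\<close>, \<open>s1\<close>, \<open>s2\<close>, has mean squared error \<open>\<tau>\<^sup>2\<close>.\<close>
lemma linear_estimate_error:
  fixes P s1 s2 :: real
  assumes pos: "P > 0" "s1 > 0" "s2 > 0"
  shows "\<exists>\<tau> c. \<tau> > 0 \<and> \<tau>\<^sup>2 = s2 * (P + s1) / (P + s1 + s2) \<and> (1 - c)\<^sup>2 * (P + s1) + c\<^sup>2 * s2 = \<tau>\<^sup>2"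
proof (intro exI conjI)
  define c where "c = (P + s1) / (P + s1 + s2)"
  define \<tau> where "\<tau> = sqrt (s2 * (P + s1) / (P + s1 + s2))"
  show "\<tau> > 0" and \<tau>2: "\<tau>\<^sup>2 = s2 * (P + s1) / (P + s1 + s2)"
    unfolding \<tau>_def using pos by (auto intro!: divide_pos_pos mult_pos_pos)
  have "1 - c = s2 / (P + s1 + s2)" unfolding c_def using pos by (simp add: field_simps)
  then have "(1 - c)\<^sup>2 * (P + s1) + c\<^sup>2 * s2 = (s2\<^sup>2 * (P + s1) + (P + s1)\<^sup>2 * s2) / (P + s1 + s2)\<^sup>2"
    by (simp only: c_def power_divide add_divide_distrib[of "_ * _" "_ * _"] times_divide_eq_left)
  also have "\<dots> = (s2 * (P + s1)) * (P + s1 + s2) / (P + s1 + s2)\<^sup>2"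
    by (simp add: power2_eq_square algebra_simps)
  also have "\<dots> = \<tau>\<^sup>2" unfolding \<tau>2 using pos by (simp add: power2_eq_square)
  finally show "(1 - c)\<^sup>2 * (P + s1) + c\<^sup>2 * s2 = \<tau>\<^sup>2" .
qed

text \<open>Brings the product of the two numerator variances over the noise variances into the form
  used in the region. The first numerator variance \<open>a\<close> is \<open>s1 + s2\<close> for
  the sum rate and \<open>P2 + s1 + s2\<close> for a single user; the second is the estimation
  error.\<close>

lemma wiretap_ratio:
  fixes a P s1 s2 :: real
  assumes "P > 0" "s1 > 0" "s2 > 0"
  shows "a * (s2 * (P + s1) / (P + s1 + s2)) / (s1 * s2) = (s1 + P) * a / (s1 * (s1 + s2 + P))"
proof -
  have "P + s1 + s2 \<noteq> 0" "s1 + s2 + P \<noteq> 0" using assms by auto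
  then show ?thesis using assms by (simp add: divide_simps) (simp add: algebra_simps)
qed

lemma ln_two_pi_ratio:
  fixes a b c d :: real
  assumes "a > 0" "b > 0" "c > 0" "d > 0"
  shows "ln (2 * pi * a) + ln (2 * pi * b) - ln (2 * pi * c) - ln (2 * pi * d) = ln (a * b / (c * d))"
  using assms by (simp add: ln_mult ln_div)

context gmac_code
begin

lemma W_ranges: "AE \<omega> in M. W1 \<omega> \<in> {1..m1} \<and> W2 \<omega> \<in> {1..m2}"
  using W1_range W2_range by eventually_elim auto

text \<open>A posterior probability is at most one. This is the lower bound \<open>c = 0\<close>
  that Gibbs' inequality asks for.\<close>

lemma H_integrand_nonneg: "AE \<omega> in M. 0 \<le> - ln (f (W1 \<omega>) (W2 \<omega>) (Z \<omega>) / fZ (Z \<omega>))"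
  using W_ranges
proof eventually_elim
  case (elim \<omega>)
  then have "0 < f (W1 \<omega>) (W2 \<omega>) (Z \<omega>)" "f (W1 \<omega>) (W2 \<omega>) (Z \<omega>) \<le> fZ (Z \<omega>)"
    using f_pos f_le_fZ by auto
  then show ?case by (simp add: ln_le_zero_iff)
qed

text \<open>Gibbs' inequality for the test law of \<open>sum_mass\<close>. The kernels from the
  inputs to \<open>Z\<close> and from \<open>Z\<close> to \<open>Y\<close> contribute the variances
  \<open>s1 + s2\<close> and \<open>\<tau>\<^sup>2\<close> to the numerator, the two true noises
  contribute \<open>s1\<close> and \<open>s2\<close> to the denominator, and \<open>r\<close>
  contributes the Fano terms.\<close>

lemma sum_rate_nats:
  "H \<le> ln 2 + perr * ln (real m1 * real m2) + real N / 2 *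
    ln ((\<sigma>1\<^sup>2 + (P1 + P2)) * (\<sigma>1\<^sup>2 + \<sigma>2\<^sup>2) / (\<sigma>1\<^sup>2 * (\<sigma>1\<^sup>2 + \<sigma>2\<^sup>2 + (P1 + P2))))"
proof -
  define s1 s2 P where "s1 = \<sigma>1\<^sup>2" and "s2 = \<sigma>2\<^sup>2" and "P = P1 + P2"
  have pos: "s1 > 0" "s2 > 0" "P > 0"
    using \<sigma>1_pos \<sigma>2_pos P1_pos P2_pos by (auto simp: s1_def s2_def P_def)
  obtain \<tau> c where \<tau>: "\<tau> > 0" and \<tau>2: "\<tau>\<^sup>2 = s2 * (P + s1) / (P + s1 + s2)"
    and \<tau>c: "(1 - c)\<^sup>2 * (P + s1) + c\<^sup>2 * s2 = \<tau>\<^sup>2"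
    using linear_estimate_error[of P s1 s2] pos by auto
  \<comment> \<open>Centring \<open>X1\<close> makes it orthogonal to \<open>X2\<close>, as the inputs need not have mean zero.\<close>
  define m where "m i = expectation (\<lambda>\<omega>. X1 \<omega> i)" for i
  define S where "S i \<omega> = (X1 \<omega> i - m i) + X2 \<omega> i" for i \<omega>
  define V where "V \<omega> i = (Y \<omega> i - m i) - c * (Z \<omega> i - m i)" for \<omega> i
  define r where "r u v y = (if \<psi> y = (u, v) then 1 / 2 else 0) + 1 / (2 * (real m1 * real m2))" for u v y
  have V_eq: "V \<omega> i = (1 - c) * S i \<omega> + (1 - c) * n1 \<omega> i + (- c) * n2 \<omega> i" for \<omega> i
    unfolding V_def S_def by (simp add: algebra_simps)
  have S_sq: "integrable M (\<lambda>\<omega>. (S i \<omega>)\<^sup>2)"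
    and S_pow: "expectation (\<lambda>\<omega>. (S i \<omega>)\<^sup>2) \<le> expectation (\<lambda>\<omega>. (X1 \<omega> i)\<^sup>2) + expectation (\<lambda>\<omega>. (X2 \<omega> i)\<^sup>2)"
    and S_n1: "expectation (\<lambda>\<omega>. S i \<omega> * n1 \<omega> i) = 0" and S_n2: "expectation (\<lambda>\<omega>. S i \<omega> * n2 \<omega> i) = 0"
    and S_meas: "S i \<in> borel_measurable M"
    if i: "i < N" for i
  proof -
    note [simp] = X1_sq[OF i] X2_sq[OF i] n1_sq[OF i] n2_sq[OF i]
    have [measurable]: "(\<lambda>\<omega>. X1 \<omega> i) \<in> borel_measurable M" "(\<lambda>\<omega>. X2 \<omega> i) \<in> borel_measurable M"
      "(\<lambda>\<omega>. n1 \<omega> i) \<in> borel_measurable M" "(\<lambda>\<omega>. n2 \<omega> i) \<in> borel_measurable M" using i by measurable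
    have int[simp]: "integrable M (\<lambda>\<omega>. X1 \<omega> i)" "integrable M (\<lambda>\<omega>. X2 \<omega> i)"
      "integrable M (\<lambda>\<omega>. n1 \<omega> i)" "integrable M (\<lambda>\<omega>. n2 \<omega> i)"
      by (rule square_integrable_imp_integrable; simp)+
    have prods[simp]: "integrable M (\<lambda>\<omega>. X1 \<omega> i * X2 \<omega> i)" "integrable M (\<lambda>\<omega>. X1 \<omega> i * n1 \<omega> i)"
      "integrable M (\<lambda>\<omega>. X2 \<omega> i * n1 \<omega> i)" "integrable M (\<lambda>\<omega>. X1 \<omega> i * n2 \<omega> i)" "integrable M (\<lambda>\<omega>. X2 \<omega> i * n2 \<omega> i)"
      by (rule integrable_mult_of_squares; simp)+
    show "S i \<in> borel_measurable M" unfolding S_def by measurable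
    have sq: "(S i \<omega>)\<^sup>2 = (X1 \<omega> i)\<^sup>2 + (X2 \<omega> i)\<^sup>2 + 2 * (X1 \<omega> i * X2 \<omega> i) - 2 * m i * X1 \<omega> i - 2 * m i * X2 \<omega> i + (m i)\<^sup>2" for \<omega>
      unfolding S_def by (simp add: power2_eq_square algebra_simps)
    show "integrable M (\<lambda>\<omega>. (S i \<omega>)\<^sup>2)" unfolding sq by simp
    have "expectation (\<lambda>\<omega>. (S i \<omega>)\<^sup>2) = expectation (\<lambda>\<omega>. (X1 \<omega> i)\<^sup>2) + expectation (\<lambda>\<omega>. (X2 \<omega> i)\<^sup>2)
        + 2 * (m i * expectation (\<lambda>\<omega>. X2 \<omega> i)) - 2 * m i * m i - 2 * m i * expectation (\<lambda>\<omega>. X2 \<omega> i) + (m i)\<^sup>2"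
      unfolding sq by (simp add: X1_X2[OF i] m_def[symmetric] prob_space)
    \<comment> \<open>Centring only removes the squared mean, so it stays within the power
      budget.\<close>
    also have "\<dots> = expectation (\<lambda>\<omega>. (X1 \<omega> i)\<^sup>2) + expectation (\<lambda>\<omega>. (X2 \<omega> i)\<^sup>2) - (m i)\<^sup>2"
      by (simp add: power2_eq_square algebra_simps)
    finally have "expectation (\<lambda>\<omega>. (S i \<omega>)\<^sup>2) = expectation (\<lambda>\<omega>. (X1 \<omega> i)\<^sup>2) + expectation (\<lambda>\<omega>. (X2 \<omega> i)\<^sup>2) - (m i)\<^sup>2" .
    then show "expectation (\<lambda>\<omega>. (S i \<omega>)\<^sup>2) \<le> expectation (\<lambda>\<omega>. (X1 \<omega> i)\<^sup>2) + expectation (\<lambda>\<omega>. (X2 \<omega> i)\<^sup>2)" by simp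
    have "S i \<omega> * n1 \<omega> i = X1 \<omega> i * n1 \<omega> i + X2 \<omega> i * n1 \<omega> i - m i * n1 \<omega> i" for \<omega>
      unfolding S_def by (simp only: ring_distribs)
    then show "expectation (\<lambda>\<omega>. S i \<omega> * n1 \<omega> i) = 0"
      using prods int by (simp only: Bochner_Integration.integral_diff Bochner_Integration.integral_add
         Bochner_Integration.integrable_add integrable_mult_right integral_mult_right_zero X1_n1[OF i] X2_n1[OF i] n1_mean[OF i])
    have "S i \<omega> * n2 \<omega> i = X1 \<omega> i * n2 \<omega> i + X2 \<omega> i * n2 \<omega> i - m i * n2 \<omega> i" for \<omega>
      unfolding S_def by (simp only: ring_distribs)
    then show "expectation (\<lambda>\<omega>. S i \<omega> * n2 \<omega> i) = 0"
      using prods int by (simp only: Bochner_Integration.integral_diff Bochner_Integration.integral_add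
         Bochner_Integration.integrable_add integrable_mult_right integral_mult_right_zero X1_n2[OF i] X2_n2[OF i] n2_mean[OF i])
  qed
  have V_sq: "integrable M (\<lambda>\<omega>. (V \<omega> i)\<^sup>2)" if "i < N" for i
    unfolding V_eq by (rule moments[OF that S_meas[OF that] S_sq[OF that] S_n1[OF that] S_n2[OF that]])
  have V_pow: "(\<Sum>i<N. expectation (\<lambda>\<omega>. (V \<omega> i)\<^sup>2)) \<le> real N * \<tau>\<^sup>2"
  proof -
    have "(\<Sum>i<N. expectation (\<lambda>\<omega>. (V \<omega> i)\<^sup>2)) = (\<Sum>i<N. (1 - c)\<^sup>2 * expectation (\<lambda>\<omega>. (S i \<omega>)\<^sup>2) + (1 - c)\<^sup>2 * s1 + c\<^sup>2 * s2)"
      unfolding V_eq s1_def s2_def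
    proof (intro sum.cong refl)
      fix i assume "i \<in> {..<N}"
      then have i: "i < N" by simp
      show "expectation (\<lambda>\<omega>. ((1 - c) * S i \<omega> + (1 - c) * n1 \<omega> i + - c * n2 \<omega> i)\<^sup>2)
          = (1 - c)\<^sup>2 * expectation (\<lambda>\<omega>. (S i \<omega>)\<^sup>2) + (1 - c)\<^sup>2 * \<sigma>1\<^sup>2 + c\<^sup>2 * \<sigma>2\<^sup>2"
        using moments(2)[OF i S_meas[OF i] S_sq[OF i] S_n1[OF i] S_n2[OF i], of "1 - c" "1 - c" "- c"] by simp
    qed
    also have "\<dots> = (1 - c)\<^sup>2 * (\<Sum>i<N. expectation (\<lambda>\<omega>. (S i \<omega>)\<^sup>2)) + real N * ((1 - c)\<^sup>2 * s1 + c\<^sup>2 * s2)"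
      by (simp add: sum.distrib sum_distrib_left algebra_simps)
    also have "\<dots> \<le> (1 - c)\<^sup>2 * (real N * P) + real N * ((1 - c)\<^sup>2 * s1 + c\<^sup>2 * s2)"
    proof -
      have "(\<Sum>i<N. expectation (\<lambda>\<omega>. (S i \<omega>)\<^sup>2)) \<le> (\<Sum>i<N. expectation (\<lambda>\<omega>. (X1 \<omega> i)\<^sup>2) + expectation (\<lambda>\<omega>. (X2 \<omega> i)\<^sup>2))"
        using S_pow by (intro sum_mono) auto
      also have "\<dots> \<le> real N * P" using X1_power X2_power by (simp add: sum.distrib P_def algebra_simps)
      finally show ?thesis by (intro add_right_mono mult_left_mono) auto
    qed
    also have "\<dots> = real N * \<tau>\<^sup>2" unfolding \<tau>c[symmetric] by (simp add: algebra_simps)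
    finally show ?thesis .
  qed
  note q_int = expectation_ln_gauss_vec(1)[of \<tau> N V, OF \<tau> V_sq]
  note q_low = ln_gauss_vec_lower[of \<tau> V, OF \<tau> V_sq V_pow]
  have K1: "1 \<le> real m1 * real m2" using m1_pos m2_pos by (metis Suc_leI nat_0_less_mult_iff of_nat_1 of_nat_le_iff of_nat_mult One_nat_def)
  have r_meas[measurable]: "r u v \<in> borel_measurable L" for u v unfolding r_def by measurable
  have r_sum: "(\<Sum>u\<in>{1..m1}. \<Sum>v\<in>{1..m2}. r u v y) \<le> 1" for y
  proof -
    have "(\<Sum>u\<in>{1..m1}. \<Sum>v\<in>{1..m2}. r u v y) = (\<Sum>p\<in>{1..m1}\<times>{1..m2}. (if \<psi> y = p then 1 / 2 else 0) + 1 / (2 * (real m1 * real m2)))"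
      unfolding r_def by (simp add: sum.cartesian_product)
    also have "\<dots> = (if \<psi> y \<in> {1..m1}\<times>{1..m2} then 1 / 2 else 0) + 1 / 2"
      using m1_pos m2_pos by (simp add: sum.distrib sum.delta)
    also have "\<dots> \<le> 1" by simp
    finally show ?thesis .
  qed
  define R where "R \<omega> = r (W1 \<omega>) (W2 \<omega>) (Y \<omega>)" for \<omega>
  have R_meas[measurable]: "R \<in> borel_measurable M"
  proof -
    have "(\<lambda>\<omega>. r (W1 \<omega>) v (Y \<omega>)) \<in> borel_measurable M" for v
      by (rule measurable_countable_param[where r="\<lambda>u. r u v", OF r_meas]) measurable
    from measurable_compose_countable[OF this W2_measurable] show ?thesis unfolding R_def .
  qed
  have R_pos: "R \<omega> > 0" for \<omega> unfolding R_def r_def using m1_pos m2_pos by (auto intro!: add_nonneg_pos divide_pos_pos mult_pos_pos)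
  have K2: "1 / (2 * (real m1 * real m2)) \<le> 1 / 2" using K1 by (intro divide_left_mono) auto
  have K3: "1 / (2 * (real m1 * real m2)) \<ge> 0" by simp
  have R_int: "integrable M (\<lambda>\<omega>. ln (R \<omega>))" and R_low: "expectation (\<lambda>\<omega>. ln (R \<omega>)) \<ge> - ln 2 - perr * ln (real m1 * real m2)"
    using fano_bound[OF R_meas K1] K2 K3 unfolding R_def r_def by fastforce+
  \<comment> \<open>All terms of ln dQ/dP except the log-posterior of the messages; these are the
    ones already known to be integrable.\<close>
  define B where "B \<omega> = ln (gauss_vec N \<sigma> (\<lambda>i. Z \<omega> i - (X1 \<omega> i + X2 \<omega> i))) + ln (gauss_vec N \<tau> (V \<omega>)) + ln (R \<omega>)
      - ln (gauss_vec N \<sigma>1 (n1 \<omega>)) - ln (gauss_vec N \<sigma>2 (n2 \<omega>))" for \<omega>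
  have B_int: "integrable M B" unfolding B_def using noise_terms q_int R_int by simp
  define g where "g \<omega> = gauss_vec N \<sigma> (\<lambda>i. Z \<omega> i - (X1 \<omega> i + X2 \<omega> i)) *
      (gauss_vec N \<tau> (V \<omega>) * R \<omega> * (fZ (Z \<omega>) / f (W1 \<omega>) (W2 \<omega>) (Z \<omega>))) /
      (gauss_vec N \<sigma>1 (n1 \<omega>) * gauss_vec N \<sigma>2 (n2 \<omega>))" for \<omega>
  have fpos: "AE \<omega> in M. f (W1 \<omega>) (W2 \<omega>) (Z \<omega>) > 0 \<and> fZ (Z \<omega>) > 0"
    using W_ranges by eventually_elim (meson f_pos f_le_fZ less_le_trans)
  note gp = gauss_vec_pos[OF \<sigma>_pos] gauss_vec_pos[OF \<tau>] gauss_vec_pos[OF \<sigma>1_pos] gauss_vec_pos[OF \<sigma>2_pos] R_pos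
  have V_meas: "(\<lambda>\<omega>. V \<omega> i) \<in> borel_measurable M" if "i < N" for i unfolding V_def using that by measurable
  have "expectation (\<lambda>\<omega>. - ln (f (W1 \<omega>) (W2 \<omega>) (Z \<omega>) / fZ (Z \<omega>))) + expectation B \<le> 0"
  proof (rule gibbs_inequality(2)[where g=g and c=0])
    have [measurable]: "(\<lambda>\<omega>. gauss_vec N \<tau> (V \<omega>)) \<in> borel_measurable M"
      by (rule borel_measurable_gauss_vec[OF V_meas])
    show "g \<in> borel_measurable M" unfolding g_def by measurable
    show "(\<integral>\<^sup>+\<omega>. ennreal (g \<omega>) \<partial>M) \<le> 1"
      unfolding g_def R_def V_def
      by (rule sum_mass[OF \<tau> r_meas _ r_sum]) (auto simp: r_def)
    show "AE \<omega> in M. 0 < g \<omega>" using fpos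
      by eventually_elim (auto simp: g_def intro!: divide_pos_pos mult_pos_pos gp)
    show "AE \<omega> in M. ln (g \<omega>) = - ln (f (W1 \<omega>) (W2 \<omega>) (Z \<omega>) / fZ (Z \<omega>)) + B \<omega>" using fpos
    proof eventually_elim
      case (elim \<omega>)
      note * = gp[THEN less_imp_neq, symmetric]
      show ?case unfolding g_def B_def using elim * gp by (simp add: ln_mult ln_div)
    qed
  qed (use B_int H_integrand_nonneg in \<open>auto\<close>)
  then have HB: "H + expectation B \<le> 0" unfolding H_def .
  have EB: "expectation B = - (real N / 2) * (ln (2 * pi * (s1 + s2)) + 1) + expectation (\<lambda>\<omega>. ln (gauss_vec N \<tau> (V \<omega>)))
     + expectation (\<lambda>\<omega>. ln (R \<omega>)) + (real N / 2) * (ln (2 * pi * s1) + 1) + (real N / 2) * (ln (2 * pi * s2) + 1)"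
    unfolding B_def s1_def s2_def using noise_terms q_int R_int by simp
  \<comment> \<open>The summands \<open>+ 1\<close> cancel, since two Gaussian densities stand in
    the numerator of dQ/dP and two in the denominator.\<close>
  have "H \<le> ln 2 + perr * ln (real m1 * real m2) + real N / 2 * (ln (2 * pi * (s1 + s2)) + ln (2 * pi * \<tau>\<^sup>2) - ln (2 * pi * s1) - ln (2 * pi * s2))"
    using HB EB q_low R_low by (simp add: algebra_simps)
  also have "ln (2 * pi * (s1 + s2)) + ln (2 * pi * \<tau>\<^sup>2) - ln (2 * pi * s1) - ln (2 * pi * s2)
      = ln ((s1 + P) * (s1 + s2) / (s1 * (s1 + s2 + P)))"
    using pos \<tau> wiretap_ratio[of P s1 s2 "s1 + s2"] by (subst ln_two_pi_ratio) (simp_all add: \<tau>2)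
  finally show ?thesis unfolding s1_def s2_def P_def .
qed


text \<open>The test law of \<open>user1_mass\<close> leaves the true density \<open>k\<close> of
  \<open>X2\<close> plus noise in dQ/dP. A second use of Gibbs' inequality, with
  \<open>cross_mass\<close>, replaces it by a Gaussian. The term \<open>ln (real m2)\<close> arises
  because \<open>k\<close> carries the weight 1/m2 of the message; it later cancels the share of
  user 2 in the equivocation.\<close>

lemma user1_rate_nats:
  "H \<le> ln (real m2) + ln 2 + perr * ln (real m1) + real N / 2 *
    ln ((\<sigma>1\<^sup>2 + P1) * (\<sigma>1\<^sup>2 + \<sigma>2\<^sup>2 + P2) / (\<sigma>1\<^sup>2 * (\<sigma>1\<^sup>2 + \<sigma>2\<^sup>2 + P1)))"
proof -
  define s1 s2 where "s1 = \<sigma>1\<^sup>2" and "s2 = \<sigma>2\<^sup>2"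
  have pos: "s1 > 0" "s2 > 0" "P1 > 0" "P2 > 0"
    using \<sigma>1_pos \<sigma>2_pos P1_pos P2_pos by (auto simp: s1_def s2_def)
  obtain \<tau> c where \<tau>: "\<tau> > 0" and \<tau>2: "\<tau>\<^sup>2 = s2 * (P1 + s1) / (P1 + s1 + s2)"
    and \<tau>c: "(1 - c)\<^sup>2 * (P1 + s1) + c\<^sup>2 * s2 = \<tau>\<^sup>2"
    using linear_estimate_error[of P1 s1 s2] pos by auto
  \<comment> \<open>With \<open>X2\<close> subtracted, only \<open>X1\<close> remains as signal. It
    is orthogonal to both noises as it stands, so no centring is called for.\<close>
  define V where "V \<omega> i = (Y \<omega> i - X2 \<omega> i) - c * (Z \<omega> i - X2 \<omega> i)" for \<omega> i
  define U where "U \<omega> i = Z \<omega> i - X1 \<omega> i" for \<omega> i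
  \<comment> \<open>The largest average second moment that the power constraint allows to
    \<open>U\<close>, which is \<open>X2\<close> plus both noises.\<close>
  define \<rho> where "\<rho> = sqrt (P2 + s1 + s2)"
  have \<rho>: "\<rho> > 0" and \<rho>2: "\<rho>\<^sup>2 = P2 + s1 + s2" unfolding \<rho>_def using pos by auto
  \<comment> \<open>Only the first decoded component is scored, so the Fano term costs
    \<open>ln m1\<close> instead of \<open>ln (m1 * m2)\<close>.\<close>
  define r where "r u y = (if fst (\<psi> y) = u then 1 / 2 else 0) + 1 / (2 * real m1)" for u y
  have V_eq: "V \<omega> i = (1 - c) * X1 \<omega> i + (1 - c) * n1 \<omega> i + (- c) * n2 \<omega> i" for \<omega> i
    unfolding V_def by (simp add: algebra_simps)
  have U_eq: "U \<omega> i = 1 * X2 \<omega> i + 1 * n1 \<omega> i + 1 * n2 \<omega> i" for \<omega> i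
    unfolding U_def by (simp add: algebra_simps)
  have X_meas: "(\<lambda>\<omega>. X1 \<omega> i) \<in> borel_measurable M" "(\<lambda>\<omega>. X2 \<omega> i) \<in> borel_measurable M" if "i < N" for i
    using that by measurable
  note mX1 = moments[OF _ X_meas(1) X1_sq X1_n1 X1_n2]
  note mX2 = moments[OF _ X_meas(2) X2_sq X2_n1 X2_n2]
  have V_sq: "integrable M (\<lambda>\<omega>. (V \<omega> i)\<^sup>2)" if "i < N" for i
    unfolding V_eq using that by (intro mX1)
  have U_sq: "integrable M (\<lambda>\<omega>. (U \<omega> i)\<^sup>2)" if "i < N" for i
    unfolding U_eq using that by (intro mX2)
  have V_pow: "(\<Sum>i<N. expectation (\<lambda>\<omega>. (V \<omega> i)\<^sup>2)) \<le> real N * \<tau>\<^sup>2"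
  proof -
    have "(\<Sum>i<N. expectation (\<lambda>\<omega>. (V \<omega> i)\<^sup>2)) = (\<Sum>i<N. (1 - c)\<^sup>2 * expectation (\<lambda>\<omega>. (X1 \<omega> i)\<^sup>2) + (1 - c)\<^sup>2 * s1 + c\<^sup>2 * s2)"
      unfolding V_eq s1_def s2_def
    proof (intro sum.cong refl)
      fix i assume "i \<in> {..<N}"
      then have i: "i < N" by simp
      show "expectation (\<lambda>\<omega>. ((1 - c) * X1 \<omega> i + (1 - c) * n1 \<omega> i + - c * n2 \<omega> i)\<^sup>2)
          = (1 - c)\<^sup>2 * expectation (\<lambda>\<omega>. (X1 \<omega> i)\<^sup>2) + (1 - c)\<^sup>2 * \<sigma>1\<^sup>2 + c\<^sup>2 * \<sigma>2\<^sup>2"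
        using mX1(2)[OF i i i i i, of "1 - c" "1 - c" "- c"] by simp
    qed
    also have "\<dots> = (1 - c)\<^sup>2 * (\<Sum>i<N. expectation (\<lambda>\<omega>. (X1 \<omega> i)\<^sup>2)) + real N * ((1 - c)\<^sup>2 * s1 + c\<^sup>2 * s2)"
      by (simp add: sum.distrib sum_distrib_left algebra_simps)
    also have "\<dots> \<le> (1 - c)\<^sup>2 * (real N * P1) + real N * ((1 - c)\<^sup>2 * s1 + c\<^sup>2 * s2)"
      using X1_power by (intro add_right_mono mult_left_mono) auto
    also have "\<dots> = real N * \<tau>\<^sup>2" unfolding \<tau>c[symmetric] by (simp add: algebra_simps)
    finally show ?thesis .
  qed
  have U_pow: "(\<Sum>i<N. expectation (\<lambda>\<omega>. (U \<omega> i)\<^sup>2)) \<le> real N * \<rho>\<^sup>2"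
  proof -
    have "(\<Sum>i<N. expectation (\<lambda>\<omega>. (U \<omega> i)\<^sup>2)) = (\<Sum>i<N. expectation (\<lambda>\<omega>. (X2 \<omega> i)\<^sup>2) + s1 + s2)"
      unfolding U_eq s1_def s2_def
    proof (intro sum.cong refl)
      fix i assume "i \<in> {..<N}"
      then have i: "i < N" by simp
      show "expectation (\<lambda>\<omega>. (1 * X2 \<omega> i + 1 * n1 \<omega> i + 1 * n2 \<omega> i)\<^sup>2)
          = expectation (\<lambda>\<omega>. (X2 \<omega> i)\<^sup>2) + \<sigma>1\<^sup>2 + \<sigma>2\<^sup>2"
        using mX2(2)[OF i i i i i, of 1 1 1] by simp
    qed
    also have "\<dots> \<le> real N * \<rho>\<^sup>2" unfolding \<rho>2 using X2_power by (simp add: sum.distrib algebra_simps)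
    finally show ?thesis .
  qed
  note q_int = expectation_ln_gauss_vec(1)[of \<tau> N V, OF \<tau> V_sq]
  note q_low = ln_gauss_vec_lower[of \<tau> V, OF \<tau> V_sq V_pow]
  note u_int = expectation_ln_gauss_vec(1)[of \<rho> N U, OF \<rho> U_sq]
  note u_low = ln_gauss_vec_lower[of \<rho> U, OF \<rho> U_sq U_pow]
  have K1: "1 \<le> real m1" using m1_pos by simp
  have r_meas[measurable]: "r u \<in> borel_measurable L" for u unfolding r_def by measurable
  have r_sum: "(\<Sum>u\<in>{1..m1}. r u y) \<le> 1" for y
  proof -
    have "(\<Sum>u\<in>{1..m1}. r u y) = (if fst (\<psi> y) \<in> {1..m1} then 1 / 2 else 0) + 1 / 2"
      unfolding r_def using m1_pos by (simp add: sum.distrib sum.delta)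
    also have "\<dots> \<le> 1" by simp
    finally show ?thesis .
  qed
  define R where "R \<omega> = r (W1 \<omega>) (Y \<omega>)" for \<omega>
  have R_meas[measurable]: "R \<in> borel_measurable M"
    unfolding R_def by (rule measurable_countable_param[OF r_meas]) measurable
  have R_pos: "R \<omega> > 0" for \<omega> unfolding R_def r_def using m1_pos by (auto intro!: add_nonneg_pos divide_pos_pos mult_pos_pos)
  have K2: "1 / (2 * real m1) \<le> 1 / 2" using K1 by (intro divide_left_mono) auto
  have K3: "1 / (2 * real m1) \<ge> 0" by simp
  have R_int: "integrable M (\<lambda>\<omega>. ln (R \<omega>))" and R_low: "expectation (\<lambda>\<omega>. ln (R \<omega>)) \<ge> - ln 2 - perr * ln (real m1)"
    using fano_bound[OF R_meas K1] K2 K3 unfolding R_def r_def by fastforce+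
  note gp = gauss_vec_pos[OF \<rho>] gauss_vec_pos[OF \<tau>] gauss_vec_pos[OF \<sigma>1_pos] gauss_vec_pos[OF \<sigma>2_pos] R_pos
  note gp' = gp[THEN less_imp_neq, symmetric]
  have V_meas: "(\<lambda>\<omega>. V \<omega> i) \<in> borel_measurable M" "(\<lambda>\<omega>. U \<omega> i) \<in> borel_measurable M" if "i < N" for i
    unfolding V_def U_def using that by measurable
  have [measurable]: "(\<lambda>\<omega>. gauss_vec N \<tau> (V \<omega>)) \<in> borel_measurable M" "(\<lambda>\<omega>. gauss_vec N \<rho> (U \<omega>)) \<in> borel_measurable M"
    using V_meas by (auto intro!: borel_measurable_gauss_vec)
  have k_meas[measurable]: "(\<lambda>\<omega>. k (W2 \<omega>) (U \<omega>)) \<in> borel_measurable M"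
    by (rule k_measurable[OF W2_measurable V_meas(2)])
  have kpos: "AE \<omega> in M. k (W2 \<omega>) (U \<omega>) > 0"
    using W2_range by eventually_elim (rule k_pos)
  have gk_meas: "(\<lambda>\<omega>. gauss_vec N \<rho> (U \<omega>) / (real m2 * k (W2 \<omega>) (U \<omega>))) \<in> borel_measurable M"
    and lnk_meas: "(\<lambda>\<omega>. - ln (k (W2 \<omega>) (U \<omega>))) \<in> borel_measurable M" by measurable
  have Bk_int: "integrable M (\<lambda>\<omega>. ln (gauss_vec N \<rho> (U \<omega>)) - ln (real m2))" using u_int by simp
  have gk_mass: "(\<integral>\<^sup>+\<omega>. ennreal (gauss_vec N \<rho> (U \<omega>) / (real m2 * k (W2 \<omega>) (U \<omega>))) \<partial>M) \<le> 1"
    unfolding U_def by (rule cross_mass[OF \<rho>])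
  have gk_pos: "AE \<omega> in M. 0 < gauss_vec N \<rho> (U \<omega>) / (real m2 * k (W2 \<omega>) (U \<omega>))"
    using kpos by eventually_elim (use m2_pos gp in \<open>auto intro!: divide_pos_pos\<close>)
  \<comment> \<open>Gaussian smoothing bounds \<open>k\<close> from above, hence
    \<open>- ln k\<close> from below, as Gibbs' inequality demands.\<close>
  have gk_low: "AE \<omega> in M. - ln Kmax \<le> - ln (k (W2 \<omega>) (U \<omega>))"
    using kpos by eventually_elim (use k_le in \<open>auto intro!: ln_mono\<close>)
  have gk_ln: "AE \<omega> in M. ln (gauss_vec N \<rho> (U \<omega>) / (real m2 * k (W2 \<omega>) (U \<omega>)))
      = - ln (k (W2 \<omega>) (U \<omega>)) + (ln (gauss_vec N \<rho> (U \<omega>)) - ln (real m2))"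
    using kpos by eventually_elim (use m2_pos gp gp' in \<open>simp add: ln_div ln_mult\<close>)
  \<comment> \<open>Besides the estimate, this supplies the integrability of \<open>ln k\<close>,
    without which \<open>B\<close> below could not be used in the main application.\<close>
  note k_gibbs = gibbs_inequality[OF gk_meas lnk_meas Bk_int gk_mass gk_pos gk_low gk_ln]
  define B where "B \<omega> = ln (k (W2 \<omega>) (U \<omega>)) + ln (gauss_vec N \<tau> (V \<omega>)) + ln (R \<omega>)
      - ln (gauss_vec N \<sigma>1 (n1 \<omega>)) - ln (gauss_vec N \<sigma>2 (n2 \<omega>))" for \<omega>
  have k_int: "integrable M (\<lambda>\<omega>. ln (k (W2 \<omega>) (U \<omega>)))" using k_gibbs(1) by simp
  have B_int: "integrable M B" unfolding B_def using noise_terms q_int R_int k_int by simp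
  define g where "g \<omega> = k (W2 \<omega>) (U \<omega>) *
      (gauss_vec N \<tau> (V \<omega>) * R \<omega> * (fZ (Z \<omega>) / f (W1 \<omega>) (W2 \<omega>) (Z \<omega>))) /
      (gauss_vec N \<sigma>1 (n1 \<omega>) * gauss_vec N \<sigma>2 (n2 \<omega>))" for \<omega>
  have fpos: "AE \<omega> in M. f (W1 \<omega>) (W2 \<omega>) (Z \<omega>) > 0 \<and> fZ (Z \<omega>) > 0"
    using W_ranges by eventually_elim (meson f_pos f_le_fZ less_le_trans)
  have "expectation (\<lambda>\<omega>. - ln (f (W1 \<omega>) (W2 \<omega>) (Z \<omega>) / fZ (Z \<omega>))) + expectation B \<le> 0"
  proof (rule gibbs_inequality(2)[where g=g and c=0])
    show "g \<in> borel_measurable M" unfolding g_def by measurable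
    show "(\<integral>\<^sup>+\<omega>. ennreal (g \<omega>) \<partial>M) \<le> 1"
      unfolding g_def R_def V_def U_def
      by (rule user1_mass[OF \<tau> r_meas _ r_sum]) (auto simp: r_def)
    show "AE \<omega> in M. 0 < g \<omega>" using fpos kpos
      by eventually_elim (auto simp: g_def intro!: divide_pos_pos mult_pos_pos gp)
    show "AE \<omega> in M. ln (g \<omega>) = - ln (f (W1 \<omega>) (W2 \<omega>) (Z \<omega>) / fZ (Z \<omega>)) + B \<omega>" using fpos kpos
      by eventually_elim (use gp gp' in \<open>simp add: g_def B_def ln_mult ln_div\<close>)
  qed (use B_int H_integrand_nonneg in \<open>auto\<close>)
  then have HB: "H + expectation B \<le> 0" unfolding H_def .
  have EB: "expectation B = expectation (\<lambda>\<omega>. ln (k (W2 \<omega>) (U \<omega>))) + expectation (\<lambda>\<omega>. ln (gauss_vec N \<tau> (V \<omega>)))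
     + expectation (\<lambda>\<omega>. ln (R \<omega>)) + (real N / 2) * (ln (2 * pi * s1) + 1) + (real N / 2) * (ln (2 * pi * s2) + 1)"
    unfolding B_def s1_def s2_def using noise_terms q_int R_int k_int by simp
  have Ek: "expectation (\<lambda>\<omega>. ln (gauss_vec N \<rho> (U \<omega>))) - ln (real m2) \<le> expectation (\<lambda>\<omega>. ln (k (W2 \<omega>) (U \<omega>)))"
    using k_gibbs(2) u_int by (simp add: prob_space)
  have "H \<le> ln (real m2) + ln 2 + perr * ln (real m1) + real N / 2 * (ln (2 * pi * \<rho>\<^sup>2) + ln (2 * pi * \<tau>\<^sup>2) - ln (2 * pi * s1) - ln (2 * pi * s2))"
    using HB EB q_low R_low Ek u_low by (simp add: algebra_simps)
  also have "ln (2 * pi * \<rho>\<^sup>2) + ln (2 * pi * \<tau>\<^sup>2) - ln (2 * pi * s1) - ln (2 * pi * s2)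
      = ln ((s1 + P1) * (s1 + s2 + P2) / (s1 * (s1 + s2 + P1)))"
    using pos \<tau> \<rho> wiretap_ratio[of P1 s1 s2 "P2 + s1 + s2"]
    by (subst ln_two_pi_ratio) (simp_all add: \<tau>2 \<rho>2 add_ac)
  finally show ?thesis unfolding s1_def s2_def .
qed

text \<open>The ordinary converse for user 2 with \<open>X1\<close> revealed to the receiver;
  secrecy does not enter.\<close>

lemma user2_rate_nats:
  "ln (real m2) \<le> ln 2 + perr * ln (real m2) + real N / 2 * ln ((\<sigma>1\<^sup>2 + P2) / \<sigma>1\<^sup>2)"
proof -
  define s1 where "s1 = \<sigma>1\<^sup>2"
  have pos: "s1 > 0" "P2 > 0" using \<sigma>1_pos P2_pos by (auto simp: s1_def)
  define V where "V \<omega> i = Y \<omega> i - X1 \<omega> i" for \<omega> i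
  define \<tau> where "\<tau> = sqrt (P2 + s1)"
  have \<tau>: "\<tau> > 0" and \<tau>2: "\<tau>\<^sup>2 = P2 + s1" unfolding \<tau>_def using pos by auto
  define r where "r v y = (if snd (\<psi> y) = v then 1 / 2 else 0) + 1 / (2 * real m2)" for v y
  have V_eq: "V \<omega> i = 1 * X2 \<omega> i + 1 * n1 \<omega> i + 0 * n2 \<omega> i" for \<omega> i
    unfolding V_def by (simp add: algebra_simps)
  have X_meas: "(\<lambda>\<omega>. X2 \<omega> i) \<in> borel_measurable M" if "i < N" for i
    using that by measurable
  note mX2 = moments[OF _ X_meas X2_sq X2_n1 X2_n2]
  have V_sq: "integrable M (\<lambda>\<omega>. (V \<omega> i)\<^sup>2)" if "i < N" for i
    unfolding V_eq using that by (intro mX2)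
  have V_pow: "(\<Sum>i<N. expectation (\<lambda>\<omega>. (V \<omega> i)\<^sup>2)) \<le> real N * \<tau>\<^sup>2"
  proof -
    have "(\<Sum>i<N. expectation (\<lambda>\<omega>. (V \<omega> i)\<^sup>2)) = (\<Sum>i<N. expectation (\<lambda>\<omega>. (X2 \<omega> i)\<^sup>2) + s1)"
      unfolding V_eq s1_def
    proof (intro sum.cong refl)
      fix i assume "i \<in> {..<N}"
      then have i: "i < N" by simp
      show "expectation (\<lambda>\<omega>. (1 * X2 \<omega> i + 1 * n1 \<omega> i + 0 * n2 \<omega> i)\<^sup>2) = expectation (\<lambda>\<omega>. (X2 \<omega> i)\<^sup>2) + \<sigma>1\<^sup>2"
        using mX2(2)[OF i i i i i, of 1 1 0] by simp
    qed
    also have "\<dots> \<le> real N * \<tau>\<^sup>2" unfolding \<tau>2 using X2_power by (simp add: sum.distrib algebra_simps)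
    finally show ?thesis .
  qed
  note q_int = expectation_ln_gauss_vec(1)[of \<tau> N V, OF \<tau> V_sq]
  note q_low = ln_gauss_vec_lower[of \<tau> V, OF \<tau> V_sq V_pow]
  have K1: "1 \<le> real m2" using m2_pos by simp
  have r_meas[measurable]: "r v \<in> borel_measurable L" for v unfolding r_def by measurable
  have r_sum: "(\<Sum>v\<in>{1..m2}. r v y) \<le> 1" for y
  proof -
    have "(\<Sum>v\<in>{1..m2}. r v y) = (if snd (\<psi> y) \<in> {1..m2} then 1 / 2 else 0) + 1 / 2"
      unfolding r_def using m2_pos by (simp add: sum.distrib sum.delta)
    also have "\<dots> \<le> 1" by simp
    finally show ?thesis .
  qed
  define R where "R \<omega> = r (W2 \<omega>) (Y \<omega>)" for \<omega>
  have R_meas[measurable]: "R \<in> borel_measurable M"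
    unfolding R_def by (rule measurable_countable_param[OF r_meas]) measurable
  have R_pos: "R \<omega> > 0" for \<omega> unfolding R_def r_def using m2_pos by (auto intro!: add_nonneg_pos divide_pos_pos mult_pos_pos)
  have K2: "1 / (2 * real m2) \<le> 1 / 2" using K1 by (intro divide_left_mono) auto
  have K3: "1 / (2 * real m2) \<ge> 0" by simp
  have R_int: "integrable M (\<lambda>\<omega>. ln (R \<omega>))" and R_low: "expectation (\<lambda>\<omega>. ln (R \<omega>)) \<ge> - ln 2 - perr * ln (real m2)"
    using fano_bound[OF R_meas K1] K2 K3 unfolding R_def r_def by fastforce+
  note gp = gauss_vec_pos[OF \<tau>] gauss_vec_pos[OF \<sigma>1_pos] R_pos
  note gp' = gp[THEN less_imp_neq, symmetric]
  have V_meas: "(\<lambda>\<omega>. V \<omega> i) \<in> borel_measurable M" if "i < N" for i unfolding V_def using that by measurable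
  have [measurable]: "(\<lambda>\<omega>. gauss_vec N \<tau> (V \<omega>)) \<in> borel_measurable M"
    by (rule borel_measurable_gauss_vec[OF V_meas])
  define B where "B \<omega> = ln (R \<omega>) + ln (gauss_vec N \<tau> (V \<omega>)) - ln (gauss_vec N \<sigma>1 (n1 \<omega>))" for \<omega>
  have B_int: "integrable M B" unfolding B_def using noise_terms q_int R_int by simp
  define g where "g \<omega> = real m2 * R \<omega> * gauss_vec N \<tau> (V \<omega>) / gauss_vec N \<sigma>1 (n1 \<omega>)" for \<omega>
  have "expectation (\<lambda>_. ln (real m2)) + expectation B \<le> 0"
  \<comment> \<open>Here the summand \<open>A\<close> is the constant \<open>ln (real m2)\<close>,
    the entropy of the uniform message, and it is its own lower bound.\<close>
  proof (rule gibbs_inequality(2)[where g=g and c="ln (real m2)"])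
    show "g \<in> borel_measurable M" unfolding g_def by measurable
    show "(\<integral>\<^sup>+\<omega>. ennreal (g \<omega>) \<partial>M) \<le> 1"
      unfolding g_def R_def V_def
      by (rule user2_mass[OF \<tau> r_meas _ r_sum]) (auto simp: r_def)
    show "AE \<omega> in M. 0 < g \<omega>"
      using m2_pos by (auto simp: g_def intro!: divide_pos_pos mult_pos_pos gp)
    show "AE \<omega> in M. ln (g \<omega>) = ln (real m2) + B \<omega>"
      using m2_pos gp gp' by (simp add: g_def B_def ln_mult ln_div)
  qed (use B_int in auto)
  moreover have "expectation B = expectation (\<lambda>\<omega>. ln (R \<omega>)) + expectation (\<lambda>\<omega>. ln (gauss_vec N \<tau> (V \<omega>)))
     + (real N / 2) * (ln (2 * pi * s1) + 1)"
    unfolding B_def s1_def using noise_terms q_int R_int by simp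
  ultimately have "ln (real m2) \<le> ln 2 + perr * ln (real m2) + real N / 2 * (ln (2 * pi * \<tau>\<^sup>2) - ln (2 * pi * s1))"
    using q_low R_low by (simp add: prob_space algebra_simps)
  also have "ln (2 * pi * \<tau>\<^sup>2) - ln (2 * pi * s1) = ln ((s1 + P2) / s1)"
    unfolding \<tau>2 using pos by (simp add: ln_mult ln_div add.commute)
  finally show ?thesis unfolding s1_def .
qed


section \<open>The equivocation as an expected log-posterior\<close>

lemma distributed_Z: "distributed M L Z (\<lambda>z. ennreal (fZ z))"
  unfolding distributed_def
proof (intro conjI)
  show [measurable]: "(\<lambda>z. ennreal (fZ z)) \<in> borel_measurable L" by measurable
  show "distr M L Z = density L (\<lambda>z. ennreal (fZ z))"
  proof (rule measure_eqI)
    fix A assume "A \<in> sets (distr M L Z)"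
    then have A[measurable]: "A \<in> sets L" by simp
    have "emeasure (distr M L Z) A = (\<integral>\<^sup>+\<omega>. indicator A (Z \<omega>) \<partial>M)"
      by (subst nn_integral_distr[symmetric, OF Z_measurable]) auto
    also have "\<dots> = (\<Sum>u\<in>{1..m1}. \<Sum>v\<in>{1..m2}. \<integral>\<^sup>+z. fE u v z * indicator A z \<partial>L)"
      by (rule law_WZ) measurable
    also have "\<dots> = (\<integral>\<^sup>+z. (\<Sum>u\<in>{1..m1}. \<Sum>v\<in>{1..m2}. fE u v z * indicator A z) \<partial>L)"
      by (subst nn_integral_sum, measurable, intro sum.cong refl nn_integral_sum[symmetric]) measurable
    also have "\<dots> = (\<integral>\<^sup>+z. ennreal (fZ z) * indicator A z \<partial>L)"
      unfolding fZ_def by (simp add: sum_ennreal[symmetric] sum_nonneg f_nonneg ennreal_f sum_distrib_right)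
    also have "\<dots> = emeasure (density L (\<lambda>z. ennreal (fZ z))) A"
      by (subst emeasure_density) measurable
    finally show "emeasure (distr M L Z) A = emeasure (density L (\<lambda>z. ennreal (fZ z))) A" .
  qed simp
qed measurable

text \<open>The cut-off gives finite support in the messages, so that integrals over
  \<open>count_space UNIV\<close> become finite sums.\<close>

definition fWZ :: "(nat \<times> nat) \<times> (nat \<Rightarrow> real) \<Rightarrow> real" where
  "fWZ p = (if fst p \<in> {1..m1} \<times> {1..m2} then f (fst (fst p)) (snd (fst p)) (snd p) else 0)"

lemma measurable_W_pair [measurable]: "(\<lambda>\<omega>. (W1 \<omega>, W2 \<omega>)) \<in> measurable M (count_space UNIV)"
proof -
  have "(\<lambda>\<omega>. (W1 \<omega>, W2 \<omega>)) \<in> measurable M (count_space UNIV \<Otimes>\<^sub>M count_space UNIV)" by measurable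
  then show ?thesis by (simp add: pair_measure_countable)
qed

lemma fWZ_measurable [measurable]: "fWZ \<in> borel_measurable (count_space UNIV \<Otimes>\<^sub>M L)"
proof (rule measurable_pair_measure_countable1)
  fix w :: "nat \<times> nat"
  show "(\<lambda>z. fWZ (w, z)) \<in> borel_measurable L"
    unfolding fWZ_def fst_conv snd_conv by measurable
qed simp

lemma distributed_WZ:
  "distributed M (count_space UNIV \<Otimes>\<^sub>M L) (\<lambda>\<omega>. ((W1 \<omega>, W2 \<omega>), Z \<omega>)) (\<lambda>p. ennreal (fWZ p))"
  unfolding distributed_def
proof (intro conjI)
  interpret L: sigma_finite_measure L by (rule leb_sigma_finite)
  show [measurable]: "(\<lambda>p. ennreal (fWZ p)) \<in> borel_measurable (count_space UNIV \<Otimes>\<^sub>M L)" by measurable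
  show WZ[measurable]: "(\<lambda>\<omega>. ((W1 \<omega>, W2 \<omega>), Z \<omega>)) \<in> measurable M (count_space UNIV \<Otimes>\<^sub>M L)" by measurable
  let ?N = "count_space UNIV \<Otimes>\<^sub>M L"
  show "distr M ?N (\<lambda>\<omega>. ((W1 \<omega>, W2 \<omega>), Z \<omega>)) = density ?N (\<lambda>p. ennreal (fWZ p))"
  proof (rule measure_eqI)
    fix A assume "A \<in> sets (distr M ?N (\<lambda>\<omega>. ((W1 \<omega>, W2 \<omega>), Z \<omega>)))"
    then have A[measurable]: "A \<in> sets ?N" by simp
    have [measurable]: "(\<lambda>z. indicator A (w, z) :: ennreal) \<in> borel_measurable L" for w
      using A by measurable
    have "emeasure (distr M ?N (\<lambda>\<omega>. ((W1 \<omega>, W2 \<omega>), Z \<omega>))) A = (\<integral>\<^sup>+\<omega>. indicator A ((W1 \<omega>, W2 \<omega>), Z \<omega>) \<partial>M)"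
      by (subst nn_integral_distr[symmetric, OF WZ]) auto
    also have "\<dots> = (\<Sum>u\<in>{1..m1}. \<Sum>v\<in>{1..m2}. \<integral>\<^sup>+z. fE u v z * indicator A ((u, v), z) \<partial>L)"
      by (rule law_WZ) measurable
    also have "\<dots> = (\<Sum>w\<in>{1..m1}\<times>{1..m2}. \<integral>\<^sup>+z. ennreal (fWZ (w, z)) * indicator A (w, z) \<partial>L)"
      unfolding sum.cartesian_product by (intro sum.cong refl) (auto simp: fWZ_def ennreal_f)
    also have "\<dots> = (\<integral>\<^sup>+w. \<integral>\<^sup>+z. ennreal (fWZ (w, z)) * indicator A (w, z) \<partial>L \<partial>count_space UNIV)"
      by (intro nn_integral_count_space'[symmetric]) (auto simp: fWZ_def)
    also have "\<dots> = (\<integral>\<^sup>+p. ennreal (fWZ p) * indicator A p \<partial>?N)"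
      by (subst L.nn_integral_fst[symmetric]) auto
    also have "\<dots> = emeasure (density ?N (\<lambda>p. ennreal (fWZ p))) A"
      by (subst emeasure_density) measurable
    finally show "emeasure (distr M ?N (\<lambda>\<omega>. ((W1 \<omega>, W2 \<omega>), Z \<omega>))) A = emeasure (density ?N (\<lambda>p. ennreal (fWZ p))) A" .
  qed simp
qed

text \<open>The entropy integral against the joint density is an expectation under \<open>M\<close>
  of the log-posterior; dividing by \<open>ln 2\<close> converts nats to bits.\<close>

lemma conditional_entropy_eq:
  "conditional_entropy 2 (count_space UNIV) L (\<lambda>\<omega>. (W1 \<omega>, W2 \<omega>)) Z
    = expectation (\<lambda>\<omega>. - ln (f (W1 \<omega>) (W2 \<omega>) (Z \<omega>) / fZ (Z \<omega>))) / ln 2"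
proof -
  interpret information_space M 2 by standard simp
  have cs: "sigma_finite_measure (count_space (UNIV :: (nat \<times> nat) set))"
    by (rule sigma_finite_measure_count_space)
  have "conditional_entropy 2 (count_space UNIV) L (\<lambda>\<omega>. (W1 \<omega>, W2 \<omega>)) Z
    = - (\<integral>(x, y). fWZ (x, y) * log 2 (fWZ (x, y) / fZ y) \<partial>(count_space UNIV \<Otimes>\<^sub>M L))"
    by (rule conditional_entropy_generic_eq[OF cs leb_sigma_finite distributed_Z _ distributed_WZ])
      (auto simp: fZ_nonneg fWZ_def f_nonneg)
  also have "(\<integral>(x, y). fWZ (x, y) * log 2 (fWZ (x, y) / fZ y) \<partial>(count_space UNIV \<Otimes>\<^sub>M L))
     = (\<integral>p. fWZ p * log 2 (fWZ p / fZ (snd p)) \<partial>(count_space UNIV \<Otimes>\<^sub>M L))"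
    by (simp add: split_beta')
  also have "\<dots> = expectation (\<lambda>\<omega>. log 2 (fWZ ((W1 \<omega>, W2 \<omega>), Z \<omega>) / fZ (snd ((W1 \<omega>, W2 \<omega>), Z \<omega>))))"
    by (rule distributed_integral[OF distributed_WZ]) (measurable, auto simp: fWZ_def f_nonneg)
  also have "\<dots> = expectation (\<lambda>\<omega>. ln (f (W1 \<omega>) (W2 \<omega>) (Z \<omega>) / fZ (Z \<omega>)) / ln 2)"
  proof (rule integral_cong_AE)
    show "AE \<omega> in M. log 2 (fWZ ((W1 \<omega>, W2 \<omega>), Z \<omega>) / fZ (snd ((W1 \<omega>, W2 \<omega>), Z \<omega>)))
       = ln (f (W1 \<omega>) (W2 \<omega>) (Z \<omega>) / fZ (Z \<omega>)) / ln 2"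
      using W1_range W2_range by eventually_elim (auto simp: fWZ_def log_def)
  qed measurable
  finally show ?thesis by simp
qed

section \<open>Exchanging the two users\<close>

lemma gmac_law_swap: "gmac_law M N m2 m1 \<sigma>1 \<sigma>2 W2 W1 X2 X1 Y Z"
proof (intro gmac_law.intro gmac_law_axioms.intro prob_space_axioms)
  fix G :: "nat \<times> (nat \<Rightarrow> real) \<times> nat \<times> (nat \<Rightarrow> real) \<times> (nat \<Rightarrow> real) \<times> (nat \<Rightarrow> real) \<Rightarrow> ennreal"
  assume G[measurable]: "G \<in> borel_measurable (count_space UNIV \<Otimes>\<^sub>M L \<Otimes>\<^sub>M count_space UNIV \<Otimes>\<^sub>M L \<Otimes>\<^sub>M L \<Otimes>\<^sub>M L)"
  interpret L: sigma_finite_measure L by (rule leb_sigma_finite)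
  have G': "(\<lambda>(u, x1, v, x2, y, z). G (v, x2, u, x1, y, z)) \<in>
      borel_measurable (count_space UNIV \<Otimes>\<^sub>M L \<Otimes>\<^sub>M count_space UNIV \<Otimes>\<^sub>M L \<Otimes>\<^sub>M L \<Otimes>\<^sub>M L)"
    by measurable
  have "(\<integral>\<^sup>+\<omega>. G (W2 \<omega>, X2 \<omega>, W1 \<omega>, X1 \<omega>, Y \<omega>, Z \<omega>) \<partial>M) =
      (\<integral>\<^sup>+a. \<integral>\<^sup>+b. \<integral>\<^sup>+y. \<integral>\<^sup>+z. ennreal (\<Phi>1 y a b) * ennreal (\<Phi>2 z y) * G (W2 b, X2 b, W1 a, X1 a, y, z)
          \<partial>L \<partial>L \<partial>M \<partial>M)"
    using law[OF G'] by simp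
  also have "\<dots> = (\<integral>\<^sup>+b. \<integral>\<^sup>+a. \<integral>\<^sup>+y. \<integral>\<^sup>+z. ennreal (\<Phi>1 y a b) * ennreal (\<Phi>2 z y) * G (W2 b, X2 b, W1 a, X1 a, y, z)
          \<partial>L \<partial>L \<partial>M \<partial>M)"
    by (intro nn_integral_swap M_sigma_finite) measurable
  finally show "(\<integral>\<^sup>+\<omega>. G (W2 \<omega>, X2 \<omega>, W1 \<omega>, X1 \<omega>, Y \<omega>, Z \<omega>) \<partial>M) =
      (\<integral>\<^sup>+a. \<integral>\<^sup>+b. \<integral>\<^sup>+y. \<integral>\<^sup>+z. ennreal (gauss_vec N \<sigma>1 (\<lambda>i. y i - (X2 a i + X1 b i))) * ennreal (\<Phi>2 z y)
        * G (W2 a, X2 a, W1 b, X1 b, y, z) \<partial>L \<partial>L \<partial>M \<partial>M)"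
    by (simp only: add.commute)
qed (use \<sigma>1_pos \<sigma>2_pos m1_pos m2_pos W1_range W2_range W1_uniform W2_uniform in auto)


lemma gmac_code_swap: "gmac_code M N m2 m1 \<sigma>1 \<sigma>2 W2 W1 X2 X1 Y Z P2 P1 (\<lambda>y. (snd (\<psi> y), fst (\<psi> y)))"
proof (intro gmac_code.intro gmac_law_swap gmac_code_axioms.intro)
  show "(\<lambda>y. (snd (\<psi> y), fst (\<psi> y))) \<in> measurable L (count_space UNIV)"
    by (rule measurable_compose[OF \<psi>_measurable, of "\<lambda>p. (snd p, fst p)"]) simp
qed (use P1_pos P2_pos X1_sq X2_sq n1_sq n2_sq n1_var n2_var n1_mean n2_mean X1_n1 X2_n1 X1_n2 X2_n2 n1_n2
      X1_X2 X1_power X2_power in \<open>simp_all add: add.commute mult.commute\<close>)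

lemma swapped_rates_nats:
  "H \<le> ln (real m1) + ln 2 + perr * ln (real m2) + real N / 2 *
    ln ((\<sigma>1\<^sup>2 + P2) * (\<sigma>1\<^sup>2 + \<sigma>2\<^sup>2 + P1) / (\<sigma>1\<^sup>2 * (\<sigma>1\<^sup>2 + \<sigma>2\<^sup>2 + P2)))"
  "ln (real m1) \<le> ln 2 + perr * ln (real m1) + real N / 2 * ln ((\<sigma>1\<^sup>2 + P1) / \<sigma>1\<^sup>2)"
proof -
  interpret sw: gmac_code M N m2 m1 \<sigma>1 \<sigma>2 W2 W1 X2 X1 Y Z P2 P1 "\<lambda>y. (snd (\<psi> y), fst (\<psi> y))"
    by (rule gmac_code_swap)
  \<comment> \<open>By Tonelli the joint density of messages and \<open>Z\<close> does not depend on
    which input is averaged first. Hence both interpretations have the same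
    \<open>H\<close>.\<close>
  have "sw.fE v u z = fE u v z" if [measurable]: "z \<in> space L" for u v z
  proof -
    have "sw.fE v u z = (\<integral>\<^sup>+b. indicator {v} (W2 b) * (\<integral>\<^sup>+a. indicator {u} (W1 a) *
        ennreal (gauss_vec N \<sigma> (\<lambda>i. z i - X2 b i - X1 a i)) \<partial>M) \<partial>M)"
      unfolding sw.fE_def sw.kE_def ..
    also have "\<dots> = (\<integral>\<^sup>+a. indicator {u} (W1 a) * (\<integral>\<^sup>+b. indicator {v} (W2 b) *
        ennreal (gauss_vec N \<sigma> (\<lambda>i. z i - X2 b i - X1 a i)) \<partial>M) \<partial>M)"
      by (intro nn_integral_swap_weighted M_sigma_finite) measurable
    also have "\<dots> = fE u v z"
    proof -
      have "(\<lambda>i. z i - X2 b i - X1 a i) = (\<lambda>i. z i - X1 a i - X2 b i)" for a b by auto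
      then show ?thesis unfolding fE_def kE_def by simp
    qed
    finally show ?thesis .
  qed
  then have f: "sw.f v u z = f u v z" if "z \<in> space L" for u v z
    unfolding sw.f_def f_def using that by simp
  then have fZ: "sw.fZ z = fZ z" if "z \<in> space L" for z
    unfolding sw.fZ_def fZ_def using that by (subst sum.swap) simp
  have "sw.H = H" unfolding sw.H_def H_def
    using measurable_space[OF Z_measurable] by (intro Bochner_Integration.integral_cong refl) (simp add: f fZ)
  moreover have "sw.perr = perr" unfolding sw.perr_def perr_def
    by (intro arg_cong[where f=prob]) (auto simp: prod_eq_iff)
  ultimately show
    "H \<le> ln (real m1) + ln 2 + perr * ln (real m2) + real N / 2 *
      ln ((\<sigma>1\<^sup>2 + P2) * (\<sigma>1\<^sup>2 + \<sigma>2\<^sup>2 + P1) / (\<sigma>1\<^sup>2 * (\<sigma>1\<^sup>2 + \<sigma>2\<^sup>2 + P2)))"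
    "ln (real m1) \<le> ln 2 + perr * ln (real m1) + real N / 2 * ln ((\<sigma>1\<^sup>2 + P1) / \<sigma>1\<^sup>2)"
    using sw.user1_rate_nats sw.user2_rate_nats by simp_all
qed

end

subsection \<open>From codes to the locale\<close>

text \<open>Evaluates the joint law on rectangles with one side the whole space. Stating the second
  marginal as well lets the lemma be iterated along a nested product.\<close>

lemma (in prob_space) product_law_marginals:
  assumes A: "A \<in> measurable M S" and R: "R \<in> measurable M T"
    and law: "distr M (S \<Otimes>\<^sub>M T) (\<lambda>\<omega>. (A \<omega>, R \<omega>)) = \<mu> \<Otimes>\<^sub>M \<nu>"
    and \<mu>: "prob_space \<mu>" "sets \<mu> = sets S" and \<nu>: "prob_space \<nu>" "sets \<nu> = sets T"
  shows "distr M S A = \<mu>" "distr M T R = \<nu>"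
proof -
  interpret \<mu>: prob_space \<mu> by fact
  interpret \<nu>: prob_space \<nu> by fact
  have AR: "(\<lambda>\<omega>. (A \<omega>, R \<omega>)) \<in> measurable M (S \<Otimes>\<^sub>M T)" using A R by measurable
  have sp: "space \<mu> = space S" "space \<nu> = space T" using \<mu> \<nu> by (auto dest: sets_eq_imp_space_eq)
  have rect: "emeasure M {\<omega> \<in> space M. A \<omega> \<in> a \<and> R \<omega> \<in> b} = emeasure \<mu> a * emeasure \<nu> b"
    if "a \<in> sets S" "b \<in> sets T" for a b
  proof -
    have "emeasure M {\<omega> \<in> space M. A \<omega> \<in> a \<and> R \<omega> \<in> b} = emeasure (distr M (S \<Otimes>\<^sub>M T) (\<lambda>\<omega>. (A \<omega>, R \<omega>))) (a \<times> b)"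
      using that by (subst emeasure_distr[OF AR]) (auto intro!: arg_cong[where f="emeasure M"])
    also have "\<dots> = emeasure \<mu> a * emeasure \<nu> b"
      unfolding law using that \<mu> \<nu> by (intro \<nu>.emeasure_pair_measure_Times) auto
    finally show ?thesis .
  qed
  show "distr M S A = \<mu>"
  proof (rule measure_eqI)
    fix a assume "a \<in> sets (distr M S A)"
    then have a: "a \<in> sets S" by simp
    have "emeasure (distr M S A) a = emeasure M {\<omega> \<in> space M. A \<omega> \<in> a \<and> R \<omega> \<in> space T}"
      using a measurable_space[OF R] by (subst emeasure_distr[OF A]) (auto intro!: arg_cong[where f="emeasure M"])
    also have "\<dots> = emeasure \<mu> a" using rect[OF a, of "space T"] \<nu>.emeasure_space_1 sp by simp
    finally show "emeasure (distr M S A) a = emeasure \<mu> a" .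
  qed (simp add: \<mu>)
  show "distr M T R = \<nu>"
  proof (rule measure_eqI)
    fix b assume "b \<in> sets (distr M T R)"
    then have b: "b \<in> sets T" by simp
    have "emeasure (distr M T R) b = emeasure M {\<omega> \<in> space M. A \<omega> \<in> space S \<and> R \<omega> \<in> b}"
      using b measurable_space[OF A] by (subst emeasure_distr[OF R]) (auto intro!: arg_cong[where f="emeasure M"])
    also have "\<dots> = emeasure \<nu> b" using rect[OF _ b, of "space S"] \<mu>.emeasure_space_1 sp by simp
    finally show "emeasure (distr M T R) b = emeasure \<nu> b" .
  qed (simp add: \<nu>)
qed

lemma (in prob_space) product_law_expectation_mult:
  fixes f :: "_ \<Rightarrow> real" and g :: "_ \<Rightarrow> real"
  assumes A: "A \<in> measurable M S" and R: "R \<in> measurable M T"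
    and law: "distr M (S \<Otimes>\<^sub>M T) (\<lambda>\<omega>. (A \<omega>, R \<omega>)) = distr M S A \<Otimes>\<^sub>M distr M T R"
    and f[measurable]: "f \<in> borel_measurable S" and g[measurable]: "g \<in> borel_measurable T"
    and int: "integrable M (\<lambda>\<omega>. f (A \<omega>))" "integrable M (\<lambda>\<omega>. g (R \<omega>))"
  shows "expectation (\<lambda>\<omega>. f (A \<omega>) * g (R \<omega>)) = expectation (\<lambda>\<omega>. f (A \<omega>)) * expectation (\<lambda>\<omega>. g (R \<omega>))"
proof (rule indep_var_lebesgue_integral[OF _ int])
  note [measurable] = A R
  have fA: "(\<lambda>\<omega>. f (A \<omega>)) \<in> borel_measurable M" and gR: "(\<lambda>\<omega>. g (R \<omega>)) \<in> borel_measurable M" by measurable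
  interpret gR: prob_space "distr M borel (\<lambda>\<omega>. g (R \<omega>))" by (rule prob_space_distr[OF gR])
  have dA: "distr M borel (\<lambda>\<omega>. f (A \<omega>)) = distr (distr M S A) borel f"
    and dR: "distr M borel (\<lambda>\<omega>. g (R \<omega>)) = distr (distr M T R) borel g"
    by (simp_all add: distr_distr[OF f A] distr_distr[OF g R] comp_def)
  have "distr M borel (\<lambda>\<omega>. f (A \<omega>)) \<Otimes>\<^sub>M distr M borel (\<lambda>\<omega>. g (R \<omega>))
      = distr (distr M S A \<Otimes>\<^sub>M distr M T R) (borel \<Otimes>\<^sub>M borel) (\<lambda>(x, y). (f x, g y))"
    using gR.sigma_finite_measure_axioms unfolding dA dR by (intro pair_measure_distr) measurable
  also have "\<dots> = distr M (borel \<Otimes>\<^sub>M borel) (\<lambda>\<omega>. (f (A \<omega>), g (R \<omega>)))"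
    unfolding law[symmetric] by (subst distr_distr) (auto simp: comp_def)
  finally show "indep_var borel (\<lambda>\<omega>. f (A \<omega>)) borel (\<lambda>\<omega>. g (R \<omega>))"
    unfolding indep_var_distribution_eq using fA gR by simp
qed

lemma nn_integral_prod4:
  assumes "prob_space A" "prob_space B" "prob_space C" "prob_space D"
    and F[measurable]: "F \<in> borel_measurable (A \<Otimes>\<^sub>M B \<Otimes>\<^sub>M C \<Otimes>\<^sub>M D)"
  shows "(\<integral>\<^sup>+p. F p \<partial>(A \<Otimes>\<^sub>M B \<Otimes>\<^sub>M C \<Otimes>\<^sub>M D)) = (\<integral>\<^sup>+a. \<integral>\<^sup>+b. \<integral>\<^sup>+c. \<integral>\<^sup>+d. F (a, b, c, d) \<partial>D \<partial>C \<partial>B \<partial>A)"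
proof -
  interpret B: prob_space B by fact
  interpret C: prob_space C by fact
  interpret D: prob_space D by fact
  interpret CD: pair_prob_space C D ..
  interpret BCD: pair_prob_space B "C \<Otimes>\<^sub>M D" ..
  have "(\<integral>\<^sup>+p. F p \<partial>(A \<Otimes>\<^sub>M B \<Otimes>\<^sub>M C \<Otimes>\<^sub>M D)) = (\<integral>\<^sup>+a. \<integral>\<^sup>+q. F (a, q) \<partial>(B \<Otimes>\<^sub>M C \<Otimes>\<^sub>M D) \<partial>A)"
    by (rule BCD.nn_integral_fst[symmetric, OF F])
  also have "\<dots> = (\<integral>\<^sup>+a. \<integral>\<^sup>+b. \<integral>\<^sup>+c. \<integral>\<^sup>+d. F (a, b, c, d) \<partial>D \<partial>C \<partial>B \<partial>A)"
  proof (rule nn_integral_cong)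
    fix a assume [measurable]: "a \<in> space A"
    have "(\<integral>\<^sup>+q. F (a, q) \<partial>(B \<Otimes>\<^sub>M C \<Otimes>\<^sub>M D)) = (\<integral>\<^sup>+b. \<integral>\<^sup>+q. F (a, b, q) \<partial>(C \<Otimes>\<^sub>M D) \<partial>B)"
      by (rule CD.nn_integral_fst[symmetric]) measurable
    also have "\<dots> = (\<integral>\<^sup>+b. \<integral>\<^sup>+c. \<integral>\<^sup>+d. F (a, b, c, d) \<partial>D \<partial>C \<partial>B)"
    proof (rule nn_integral_cong)
      fix b assume [measurable]: "b \<in> space B"
      show "(\<integral>\<^sup>+q. F (a, b, q) \<partial>(C \<Otimes>\<^sub>M D)) = (\<integral>\<^sup>+c. \<integral>\<^sup>+d. F (a, b, c, d) \<partial>D \<partial>C)"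
        by (rule D.nn_integral_fst[symmetric]) measurable
    qed
    finally show "(\<integral>\<^sup>+q. F (a, q) \<partial>(B \<Otimes>\<^sub>M C \<Otimes>\<^sub>M D)) = (\<integral>\<^sup>+b. \<integral>\<^sup>+c. \<integral>\<^sup>+d. F (a, b, c, d) \<partial>D \<partial>C \<partial>B)" .
  qed
  finally show ?thesis .
qed

text \<open>The values outside the message set form countably many null events. An empty message set
  would leave \<open>W\<close> no value at all, against total mass one.\<close>

lemma (in prob_space) uniform_message:
  assumes W[measurable]: "W \<in> measurable M (count_space UNIV)"
    and P: "\<And>w. prob {\<omega> \<in> space M. W \<omega> = w} = (if w \<in> {1..m} then 1 / real m else 0)"
  shows "AE \<omega> in M. W \<omega> \<in> {1..m}" "m > 0"
    and "\<And>w. w \<in> {1..m} \<Longrightarrow> (\<integral>\<^sup>+\<omega>. indicator {w} (W \<omega>) \<partial>M) = ennreal (1 / real m)"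
proof -
  have ev: "{\<omega> \<in> space M. W \<omega> = w} \<in> events" for w :: nat
    using measurable_sets[OF W, of "{w}"] by (simp add: vimage_def Int_def conj_commute)
  have "AE \<omega> in M. W \<omega> \<noteq> w" if "w \<notin> {1..m}" for w
    using P[of w] that ev[of w] by (subst AE_iff_measurable[OF ev]) (auto simp: emeasure_eq_measure)
  then have "AE \<omega> in M. \<forall>w. w \<notin> {1..m} \<longrightarrow> W \<omega> \<noteq> w" by (subst AE_all_countable) auto
  then show *: "AE \<omega> in M. W \<omega> \<in> {1..m}" by eventually_elim auto
  show "m > 0"
  proof (rule ccontr)
    assume "\<not> m > 0"
    then have "{1..m} = {}" by simp
    with * have "AE \<omega> in M. False" by (simp only: empty_iff)
    then show False by simp
  qed
  fix w assume w: "w \<in> {1..m}"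
  have "(\<integral>\<^sup>+\<omega>. indicator {w} (W \<omega>) \<partial>M) = (\<integral>\<^sup>+\<omega>. indicator {\<omega> \<in> space M. W \<omega> = w} \<omega> \<partial>M)"
    by (intro nn_integral_cong) (auto simp: indicator_def)
  also have "\<dots> = ennreal (1 / real m)" using P[of w] w ev[of w] by (simp add: emeasure_eq_measure)
  finally show "(\<integral>\<^sup>+\<omega>. indicator {w} (W \<omega>) \<partial>M) = ennreal (1 / real m)" .
qed

text \<open>Projecting the product law to one coordinate gives a normal density, whose moments are
  standard.\<close>

lemma (in prob_space) iid_gauss_moments:
  assumes \<sigma>: "\<sigma> > 0" and n: "\<And>i. (\<lambda>\<omega>. n \<omega> i) \<in> borel_measurable M"
    and law: "distr M (vec_space N) (\<lambda>\<omega>. restrict (n \<omega>) {..<N}) = iid_gauss N \<sigma>" and i: "i < N"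
  shows "integrable M (\<lambda>\<omega>. (n \<omega> i)\<^sup>2)" "expectation (\<lambda>\<omega>. (n \<omega> i)\<^sup>2) = \<sigma>\<^sup>2" "expectation (\<lambda>\<omega>. n \<omega> i) = 0"
proof -
  have [measurable]: "(\<lambda>\<omega>. n \<omega> i) \<in> borel_measurable M" by (rule n)
  let ?g = "density lborel (\<lambda>x. ennreal (normal_density 0 \<sigma> x))"
  have r: "(\<lambda>\<omega>. restrict (n \<omega>) {..<N}) \<in> measurable M (vec_space N)"
    unfolding vec_space_def using n by (intro measurable_restrict)
  have "distr M lborel (\<lambda>\<omega>. n \<omega> i) = distr (distr M (vec_space N) (\<lambda>\<omega>. restrict (n \<omega>) {..<N})) lborel (\<lambda>x. x i)"
    using i by (subst distr_distr[OF _ r])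
      (auto simp: vec_space_def comp_def intro!: measurable_component_singleton[where M="\<lambda>_. borel", simplified])
  also have "\<dots> = distr (Pi\<^sub>M {..<N} (\<lambda>_. ?g)) ?g (\<lambda>x. x i)"
    unfolding law iid_gauss_def by (intro distr_cong) auto
  also have "\<dots> = ?g" using i prob_space_normal_density[OF \<sigma>] by (intro distr_PiM_component) auto
  finally have D: "distributed M lborel (\<lambda>\<omega>. n \<omega> i) (normal_density 0 \<sigma>)"
    unfolding distributed_def by simp
  show e: "expectation (\<lambda>\<omega>. n \<omega> i) = 0" by (rule normal_distributed_expectation[OF \<sigma> D])
  show "expectation (\<lambda>\<omega>. (n \<omega> i)\<^sup>2) = \<sigma>\<^sup>2" using normal_distributed_variance[OF \<sigma> D] e by simp
  show "integrable M (\<lambda>\<omega>. (n \<omega> i)\<^sup>2)"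
    using distributed_integrable[OF D, of "\<lambda>x. x\<^sup>2"] integrable_normal_moment[OF \<sigma>, of 0 2] by simp
qed

text \<open>The locale receives the restricted inputs because a code prescribes the joint law only
  of the coordinates below \<open>N\<close>.\<close>

lemma gmac_code_of_gmac_wt_code:
  assumes code: "gmac_wt_code M N P1 P2 sig1 sig2 m1 m2 W1 W2 X1 X2 n1 n2 psi"
    and N: "N > 0" and P: "P1 > 0" "P2 > 0" and sig: "sig1 > 0" "sig2 > 0"
  shows "gmac_code M N m1 m2 sig1 sig2 W1 W2 (\<lambda>\<omega>. restrict (X1 \<omega>) {..<N}) (\<lambda>\<omega>. restrict (X2 \<omega>) {..<N})
    (chan_Y N X1 X2 n1) (chan_Z N X1 X2 n1 n2) P1 P2 psi"
proof -
  note c = code[unfolded gmac_wt_code_def]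
  interpret prob_space M using c by blast
  let ?r = "\<lambda>x::nat \<Rightarrow> real. restrict x {..<N}"
  let ?V = "vec_space N" and ?S = "msg_input_space N" and ?L = "leb_vec N"
  interpret L: sigma_finite_measure ?L by (rule sigma_finite_leb_vec)
  have W[measurable]: "W1 \<in> measurable M (count_space UNIV)" "W2 \<in> measurable M (count_space UNIV)"
    using c by auto
  have X[measurable]: "(\<lambda>\<omega>. X1 \<omega> i) \<in> borel_measurable M" "(\<lambda>\<omega>. X2 \<omega> i) \<in> borel_measurable M"
    "(\<lambda>\<omega>. n1 \<omega> i) \<in> borel_measurable M" "(\<lambda>\<omega>. n2 \<omega> i) \<in> borel_measurable M" for i
    using c by auto
  have rL: "(\<lambda>\<omega>. ?r (X \<omega>)) \<in> measurable M ?L" if "\<And>i. (\<lambda>\<omega>. X \<omega> i) \<in> borel_measurable M" for X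
    using that by (intro measurable_restrict_leb_vec)
  have LV: "sets ?L = sets ?V" by (rule sets_leb_vec)
  have SL: "sets ?S = sets (count_space UNIV \<Otimes>\<^sub>M ?L)" unfolding msg_input_space_def
    by (intro sets_pair_measure_cong refl LV[symmetric])
  have rV: "(\<lambda>\<omega>. ?r (X \<omega>)) \<in> measurable M ?V" if "\<And>i. (\<lambda>\<omega>. X \<omega> i) \<in> borel_measurable M" for X
    using rL[OF that] by (simp add: measurable_cong_sets[OF refl LV])
  define A where "A \<omega> = (W1 \<omega>, ?r (X1 \<omega>))" for \<omega>
  define B where "B \<omega> = (W2 \<omega>, ?r (X2 \<omega>))" for \<omega>
  define C where "C \<omega> = ?r (n1 \<omega>)" for \<omega>
  define D where "D \<omega> = ?r (n2 \<omega>)" for \<omega>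
  have A: "A \<in> measurable M ?S" and B: "B \<in> measurable M ?S" and C: "C \<in> measurable M ?V" and D: "D \<in> measurable M ?V"
    unfolding A_def B_def C_def D_def msg_input_space_def using rV[OF X(1)] rV[OF X(2)] rV[OF X(3)] rV[OF X(4)] by simp_all
  note ABCD[measurable] = A B C D
  define dA dB dC dD where "dA = distr M ?S A" and "dB = distr M ?S B" and "dC = distr M ?V C" and "dD = distr M ?V D"
  have pA: "prob_space dA" and pB: "prob_space dB" and pC: "prob_space dC" and pD: "prob_space dD"
    unfolding dA_def dB_def dC_def dD_def by (intro prob_space_distr ABCD)+
  interpret pA: prob_space dA by fact
  interpret pB: prob_space dB by fact
  interpret pC: prob_space dC by fact
  interpret pD: prob_space dD by fact
  interpret CD: pair_prob_space dC dD ..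
  interpret BCD: pair_prob_space dB "dC \<Otimes>\<^sub>M dD" ..
  have gC: "dC = iid_gauss N sig1" and gD: "dD = iid_gauss N sig2"
    unfolding dC_def dD_def C_def D_def using c by auto
  have sAB: "sets dA = sets ?S" "sets dB = sets ?S" and sCD: "sets dC = sets ?V" "sets dD = sets ?V"
    unfolding dA_def dB_def dC_def dD_def by auto
  have joint: "distr M (?S \<Otimes>\<^sub>M ?S \<Otimes>\<^sub>M ?V \<Otimes>\<^sub>M ?V) (\<lambda>\<omega>. (A \<omega>, B \<omega>, C \<omega>, D \<omega>)) = dA \<Otimes>\<^sub>M dB \<Otimes>\<^sub>M dC \<Otimes>\<^sub>M dD"
    unfolding dA_def dB_def dC_def dD_def A_def B_def C_def D_def using c by blast
  have sCD2: "sets (dC \<Otimes>\<^sub>M dD) = sets (?V \<Otimes>\<^sub>M ?V)" by (intro sets_pair_measure_cong sCD)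
  have sBCD: "sets (dB \<Otimes>\<^sub>M dC \<Otimes>\<^sub>M dD) = sets (?S \<Otimes>\<^sub>M ?V \<Otimes>\<^sub>M ?V)" by (intro sets_pair_measure_cong sCD2 sAB)
  have mCD: "(\<lambda>\<omega>. (C \<omega>, D \<omega>)) \<in> measurable M (?V \<Otimes>\<^sub>M ?V)"
    and mBCD: "(\<lambda>\<omega>. (B \<omega>, C \<omega>, D \<omega>)) \<in> measurable M (?S \<Otimes>\<^sub>M ?V \<Otimes>\<^sub>M ?V)" by measurable
  \<comment> \<open>The product is nested to the right: each line splits off one factor and passes
    the law of the remaining tuple to the next.\<close>
  note margA = product_law_marginals[OF A mBCD joint pA sAB(1) BCD.prob_space_axioms sBCD]
  note margB = product_law_marginals[OF B mCD margA(2) pB sAB(2) CD.prob_space_axioms sCD2]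
  note margC = product_law_marginals[OF C D margB(2) pC sCD(1) pD sCD(2)]
  note multA = product_law_expectation_mult[OF A mBCD joint[folded margA]]
  note multB = product_law_expectation_mult[OF B mCD margA(2)[folded margB]]
  note multC = product_law_expectation_mult[OF C D margB(2)[folded margC]]
  have V_comp[measurable]: "(\<lambda>x. x i) \<in> borel_measurable ?V" if "i < N" for i
    unfolding vec_space_def using that measurable_component_singleton[of i "{..<N}" "\<lambda>_. borel :: real measure"] by simp
  have S_comp[measurable]: "(\<lambda>p. snd p i) \<in> borel_measurable ?S" if "i < N" for i
    unfolding msg_input_space_def by (rule measurable_compose[OF measurable_snd V_comp[OF that]])
  have sq: "integrable M (\<lambda>\<omega>. (X1 \<omega> i)\<^sup>2)" "integrable M (\<lambda>\<omega>. (X2 \<omega> i)\<^sup>2)" if "i < N" for i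
    using c that by auto
  have n1m: "integrable M (\<lambda>\<omega>. (n1 \<omega> i)\<^sup>2)" "expectation (\<lambda>\<omega>. (n1 \<omega> i)\<^sup>2) = sig1\<^sup>2" "expectation (\<lambda>\<omega>. n1 \<omega> i) = 0" if "i < N" for i
    using iid_gauss_moments[OF sig(1) X(3) _ that] c by auto
  have n2m: "integrable M (\<lambda>\<omega>. (n2 \<omega> i)\<^sup>2)" "expectation (\<lambda>\<omega>. (n2 \<omega> i)\<^sup>2) = sig2\<^sup>2" "expectation (\<lambda>\<omega>. n2 \<omega> i) = 0" if "i < N" for i
    using iid_gauss_moments[OF sig(2) X(4) _ that] c by auto
  have int: "integrable M (\<lambda>\<omega>. X1 \<omega> i)" "integrable M (\<lambda>\<omega>. X2 \<omega> i)" "integrable M (\<lambda>\<omega>. n1 \<omega> i)" "integrable M (\<lambda>\<omega>. n2 \<omega> i)"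
    if "i < N" for i
    by (rule square_integrable_imp_integrable[OF X(1) sq(1)[OF that]] square_integrable_imp_integrable[OF X(2) sq(2)[OF that]]
      square_integrable_imp_integrable[OF X(3) n1m(1)[OF that]] square_integrable_imp_integrable[OF X(4) n2m(1)[OF that]])+
  have corr: "expectation (\<lambda>\<omega>. X1 \<omega> i * X2 \<omega> i) = expectation (\<lambda>\<omega>. X1 \<omega> i) * expectation (\<lambda>\<omega>. X2 \<omega> i)"
    "expectation (\<lambda>\<omega>. X1 \<omega> i * n1 \<omega> i) = 0" "expectation (\<lambda>\<omega>. X1 \<omega> i * n2 \<omega> i) = 0"
    "expectation (\<lambda>\<omega>. X2 \<omega> i * n1 \<omega> i) = 0" "expectation (\<lambda>\<omega>. X2 \<omega> i * n2 \<omega> i) = 0"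
    "expectation (\<lambda>\<omega>. n1 \<omega> i * n2 \<omega> i) = 0" if i: "i < N" for i
  proof -
    note [simp] = int[OF i] n1m(3)[OF i] n2m(3)[OF i] i
    note [measurable] = V_comp[OF i] S_comp[OF i]
    note eq = A_def B_def C_def D_def
    show "expectation (\<lambda>\<omega>. X1 \<omega> i * X2 \<omega> i) = expectation (\<lambda>\<omega>. X1 \<omega> i) * expectation (\<lambda>\<omega>. X2 \<omega> i)"
      using multA[OF S_comp[OF i], of "\<lambda>q. snd (fst q) i"]
      by (simp add: eq measurable_compose[OF measurable_fst S_comp[OF i]])
    show "expectation (\<lambda>\<omega>. X1 \<omega> i * n1 \<omega> i) = 0"
      using multA[OF S_comp[OF i], of "\<lambda>q. fst (snd q) i"]
      by (simp add: eq measurable_compose[OF measurable_snd measurable_compose[OF measurable_fst V_comp[OF i]]])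
    show "expectation (\<lambda>\<omega>. X1 \<omega> i * n2 \<omega> i) = 0"
      using multA[OF S_comp[OF i], of "\<lambda>q. snd (snd q) i"]
      by (simp add: eq measurable_compose[OF measurable_snd measurable_compose[OF measurable_snd V_comp[OF i]]])
    show "expectation (\<lambda>\<omega>. X2 \<omega> i * n1 \<omega> i) = 0"
      using multB[OF S_comp[OF i], of "\<lambda>q. fst q i"]
      by (simp add: eq measurable_compose[OF measurable_fst V_comp[OF i]])
    show "expectation (\<lambda>\<omega>. X2 \<omega> i * n2 \<omega> i) = 0"
      using multB[OF S_comp[OF i], of "\<lambda>q. snd q i"]
      by (simp add: eq measurable_compose[OF measurable_snd V_comp[OF i]])
    show "expectation (\<lambda>\<omega>. n1 \<omega> i * n2 \<omega> i) = 0"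
      using multC[OF V_comp[OF i] V_comp[OF i]] by (simp add: eq)
  qed
  have Y_i: "chan_Y N X1 X2 n1 \<omega> i - (?r (X1 \<omega>) i + ?r (X2 \<omega>) i) = n1 \<omega> i"
    and Y_i': "chan_Y N X1 X2 n1 \<omega> i - (X1 \<omega> i + X2 \<omega> i) = n1 \<omega> i"
    and Z_i: "chan_Z N X1 X2 n1 n2 \<omega> i - chan_Y N X1 X2 n1 \<omega> i = n2 \<omega> i" if "i < N" for \<omega> i
    using that by (simp_all add: chan_Y_def chan_Z_def)
  have law: "(\<integral>\<^sup>+\<omega>. G (W1 \<omega>, ?r (X1 \<omega>), W2 \<omega>, ?r (X2 \<omega>), chan_Y N X1 X2 n1 \<omega>, chan_Z N X1 X2 n1 n2 \<omega>) \<partial>M) =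
      (\<integral>\<^sup>+a. \<integral>\<^sup>+b. \<integral>\<^sup>+y. \<integral>\<^sup>+z. ennreal (gauss_vec N sig1 (\<lambda>i. y i - (?r (X1 a) i + ?r (X2 b) i))) *
          ennreal (gauss_vec N sig2 (\<lambda>i. z i - y i)) * G (W1 a, ?r (X1 a), W2 b, ?r (X2 b), y, z) \<partial>?L \<partial>?L \<partial>M \<partial>M)"
    if G[measurable]: "G \<in> borel_measurable (count_space UNIV \<Otimes>\<^sub>M ?L \<Otimes>\<^sub>M count_space UNIV \<Otimes>\<^sub>M ?L \<Otimes>\<^sub>M ?L \<Otimes>\<^sub>M ?L)" for G
  proof -
    let ?S' = "(count_space UNIV :: nat measure) \<Otimes>\<^sub>M ?L"
    \<comment> \<open>\<open>F\<close> is \<open>G\<close> with both outputs written through inputs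
      and noises; \<open>K\<close> below is what remains once the noises have been integrated
      out.\<close>
    define F where "F = (\<lambda>p. G (fst (fst p), snd (fst p), fst (fst (snd p)), snd (fst (snd p)),
        ?r (\<lambda>i. (snd (fst p) i + snd (fst (snd p)) i) + fst (snd (snd p)) i),
        ?r (\<lambda>i. ?r (\<lambda>i. (snd (fst p) i + snd (fst (snd p)) i) + fst (snd (snd p)) i) i + snd (snd (snd p)) i)))"
    define K where "K p q = (\<integral>\<^sup>+y. \<integral>\<^sup>+z. ennreal (gauss_vec N sig1 (\<lambda>i. y i - (snd p i + snd q i))) *
          ennreal (gauss_vec N sig2 (\<lambda>i. z i - y i)) * G (fst p, snd p, fst q, snd q, y, z) \<partial>?L \<partial>?L)" for p q
    have [measurable]: "(\<lambda>p. ?r (\<lambda>i. (snd (fst p) i + snd (fst (snd p)) i) + fst (snd (snd p)) i)) \<in> measurable (?S' \<Otimes>\<^sub>M ?S' \<Otimes>\<^sub>M ?L \<Otimes>\<^sub>M ?L) ?L"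
      "(\<lambda>p. ?r (\<lambda>i. ?r (\<lambda>i. (snd (fst p) i + snd (fst (snd p)) i) + fst (snd (snd p)) i) i + snd (snd (snd p)) i)) \<in> measurable (?S' \<Otimes>\<^sub>M ?S' \<Otimes>\<^sub>M ?L \<Otimes>\<^sub>M ?L) ?L"
      by (rule measurable_restrict_leb_vec, simp, measurable)+
    have F': "F \<in> borel_measurable (?S' \<Otimes>\<^sub>M ?S' \<Otimes>\<^sub>M ?L \<Otimes>\<^sub>M ?L)" unfolding F_def by measurable
    have "sets (?S' \<Otimes>\<^sub>M ?S' \<Otimes>\<^sub>M ?L \<Otimes>\<^sub>M ?L) = sets (?S \<Otimes>\<^sub>M ?S \<Otimes>\<^sub>M ?V \<Otimes>\<^sub>M ?V)"
      by (intro sets_pair_measure_cong SL[symmetric] LV)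
    then have F: "F \<in> borel_measurable (?S \<Otimes>\<^sub>M ?S \<Otimes>\<^sub>M ?V \<Otimes>\<^sub>M ?V)"
      using F' measurable_cong_sets[OF _ refl] by blast
    have "sets (?S \<Otimes>\<^sub>M ?S \<Otimes>\<^sub>M ?V \<Otimes>\<^sub>M ?V) = sets (dA \<Otimes>\<^sub>M dB \<Otimes>\<^sub>M dC \<Otimes>\<^sub>M dD)"
      by (intro sets_pair_measure_cong sAB[symmetric] sCD[symmetric])
    then have Fd: "F \<in> borel_measurable (dA \<Otimes>\<^sub>M dB \<Otimes>\<^sub>M dC \<Otimes>\<^sub>M dD)"
      using F measurable_cong_sets[OF _ refl] by blast
    have K': "(\<lambda>x. K (fst x) (snd x)) \<in> borel_measurable (?S' \<Otimes>\<^sub>M ?S')" unfolding K_def by measurable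
    have "sets (?S' \<Otimes>\<^sub>M ?S') = sets (?S \<Otimes>\<^sub>M ?S)" by (intro sets_pair_measure_cong SL[symmetric])
    then have K[measurable]: "(\<lambda>x. K (fst x) (snd x)) \<in> borel_measurable (?S \<Otimes>\<^sub>M ?S)"
      using K' measurable_cong_sets[OF _ refl] by blast
    have FK: "(\<integral>\<^sup>+c. \<integral>\<^sup>+d. F (p, q, c, d) \<partial>dD \<partial>dC) = K p q" if pq: "p \<in> space ?S'" "q \<in> space ?S'" for p q
    proof -
      have [measurable]: "snd p \<in> space ?L" "snd q \<in> space ?L" using pq by (auto simp: space_pair_measure)
      let ?F2 = "\<lambda>y. \<integral>\<^sup>+z. ennreal (gauss_vec N sig2 (\<lambda>i. z i - y i)) * G (fst p, snd p, fst q, snd q, y, z) \<partial>?L"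
      have F2: "?F2 \<in> borel_measurable ?L" by measurable
      \<comment> \<open>The inner noise is shifted by the fixed vector \<open>y\<close>; afterwards
        the outer noise is shifted by the sum of the inputs.\<close>
      have "(\<integral>\<^sup>+d. F (p, q, c, d) \<partial>dD) = ?F2 (?r (\<lambda>i. (snd p i + snd q i) + c i))" for c
      proof -
        let ?y = "?r (\<lambda>i. (snd p i + snd q i) + c i)"
        have y[measurable]: "?y \<in> space ?L" by (simp add: leb_vec_def space_PiM)
        have "(\<integral>\<^sup>+d. G (fst p, snd p, fst q, snd q, ?y, ?r (\<lambda>i. ?y i + d i)) \<partial>iid_gauss N sig2) = ?F2 ?y"
          by (rule nn_integral_iid_gauss_shift[OF sig(2), of "\<lambda>z. G (fst p, snd p, fst q, snd q, ?y, z)"]) measurable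
        then show ?thesis unfolding F_def gD by simp
      qed
      then have "(\<integral>\<^sup>+c. \<integral>\<^sup>+d. F (p, q, c, d) \<partial>dD \<partial>dC) = (\<integral>\<^sup>+c. ?F2 (?r (\<lambda>i. (snd p i + snd q i) + c i)) \<partial>iid_gauss N sig1)"
        unfolding gC by simp
      also have "\<dots> = (\<integral>\<^sup>+y. ennreal (gauss_vec N sig1 (\<lambda>i. y i - (snd p i + snd q i))) * ?F2 y \<partial>?L)"
        by (rule nn_integral_iid_gauss_shift[OF sig(1) F2])
      also have "\<dots> = K p q" unfolding K_def mult.assoc
        by (intro nn_integral_cong nn_integral_cmult[symmetric]) measurable
      finally show ?thesis .
    qed
    have spS: "space ?S = space ?S'" "space dA = space ?S" "space dB = space ?S"
      by (rule sets_eq_imp_space_eq[OF SL] sets_eq_imp_space_eq[OF sAB(1)] sets_eq_imp_space_eq[OF sAB(2)])+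
    have "(\<integral>\<^sup>+\<omega>. G (W1 \<omega>, ?r (X1 \<omega>), W2 \<omega>, ?r (X2 \<omega>), chan_Y N X1 X2 n1 \<omega>, chan_Z N X1 X2 n1 n2 \<omega>) \<partial>M)
        = (\<integral>\<^sup>+\<omega>. F (A \<omega>, B \<omega>, C \<omega>, D \<omega>) \<partial>M)"
    proof (rule nn_integral_cong)
      fix \<omega>
      have "chan_Y N X1 X2 n1 \<omega> = ?r (\<lambda>i. (?r (X1 \<omega>) i + ?r (X2 \<omega>) i) + ?r (n1 \<omega>) i)"
        and "chan_Z N X1 X2 n1 n2 \<omega> = ?r (\<lambda>i. ?r (\<lambda>i. (?r (X1 \<omega>) i + ?r (X2 \<omega>) i) + ?r (n1 \<omega>) i) i + ?r (n2 \<omega>) i)"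
        unfolding chan_Y_def chan_Z_def by (auto intro!: restrict_ext)
      then show "G (W1 \<omega>, ?r (X1 \<omega>), W2 \<omega>, ?r (X2 \<omega>), chan_Y N X1 X2 n1 \<omega>, chan_Z N X1 X2 n1 n2 \<omega>) = F (A \<omega>, B \<omega>, C \<omega>, D \<omega>)"
        unfolding F_def A_def B_def C_def D_def by simp
    qed
    also have "\<dots> = (\<integral>\<^sup>+p. F p \<partial>distr M (?S \<Otimes>\<^sub>M ?S \<Otimes>\<^sub>M ?V \<Otimes>\<^sub>M ?V) (\<lambda>\<omega>. (A \<omega>, B \<omega>, C \<omega>, D \<omega>)))"
      by (rule nn_integral_distr[symmetric]) (measurable, rule F)
    also have "\<dots> = (\<integral>\<^sup>+p. F p \<partial>(dA \<Otimes>\<^sub>M dB \<Otimes>\<^sub>M dC \<Otimes>\<^sub>M dD))" by (simp only: joint)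
    also have "\<dots> = (\<integral>\<^sup>+p. \<integral>\<^sup>+q. \<integral>\<^sup>+c. \<integral>\<^sup>+d. F (p, q, c, d) \<partial>dD \<partial>dC \<partial>dB \<partial>dA)"
      by (rule nn_integral_prod4[OF pA pB pC pD Fd])
    also have "\<dots> = (\<integral>\<^sup>+p. \<integral>\<^sup>+q. K p q \<partial>dB \<partial>dA)"
      using spS by (intro nn_integral_cong) (simp add: FK)
    also have "\<dots> = (\<integral>\<^sup>+p. \<integral>\<^sup>+b. K p (B b) \<partial>M \<partial>dA)"
    proof (rule nn_integral_cong)
      fix p assume "p \<in> space dA"
      then have [measurable]: "p \<in> space ?S" using spS by simp
      show "(\<integral>\<^sup>+q. K p q \<partial>dB) = (\<integral>\<^sup>+b. K p (B b) \<partial>M)"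
        unfolding dB_def using measurable_compose[OF measurable_Pair1'[OF \<open>p \<in> space ?S\<close>, of ?S] K]
        by (intro nn_integral_distr B) simp
    qed
    also have "\<dots> = (\<integral>\<^sup>+a. \<integral>\<^sup>+b. K (A a) (B b) \<partial>M \<partial>M)"
    proof -
      have "(\<lambda>x. K (fst x) (B (snd x))) \<in> borel_measurable (?S \<Otimes>\<^sub>M M)"
        using measurable_compose[of "\<lambda>x. (fst x, B (snd x))" "?S \<Otimes>\<^sub>M M" "?S \<Otimes>\<^sub>M ?S", OF _ K] by simp
      then have "(\<lambda>p. \<integral>\<^sup>+b. K p (B b) \<partial>M) \<in> borel_measurable ?S"
        by (intro borel_measurable_nn_integral) (simp add: split_beta')
      then show ?thesis unfolding dA_def by (intro nn_integral_distr A) simp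
    qed
    finally show ?thesis unfolding K_def A_def B_def by simp
  qed
  have P1': "prob {\<omega> \<in> space M. W1 \<omega> = w} = (if w \<in> {1..m1} then 1 / real m1 else 0)"
    and P2': "prob {\<omega> \<in> space M. W2 \<omega> = w} = (if w \<in> {1..m2} then 1 / real m2 else 0)" for w
    using c by blast+
  note u1 = uniform_message[OF W(1) P1'] and u2 = uniform_message[OF W(2) P2']
  have psi: "psi \<in> measurable ?L (count_space UNIV)"
    using c measurable_cong_sets[OF LV refl] by blast
  have Ymeas: "chan_Y N X1 X2 n1 \<in> measurable M ?L" "chan_Z N X1 X2 n1 n2 \<in> measurable M ?L"
    unfolding chan_Y_def chan_Z_def by (intro measurable_restrict_leb_vec; measurable)+
  have "gmac_law M N m1 m2 sig1 sig2 W1 W2 (\<lambda>\<omega>. ?r (X1 \<omega>)) (\<lambda>\<omega>. ?r (X2 \<omega>)) (chan_Y N X1 X2 n1) (chan_Z N X1 X2 n1 n2)"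
    by (intro gmac_law.intro gmac_law_axioms.intro prob_space_axioms sig u1 u2 W rL X Ymeas law)
  moreover have "(\<Sum>i<N. expectation (\<lambda>\<omega>. (X1 \<omega> i)\<^sup>2)) \<le> real N * P1" "(\<Sum>i<N. expectation (\<lambda>\<omega>. (X2 \<omega> i)\<^sup>2)) \<le> real N * P2"
    using c N by (auto simp: field_simps)
  ultimately show ?thesis
    by (intro gmac_code.intro gmac_code_axioms.intro)
      (auto simp: P psi sq n1m n2m corr Y_i Y_i' Z_i)
qed

subsection \<open>The outer bound\<close>

lemma le_of_vanishing_slack:
  fixes x c y :: real
  assumes "y \<ge> 0" and "\<And>\<epsilon>. \<epsilon> > 0 \<Longrightarrow> x \<le> c + 2 * \<epsilon> + \<epsilon> * y"
  shows "x \<le> c"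
proof (rule field_le_epsilon)
  fix e :: real assume "e > 0"
  \<comment> \<open>This \<epsilon> makes the total slack \<open>\<epsilon> * (2 + y)\<close> equal
    to \<open>e\<close>.\<close>
  then have "x \<le> c + 2 * (e / (2 + y)) + e / (2 + y) * y"
    using assms(1) by (intro assms(2)) simp
  also have "\<dots> = c + e" using assms(1) by (simp add: divide_simps) (simp add: algebra_simps)
  finally show "x \<le> c + e" .
qed

text \<open>The slack has three sources: one \<epsilon> from the equivocation, one from the Fano
  constant \<open>ln 2\<close> divided by the block length, and \<epsilon> times the rate from the
  error probability. The rates are fixed while \<epsilon> varies, so all of it can be sent to
  zero.\<close>

lemma achievable_rate_bounds:
  fixes P1 P2 sig1 sig2 :: real
  assumes P: "P1 > 0" "P2 > 0" and sig: "sig1 > 0" "sig2 > 0"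
    and ach: "achievable_gmac TYPE('a) P1 P2 sig1 sig2 R1 R2"
  defines "s1 \<equiv> sig1\<^sup>2" and "s \<equiv> sig1\<^sup>2 + sig2\<^sup>2"
  shows "0 \<le> R1" "0 \<le> R2"
    "R1 \<le> 1/2 * log 2 ((s1 + P1) * (s + P2) / (s1 * (s + P1)))"
    "R2 \<le> 1/2 * log 2 ((s1 + P2) * (s + P1) / (s1 * (s + P2)))"
    "R1 \<le> 1/2 * log 2 ((s1 + P1) / s1)"
    "R2 \<le> 1/2 * log 2 ((s1 + P2) / s1)"
    "R1 + R2 \<le> 1/2 * log 2 ((s1 + (P1 + P2)) * s / (s1 * (s + (P1 + P2))))"
proof -
  have bounds: "0 \<le> R1 \<and> 0 \<le> R2 \<and>
    R1 \<le> 1/2 * log 2 ((s1 + P1) * (s + P2) / (s1 * (s + P1))) + 2 * \<epsilon> + \<epsilon> * R1 \<and>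
    R2 \<le> 1/2 * log 2 ((s1 + P2) * (s + P1) / (s1 * (s + P2))) + 2 * \<epsilon> + \<epsilon> * R2 \<and>
    R1 \<le> 1/2 * log 2 ((s1 + P1) / s1) + 2 * \<epsilon> + \<epsilon> * R1 \<and>
    R2 \<le> 1/2 * log 2 ((s1 + P2) / s1) + 2 * \<epsilon> + \<epsilon> * R2 \<and>
    R1 + R2 \<le> 1/2 * log 2 ((s1 + (P1 + P2)) * s / (s1 * (s + (P1 + P2)))) + 2 * \<epsilon> + \<epsilon> * (R1 + R2)"
    if \<epsilon>: "\<epsilon> > 0" for \<epsilon>
  proof -
    obtain N0 where N0: "\<And>N. N \<ge> N0 \<Longrightarrow> \<exists>(M :: 'a measure) m1 m2 W1 W2 X1 X2 n1 n2 psi.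
        gmac_wt_code M N P1 P2 sig1 sig2 m1 m2 W1 W2 X1 X2 n1 n2 psi \<and>
        log 2 (real m1) / real N = R1 \<and> log 2 (real m2) / real N = R2 \<and>
        gmac_equivocation M N W1 W2 X1 X2 n1 n2 \<ge> R1 + R2 - \<epsilon> \<and>
        gmac_Pe M N W1 W2 X1 X2 n1 psi \<le> \<epsilon>"
      using ach \<epsilon> unfolding achievable_gmac_def by blast
    obtain K where K: "1 / \<epsilon> < real K" using reals_Archimedean2 by blast
    \<comment> \<open>Long enough for achievability and for 1/N to be below \<epsilon>; the
      \<open>+ 1\<close> makes \<open>N\<close> positive.\<close>
    define N where "N = max N0 K + 1"
    have N: "N > 0" "N \<ge> N0" unfolding N_def by auto
    have "1 / \<epsilon> < real N" using K unfolding N_def by simp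
    then have N\<epsilon>: "1 / real N \<le> \<epsilon>" using \<epsilon> N by (simp add: field_simps)
    obtain M :: "'a measure" and m1 m2 W1 W2 X1 X2 n1 n2 psi where
      code: "gmac_wt_code M N P1 P2 sig1 sig2 m1 m2 W1 W2 X1 X2 n1 n2 psi"
      and R1: "log 2 (real m1) / real N = R1" and R2: "log 2 (real m2) / real N = R2"
      and eq: "gmac_equivocation M N W1 W2 X1 X2 n1 n2 \<ge> R1 + R2 - \<epsilon>"
      and Pe: "gmac_Pe M N W1 W2 X1 X2 n1 psi \<le> \<epsilon>"
      using N0[OF N(2)] by blast
    interpret gmac_code M N m1 m2 sig1 sig2 W1 W2 "\<lambda>\<omega>. restrict (X1 \<omega>) {..<N}" "\<lambda>\<omega>. restrict (X2 \<omega>) {..<N}"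
      "chan_Y N X1 X2 n1" "chan_Z N X1 X2 n1 n2" P1 P2 psi
      by (rule gmac_code_of_gmac_wt_code[OF code N(1) P sig])
    have m: "real m1 \<ge> 1" "real m2 \<ge> 1" using m1_pos m2_pos by auto
    \<comment> \<open>Converts bits per channel use into nats per block.\<close>
    define T where "T = real N * ln 2"
    have T: "T > 0" unfolding T_def using N by simp
    have lm: "ln (real m1) = T * R1" "ln (real m2) = T * R2"
      unfolding T_def R1[symmetric] R2[symmetric] log_def using N by simp_all
    have R_nonneg: "0 \<le> R1" "0 \<le> R2" using R1 R2 m N by auto
    have H: "H \<ge> T * (R1 + R2 - \<epsilon>)"
    proof -
      have "gmac_equivocation M N W1 W2 X1 X2 n1 n2 = H / T"
        unfolding gmac_equivocation_def conditional_entropy_eq H_def T_def by simp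
      then have "T * (R1 + R2 - \<epsilon>) \<le> T * (H / T)" using eq T by (intro mult_left_mono) auto
      then show ?thesis using T by simp
    qed
    have perr: "perr \<le> \<epsilon>" using Pe unfolding gmac_Pe_def perr_def .
    have perr_le: "perr * (T * r) \<le> T * (\<epsilon> * r)" if "r \<ge> 0" for r
      using mult_right_mono[OF perr, of "T * r"] T that by (simp add: mult.left_commute)
    have ln2: "ln 2 \<le> T * \<epsilon>"
    proof -
      have "ln 2 = T * (1 / real N)" unfolding T_def using N by simp
      also have "\<dots> \<le> T * \<epsilon>" using N\<epsilon> T by (intro mult_left_mono) auto
      finally show ?thesis .
    qed
    have half: "real N / 2 * ln x = T * (1/2 * log 2 x)" for x
      unfolding T_def log_def by simp
    have cancel: "x \<le> y" if "T * x \<le> T * y" for x y using that T by simp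
    have lm12: "ln (real m1 * real m2) = T * (R1 + R2)"
      using m lm by (simp add: ln_mult distrib_left)
    note sum = sum_rate_nats[unfolded half lm12, folded s1_def s_def]
    note u1 = user1_rate_nats[unfolded half lm, folded s1_def s_def]
    note u2 = user2_rate_nats[unfolded half lm, folded s1_def s_def]
    note sw1 = swapped_rates_nats(1)[unfolded half lm, folded s1_def s_def]
    note sw2 = swapped_rates_nats(2)[unfolded half lm, folded s1_def s_def]
    \<comment> \<open>Here \<open>h\<close> is the bounded quantity, the equivocation or the
      logarithm of a message count, \<open>l\<close> is the Fano constant and \<open>p\<close> the
      error term.\<close>
    have slack: "x \<le> c + 2 * \<epsilon> + \<epsilon> * x"
      if "h \<le> l + p + T * c" "T * (x - \<epsilon>) \<le> h" "l \<le> T * \<epsilon>" "p \<le> T * (\<epsilon> * x)" for x c h l p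
    proof -
      have "T * (x - \<epsilon>) \<le> T * (c + \<epsilon> + \<epsilon> * x)" using that by (simp add: distrib_left)
      then show ?thesis using cancel by fastforce
    qed
    \<comment> \<open>The extra \<open>a\<close> is the other user's message entropy, which stands
      on both sides and cancels.\<close>
    have slack': "x \<le> c + 2 * \<epsilon> + \<epsilon> * x"
      if "h \<le> a + l + p + T * c" "T * (x - \<epsilon>) + a \<le> h" "l \<le> T * \<epsilon>" "p \<le> T * (\<epsilon> * x)" for x c h l p a
      using that by (intro slack[of "h - a" l p]) auto
    have H1: "T * (R1 - \<epsilon>) + T * R2 \<le> H" and H2: "T * (R2 - \<epsilon>) + T * R1 \<le> H"
      using H by (simp_all add: algebra_simps)
    \<comment> \<open>Weakens the single-user bounds, which lose nothing to equivocation, to the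
      common form of \<open>slack\<close>.\<close>
    have le: "T * (x - \<epsilon>) \<le> T * x" for x using T \<epsilon> by simp
    have "0 \<le> R1 + R2" using R_nonneg by simp
    then show ?thesis
      using slack'[OF u1 H1 ln2 perr_le[OF R_nonneg(1)]] slack'[OF sw1 H2 ln2 perr_le[OF R_nonneg(2)]]
        slack[OF sw2 le ln2 perr_le[OF R_nonneg(1)]] slack[OF u2 le ln2 perr_le[OF R_nonneg(2)]]
        slack[OF sum H ln2 perr_le] R_nonneg by blast
  qed
  show R_nonneg: "0 \<le> R1" "0 \<le> R2" using bounds[of 1] by auto
  show "R1 \<le> 1/2 * log 2 ((s1 + P1) * (s + P2) / (s1 * (s + P1)))"
    by (rule le_of_vanishing_slack[OF R_nonneg(1)]) (use bounds in blast)
  show "R2 \<le> 1/2 * log 2 ((s1 + P2) * (s + P1) / (s1 * (s + P2)))"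
    by (rule le_of_vanishing_slack[OF R_nonneg(2)]) (use bounds in blast)
  show "R1 \<le> 1/2 * log 2 ((s1 + P1) / s1)"
    by (rule le_of_vanishing_slack[OF R_nonneg(1)]) (use bounds in blast)
  show "R2 \<le> 1/2 * log 2 ((s1 + P2) / s1)"
    by (rule le_of_vanishing_slack[OF R_nonneg(2)]) (use bounds in blast)
  show "R1 + R2 \<le> 1/2 * log 2 ((s1 + (P1 + P2)) * s / (s1 * (s + (P1 + P2))))"
    by (rule le_of_vanishing_slack[OF add_nonneg_nonneg[OF R_nonneg]]) (use bounds in blast)
qed

text \<open>Here \<open>D\<close> is \<open>s1 + s2 + max P1 P2\<close>. For the user with the
  larger power the secrecy bound is the binding one; for the other user the subtracted logarithm
  vanishes and the single-user bound is what remains.\<close>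

lemma outer_region_extreme_point:
  fixes P1 P2 s1 s2 R1 R2 :: real
  assumes pos: "P1 > 0" "P2 > 0" "s1 > 0" "s2 > 0" and R: "0 \<le> R1" "0 \<le> R2"
    and b1: "R1 \<le> 1/2 * log 2 ((s1 + P1) * (s1 + s2 + P2) / (s1 * (s1 + s2 + P1)))" "R1 \<le> 1/2 * log 2 ((s1 + P1) / s1)"
    and b2: "R2 \<le> 1/2 * log 2 ((s1 + P2) * (s1 + s2 + P1) / (s1 * (s1 + s2 + P2)))" "R2 \<le> 1/2 * log 2 ((s1 + P2) / s1)"
    and b12: "R1 + R2 \<le> 1/2 * log 2 ((s1 + (P1 + P2)) * (s1 + s2) / (s1 * (s1 + s2 + (P1 + P2))))"
  shows "(R1, R2) \<in> C_out_gmac P1 P2 s1 s2"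
proof -
  have diff: "1/2 * log 2 (1 + p / s1) - 1/2 * log 2 (d / e) = 1/2 * log 2 ((s1 + p) * e / (s1 * d))"
    if "p > 0" "d > 0" "e > 0" for p d e
  proof -
    have "log 2 (1 + p / s1) - log 2 (d / e) = log 2 ((1 + p / s1) / (d / e))"
    proof (rule log_divide_pos[symmetric])
      show "1 + p / s1 > 0" "d / e > 0"
        using that pos by (smt (verit) divide_pos_pos)+
    qed
    also have "(1 + p / s1) / (d / e) = (s1 + p) * e / (s1 * d)"
    proof -
      have "1 + p / s1 = (s1 + p) / s1" using pos by (simp add: add_divide_distrib)
      then show ?thesis by simp
    qed
    finally show ?thesis by simp
  qed
  have same: "(s1 + p) * d / (s1 * d) = (s1 + p) / s1" if "d > 0" for p d :: real
    using that by simp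
  define S where "S = s1 + s2"
  define D where "D = S + max P1 P2"
  have S: "S > 0" and D: "D > 0" using pos unfolding S_def D_def by auto
  have "R1 \<le> 1/2 * log 2 (1 + P1 / s1) - 1/2 * log 2 (D / (S + P2))"
    using b1 pos S D unfolding diff[OF pos(1) D add_pos_pos[OF S pos(2)]]
    by (cases "P1 \<le> P2") (auto simp: D_def S_def[symmetric] same max_def)
  moreover have "R2 \<le> 1/2 * log 2 (1 + P2 / s1) - 1/2 * log 2 (D / (S + P1))"
    using b2 pos S D unfolding diff[OF pos(2) D add_pos_pos[OF S pos(1)]]
    by (cases "P1 \<le> P2") (auto simp: D_def S_def[symmetric] same max_def)
  moreover have "R1 + R2 \<le> 1/2 * log 2 (1 + (P1 + P2) / s1) - 1/2 * log 2 (1 + (P1 + P2) / S)"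
  proof -
    have "1 + (P1 + P2) / S = (S + (P1 + P2)) / S" using S by (simp add: field_simps)
    then show ?thesis using b12 diff[of "P1 + P2" "S + (P1 + P2)" S] pos S by (simp add: S_def)
  qed
  ultimately show ?thesis
    unfolding C_out_gmac_def Let_def S_def D_def using R
    by - (rule UN_I[of 1], simp, rule UN_I[of 1], simp, rule UN_I[of 0], simp, simp)
qed

theorem theorem2:
  fixes P1 P2 sig1 sig2 :: real
  assumes "P1 > 0" and "P2 > 0" and "sig1 > 0" and "sig2 > 0"
  shows "C_s_gmac TYPE('a) P1 P2 sig1 sig2 \<subseteq> C_out_gmac P1 P2 (sig1\<^sup>2) (sig2\<^sup>2)"
proof -
  have "(R1, R2) \<in> C_out_gmac P1 P2 (sig1\<^sup>2) (sig2\<^sup>2)"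
    if "achievable_gmac TYPE('a) P1 P2 sig1 sig2 R1 R2" for R1 R2
    using assms achievable_rate_bounds[OF assms that]
    by (intro outer_region_extreme_point) simp_all
  then show ?thesis unfolding C_s_gmac_def by auto
qed

end
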